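(* The morphism of species $$\gamma|_{\mathbf{Lie}}:\boldsymbol\Gamma^*\to\mathbf{Lie}^*\circ\boldsymbol\Gamma^*,\qquad f\mapsto\bigoplus_P\gamma_P(f)$$ is a left $\mathbf{Lie}^*$-comodule, i.e. a counital and coassociative left coaction on $\boldsymbol\Gamma^*$ of the cooperad $\mathbf{Lie}^*$ dual to the Lie operad.
   Context: **Arrangement and faces.** $\Bbbk$ is a field of characteristic zero, $I$ a finite set. A partition $P=(S_1|\dots|S_k)$ of $I$ is an unordered set of disjoint nonempty blocks with union $I$; $Q$ is finer than $P$ if every block of $Q$ is contained in a block of $P$ ($Q=P$ allowed). $(I)$ is the one-block partition; for $S\subseteq I$, ${}^IS$ is the partition of $I$ with block $S$ and all other blocks singletons. Put $T^\vee[P]=\{h\in\mathbb R I:\sum_{i\in S_j}h_i=0 \text{ for all } j\}$ and $T^\vee[I]=T^\vee[(I)]$. The adjoint braid arrangement consists of the hyperplanes $\{\sum_{i\in S}h_i=0\}$ of $T^\vee[I]$, $\emptyset\ne S\subsetneq I$. An adjoint face $X$ is (the characteristic function of) a relatively open face of this arrangement; it is determined by its sign function $s_X$, where $s_X(S)\in\{+,-,0\}$ is the sign of $\sum_{i\in S}h_i$ for $h$ in the face. Its support is its linear span. $\mathsf L^\vee[P]$ is the $\Bbbk$-vector space with basis the adjoint faces with support $T^\vee[P]$; $\mathsf L^{\vee *}[P]$ is its dual (functionals); $\mathsf L^\vee[I]:=\mathsf L^\vee[(I)]$. The natural isomorphism $T^\vee[{}^IS]\cong T^\vee[S]$ identifies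 $\mathsf L^\vee[{}^IS]$ with $\mathsf L^\vee[S]$. **External product.** For an adjoint face $X\in\mathsf L^\vee[P]$, $X|_{S_j}\in\mathsf L^\vee[{}^IS_j]=\mathsf L^\vee[S_j]$ is the adjoint face with sign $S\mapsto s_X(S\cap S_j)$ if $S\cap S_j\ne\emptyset$, and $0$ otherwise. $\mathrm{prod}_P:\bigotimes_j\mathsf L^{\vee*}[S_j]\to\mathsf L^{\vee*}[P]$ is $\mathrm{prod}_P(f_1\otimes\dots\otimes f_k)(X)=\prod_jf_j(X|_{S_j})$. A functional in $\mathsf L^{\vee*}[P]$ is semisimple if it lies in the image of $\mathrm{prod}_P$. **Forest derivative.** For $E\subseteq I$, $\mathrm{Redn}_P(E)$ is $E$ with all blocks of $P$ contained in $E$ removed; write $E=S \bmod P$ if $\mathrm{Redn}_P(E)=\mathrm{Redn}_P(S)$. A cut $\mathcal V=[C,D]:P\leftarrow Q$ is an ordered splitting of one block $S_m=C\sqcup D$ of $P$ ($C,D\neq\emptyset$), where $Q$ is $P$ with $S_m$ replaced by $C$ and $D$; $\overline{\mathcal V}=[D,C]$. For an adjoint face $X\in\mathsf L^\vee[Q]$, $X^{\mathcal V}\in\mathsf L^\vee[P]$ is the adjoint face with sign at $S$ equal to $+$ if $S=C\bmod P$, $-$ if $S=D\bmod P$, $s_X(S)$ if $S\ne\emptyset\bmod Q$, $0$ if $S=\emptyset\bmod P$. For $f\in\mathsf L^{\vee*}[P]$ set $\boldsymbol\partial_{\mathcal V}f(X)=f(X^{\mathcal V})-f(X^{\overline{\mathcal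 V}})$, in $\mathsf L^{\vee *}[Q]$. A layered forest $\mathcal F:P\leftarrow Q$ is a family of planar full binary trees, one over each block $S_j$ of $P$ with leaves labelled bijectively by the blocks of $Q$ contained in $S_j$, with a linear order on all the (internal) nodes in which each node precedes its descendants. Equivalently it is a sequence of successive cuts $\mathcal F=\mathcal V_1\circ\dots\circ\mathcal V_l$ in the order of the nodes (from $P$ to $Q$; left child $C$, right child $D$). Set $\boldsymbol\partial_{\mathcal F}f=\boldsymbol\partial_{\mathcal V_l}(\cdots(\boldsymbol\partial_{\mathcal V_1}f)\cdots)$; if $l=0$ (sticks) this is the identity. **The species $\boldsymbol\Gamma^*$.** $f\in\mathsf L^{\vee*}[P]$ is semisimply differentiable if $\boldsymbol\partial_{\mathcal F}f$ is semisimple for all layered forests $\mathcal F$ over $P$; $\boldsymbol\Gamma^*[P]$ is the space of such $f$. $\boldsymbol\Gamma^*[I]:=\boldsymbol\Gamma^*[(I)]$, $\boldsymbol\Gamma^*[\emptyset]=0$. This is a vector species. $\mathrm{prod}_P$ restricts to an isomorphism $\mathrm{prod}_P|_{\boldsymbol\Gamma}:\bigotimes_j\boldsymbol\Gamma^*[S_j]\to\boldsymbol\Gamma^*[P]$. **The coaction.** $\mathbf{Lay}[I]$ is the vector space spanned by layered trees over $I$ with leaves labelled by singletons ($\mathbf{Lay}[\emptyset]=0$). For a partition $P$ of $I$, viewed as the finite set of its blocks, $\mathbf{Lay}[P]$ has basis the layered trees $\mathcal T:(I)\leftarrow P$; $\{\mathcal T^*\}$ denotes the dual basis of $\mathbf{Lay}^*[P]$.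 For such $\mathcal T$ with $P=(S_1|\dots|S_k)$ put $\partial_{\mathcal T}=(\mathrm{prod}_P|_{\boldsymbol\Gamma})^{-1}\circ\boldsymbol\partial_{\mathcal T}:\boldsymbol\Gamma^*[I]\to\bigotimes_j\boldsymbol\Gamma^*[S_j]$. For $f\in\boldsymbol\Gamma^*[I]$ put $\gamma_P(f)=\sum_{\mathcal T}\mathcal T^*\otimes\partial_{\mathcal T}f$, the sum over layered trees $\mathcal T\in\mathbf{Lay}[P]$. $\mathbf{Lie}$ is the positive Lie operad, represented as $\mathbf{Lay}$ modulo antisymmetry, the Jacobi identity, and identifying layered trees that differ only in their layering; operadic composition is grafting of trees at leaves, and the unit is the stick. Thus $\mathbf{Lie}^*\hookrightarrow\mathbf{Lay}^*$, hence $\mathbf{Lie}^*\circ\boldsymbol\Gamma^*\hookrightarrow\mathbf{Lay}^*\circ\boldsymbol\Gamma^*$, and the map $f\mapsto\bigoplus_P\gamma_P(f)$ takes values in the image of this embedding; $\gamma|_{\mathbf{Lie}}$ is the resulting map to $\mathbf{Lie}^*\circ\boldsymbol\Gamma^*$. Composition of species (second factor positive): $(\mathbf p\circ\mathbf q)[I]=\bigoplus_P\big(\mathbf p[P]\otimes\bigotimes_j\mathbf q[S_j]\big)$, the sum over partitions $P=(S_1|\dots|S_k)$ of $I$. *)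

theory Defs
  imports
    Complex_Main
    "HOL-Library.Disjoint_Sets"
    "HOL-Library.FuncSet"
    "HOL-Library.Function_Algebras"
begin

section \<open>Function spaces and their tensor products\<close>

text \<open>
  Each vector space below is finite dimensional and is a space of \<open>'k\<close>-valued functions
  vanishing outside a given finite set. The dual of the vector space with basis \<open>X\<close> is the space
  of functions vanishing outside \<open>X\<close>.
\<close>

definition fscale :: "'k::field \<Rightarrow> ('x \<Rightarrow> 'k) \<Rightarrow> 'x \<Rightarrow> 'k" where
  "fscale c f = (\<lambda>x. c * f x)"

global_interpretation fun_vs: vector_space "fscale :: 'k::field \<Rightarrow> ('x \<Rightarrow> 'k) \<Rightarrow> 'x \<Rightarrow> 'k"
  by unfold_locales (auto simp: fscale_def fun_eq_iff algebra_simps)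

definition dual_on :: "'x set \<Rightarrow> ('x \<Rightarrow> 'k::field) set" where
  "dual_on X = {f. \<forall>x. x \<notin> X \<longrightarrow> f x = 0}"

definition linear_on :: "('x \<Rightarrow> 'k::field) set \<Rightarrow> (('x \<Rightarrow> 'k) \<Rightarrow> ('y \<Rightarrow> 'k)) \<Rightarrow> bool" where
  "linear_on V L \<longleftrightarrow>
     (\<forall>u\<in>V. \<forall>v\<in>V. L (u + v) = L u + L v) \<and> (\<forall>c. \<forall>v\<in>V. L (fscale c v) = fscale c (L v))"

text \<open>
  If \<open>V j\<close> consists of functions vanishing outside \<open>X j\<close>, the tensor product of the \<open>V j\<close> is
  realized inside the functions vanishing outside \<open>PiE J X\<close>: a pure tensor is the function
  \<open>x \<mapsto> (\<Prod>j\<in>J. f j (x j))\<close>.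
\<close>

definition pure_tensor :: "'j set \<Rightarrow> ('j \<Rightarrow> 'x \<Rightarrow> 'k::field) \<Rightarrow> ('j \<Rightarrow> 'x) \<Rightarrow> 'k" where
  "pure_tensor J f = (\<lambda>x. if x \<in> extensional J then \<Prod>j\<in>J. f j (x j) else 0)"

definition tensor :: "'j set \<Rightarrow> ('j \<Rightarrow> ('x \<Rightarrow> 'k::field) set) \<Rightarrow> (('j \<Rightarrow> 'x) \<Rightarrow> 'k) set" where
  "tensor J V = fun_vs.span {pure_tensor J f |f. \<forall>j\<in>J. f j \<in> V j}"

definition tensor2 ::
    "('x \<Rightarrow> 'k::field) set \<Rightarrow> ('y \<Rightarrow> 'k) set \<Rightarrow> ('x \<times> 'y \<Rightarrow> 'k) set" where
  "tensor2 U V = fun_vs.span {\<lambda>(x, y). u x * v y |u v. u \<in> U \<and> v \<in> V}"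

text \<open>
  The linear map induced on the tensor product by linear maps \<open>\<eta> j\<close> on the \<open>V j\<close>; on
  \<open>tensor J V\<close> it is unique, and it exists by the lemma \<open>tensor_map\<close> below.
\<close>

definition is_tensor_map ::
    "'j set \<Rightarrow> ('j \<Rightarrow> ('x \<Rightarrow> 'k::field) set) \<Rightarrow> ('j \<Rightarrow> ('x \<Rightarrow> 'k) \<Rightarrow> ('y \<Rightarrow> 'k)) \<Rightarrow>
     ((('j \<Rightarrow> 'x) \<Rightarrow> 'k) \<Rightarrow> (('j \<Rightarrow> 'y) \<Rightarrow> 'k)) \<Rightarrow> bool" where
  "is_tensor_map J V \<eta> L \<longleftrightarrow>
     linear_on (tensor J V) L \<and>
     (\<forall>f. (\<forall>j\<in>J. f j \<in> V j) \<longrightarrow> L (pure_tensor J f) = pure_tensor J (\<lambda>j. \<eta> j (f j)))"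

definition tensor_map ::
    "'j set \<Rightarrow> ('j \<Rightarrow> ('x \<Rightarrow> 'k::field) set) \<Rightarrow> ('j \<Rightarrow> ('x \<Rightarrow> 'k) \<Rightarrow> ('y \<Rightarrow> 'k)) \<Rightarrow>
     (('j \<Rightarrow> 'x) \<Rightarrow> 'k) \<Rightarrow> (('j \<Rightarrow> 'y) \<Rightarrow> 'k)" where
  "tensor_map J V \<eta> = (SOME L. is_tensor_map J V \<eta> L)"

lemma sum_fun_apply: "(\<Sum>a\<in>A. f a) x = (\<Sum>a\<in>A. f a x :: 'k::comm_monoid_add)"
  by (induction A rule: infinite_finite_induct) auto

lemma linear_on_extend:
  fixes V :: "('x \<Rightarrow> 'k::field) set" and L :: "('x \<Rightarrow> 'k) \<Rightarrow> ('y \<Rightarrow> 'k)"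
  assumes V: "fun_vs.subspace V" and L: "linear_on V L"
  shows "\<exists>M. linear_on UNIV M \<and> (\<forall>v\<in>V. M v = L v)"
proof -
  interpret vp: vector_space_pair "fscale :: 'k \<Rightarrow> ('x \<Rightarrow> 'k) \<Rightarrow> 'x \<Rightarrow> 'k"
      "fscale :: 'k \<Rightarrow> ('y \<Rightarrow> 'k) \<Rightarrow> 'y \<Rightarrow> 'k"
    by unfold_locales
  obtain B where B: "B \<subseteq> V" "fun_vs.independent B" "V \<subseteq> fun_vs.span B"
    using fun_vs.maximal_independent_subset[of V] by blast
  obtain M where M: "Vector_Spaces.linear fscale fscale M" "\<forall>x\<in>B. M x = L x"
    using vp.linear_independent_extend[OF B(2), of L] by blast
  have lin: "linear_on UNIV M"
    using M(1) unfolding linear_on_def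
    by (simp add: vp.linear_add[OF M(1)] vp.linear_scale[OF M(1)])
  have L0: "L 0 = 0"
  proof -
    have "L (fscale 0 0) = fscale 0 (L 0)"
      using L V fun_vs.subspace_0[OF V] unfolding linear_on_def by blast
    then show ?thesis by simp
  qed
  have "v \<in> V \<and> M v = L v" if "v \<in> fun_vs.span B" for v
    using that
  proof (induction rule: fun_vs.span_induct_alt)
    case base
    show ?case by (simp only: L0 vp.linear_0[OF M(1)] fun_vs.subspace_0[OF V] simp_thms)
  next
    case (step c x y)
    have "x \<in> V" using step B by blast
    moreover have "fscale c x \<in> V" using \<open>x \<in> V\<close> V by (simp add: fun_vs.subspace_scale)
    moreover have "fscale c x + y \<in> V"
      using calculation step V by (simp add: fun_vs.subspace_add)
    moreover have "M (fscale c x + y) = fscale c (M x) + M y"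
      using lin unfolding linear_on_def by (metis UNIV_I)
    moreover have "L (fscale c x + y) = fscale c (L x) + L y"
      using calculation step L unfolding linear_on_def by metis
    ultimately show ?case using step M(2) by metis
  qed
  then show ?thesis using lin B(3) by blast
qed

lemma tensor_map:
  fixes V :: "'j \<Rightarrow> ('x \<Rightarrow> 'k::field) set" and \<eta> :: "'j \<Rightarrow> ('x \<Rightarrow> 'k) \<Rightarrow> ('y \<Rightarrow> 'k)"
  assumes J: "finite J"
    and X: "\<And>j. j \<in> J \<Longrightarrow> finite (X j) \<and> V j \<subseteq> dual_on (X j)"
    and V: "\<And>j. j \<in> J \<Longrightarrow> fun_vs.subspace (V j)"
    and \<eta>: "\<And>j. j \<in> J \<Longrightarrow> linear_on (V j) (\<eta> j)"
  shows "is_tensor_map J V \<eta> (tensor_map J V \<eta>)"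
proof -
  have "\<forall>j\<in>J. \<exists>M. linear_on UNIV M \<and> (\<forall>v\<in>V j. M v = \<eta> j v)"
    using linear_on_extend[OF V \<eta>] by blast
  then obtain M where M: "\<And>j. j \<in> J \<Longrightarrow> linear_on UNIV (M j)"
      "\<And>j v. j \<in> J \<Longrightarrow> v \<in> V j \<Longrightarrow> M j v = \<eta> j v"
    by (auto simp: bchoice_iff)
  define d :: "'x \<Rightarrow> 'x \<Rightarrow> 'k" where "d x = (\<lambda>x'. if x' = x then 1 else 0)" for x
  have M_sum: "M j (\<Sum>x\<in>A. fscale (c x) (d x)) = (\<Sum>x\<in>A. fscale (c x) (M j (d x)))"
    if "j \<in> J" "finite A" for j A c
  proof -
    have add: "M j (u + v) = M j u + M j v" and sc: "M j (fscale a u) = fscale a (M j u)" for u v a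
      using M(1)[OF that(1)] unfolding linear_on_def by auto
    have "M j 0 = 0"
      using sc[of 0 0] by (simp add: fscale_def fun_eq_iff zero_fun_def)
    with that(2) show ?thesis
      by (induction A rule: finite_induct) (auto simp: add sc)
  qed
  have exp: "\<eta> j f y = (\<Sum>x\<in>X j. f x * M j (d x) y)" if "j \<in> J" "f \<in> V j" for j f y
  proof -
    have "f = (\<Sum>x\<in>X j. fscale (f x) (d x))"
    proof
      fix z
      have "(\<Sum>x\<in>X j. fscale (f x) (d x)) z = (\<Sum>x\<in>X j. if z = x then f x else 0)"
        by (subst sum_fun_apply) (auto simp: fscale_def d_def intro!: sum.cong)
      also have "\<dots> = f z"
        using X[OF that(1)] that(2) by (auto simp: dual_on_def)
      finally show "f z = (\<Sum>x\<in>X j. fscale (f x) (d x)) z" by simp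
    qed
    then have "\<eta> j f = (\<Sum>x\<in>X j. fscale (f x) (M j (d x)))"
      using M(2)[OF that] M_sum[OF that(1), of "X j" f] X[OF that(1)] by simp
    then show ?thesis by (simp add: fscale_def sum_fun_apply)
  qed
  define L :: "(('j \<Rightarrow> 'x) \<Rightarrow> 'k) \<Rightarrow> (('j \<Rightarrow> 'y) \<Rightarrow> 'k)" where
    "L t = (\<lambda>y. if y \<in> extensional J
       then \<Sum>x\<in>PiE J X. t x * (\<Prod>j\<in>J. M j (d (x j)) (y j)) else 0)" for t
  have "linear_on (tensor J V) L"
    unfolding linear_on_def L_def
    by (auto simp: fun_eq_iff fscale_def algebra_simps sum.distrib sum_distrib_left)
  moreover have "L (pure_tensor J f) = pure_tensor J (\<lambda>j. \<eta> j (f j))" if f: "\<forall>j\<in>J. f j \<in> V j" for f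
  proof
    fix y
    show "L (pure_tensor J f) y = pure_tensor J (\<lambda>j. \<eta> j (f j)) y"
    proof (cases "y \<in> extensional J")
      case True
      have "pure_tensor J (\<lambda>j. \<eta> j (f j)) y = (\<Prod>j\<in>J. \<Sum>x\<in>X j. f j x * M j (d x) (y j))"
        using True f exp by (auto simp: pure_tensor_def intro!: prod.cong)
      also have "\<dots> = (\<Sum>x\<in>PiE J X. \<Prod>j\<in>J. f j (x j) * M j (d (x j)) (y j))"
        using J X by (subst prod_sum_PiE) auto
      also have "\<dots> = L (pure_tensor J f) y"
        using True by (auto simp: L_def pure_tensor_def PiE_def prod.distrib intro!: sum.cong)
      finally show ?thesis by simp
    qed (simp add: L_def pure_tensor_def)
  qed
  ultimately have "is_tensor_map J V \<eta> L" unfolding is_tensor_map_def by blast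
  then show ?thesis unfolding tensor_map_def by (metis someI)
qed

section \<open>The adjoint braid arrangement\<close>

text \<open>
  A face is represented by its sign function, with the signs \<open>+, -, 0\<close> encoded as \<open>1, -1, 0\<close> and
  the value \<open>0\<close> outside the subsets of the ground set. The ground set of a partition \<open>P\<close> is \<open>\<Union>P\<close>.
\<close>

type_synonym 'a face = "'a set \<Rightarrow> real"

definition Tvee :: "'a set set \<Rightarrow> ('a \<Rightarrow> real) set" where
  "Tvee P = {h. (\<forall>i. i \<notin> \<Union>P \<longrightarrow> h i = 0) \<and> (\<forall>S\<in>P. sum h S = 0)}"

definition sign_fun :: "'a set \<Rightarrow> ('a \<Rightarrow> real) \<Rightarrow> 'a face" where
  "sign_fun I h = (\<lambda>S. if S \<subseteq> I then sgn (sum h S) else 0)"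

definition cone :: "'a set \<Rightarrow> 'a face \<Rightarrow> ('a \<Rightarrow> real) set" where
  "cone I X = {h \<in> Tvee {I}. sign_fun I h = X}"

definition adjoint_faces :: "'a set \<Rightarrow> 'a face set" where
  "adjoint_faces I = {X. cone I X \<noteq> {}}"

definition support :: "'a set \<Rightarrow> 'a face \<Rightarrow> ('a \<Rightarrow> real) set" where
  "support I X = fun_vs.span (cone I X)"

definition faces :: "'a set set \<Rightarrow> 'a face set" where
  "faces P = {X \<in> adjoint_faces (\<Union>P). support (\<Union>P) X = Tvee P}"

definition L_dual :: "'a set set \<Rightarrow> ('a face \<Rightarrow> 'k::field) set" where
  "L_dual P = dual_on (faces P)"

section \<open>External product\<close>

text \<open>The face \<open>X|\<^sub>S\<close>, already regarded as a face over the ground set \<open>S\<close>.\<close>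

definition face_restrict :: "'a face \<Rightarrow> 'a set \<Rightarrow> 'a face" where
  "face_restrict X S = (\<lambda>E. if E \<subseteq> S then X E else 0)"

definition ext_prod :: "'a set set \<Rightarrow> (('a set \<Rightarrow> 'a face) \<Rightarrow> 'k::field) \<Rightarrow> 'a face \<Rightarrow> 'k" where
  "ext_prod P t = (\<lambda>X. if X \<in> faces P then t (restrict (face_restrict X) P) else 0)"

lemma ext_prod_pure_tensor:
  assumes "X \<in> faces P"
  shows "ext_prod P (pure_tensor P f) X = (\<Prod>S\<in>P. f S (face_restrict X S))"
  using assms by (auto simp: ext_prod_def pure_tensor_def intro!: prod.cong)

definition semisimple :: "'a set set \<Rightarrow> ('a face \<Rightarrow> 'k::field) \<Rightarrow> bool" where
  "semisimple P f \<longleftrightarrow> f \<in> ext_prod P ` tensor P (\<lambda>S. L_dual {S})"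

section \<open>Cuts, layered forests and the forest derivative\<close>

type_synonym 'a cut = "'a set \<times> 'a set"

definition is_cut :: "'a set set \<Rightarrow> 'a cut \<Rightarrow> bool" where
  "is_cut P V \<longleftrightarrow>
     (case V of (C, D) \<Rightarrow> C \<noteq> {} \<and> D \<noteq> {} \<and> C \<inter> D = {} \<and> C \<union> D \<in> P)"

definition apply_cut :: "'a set set \<Rightarrow> 'a cut \<Rightarrow> 'a set set" where
  "apply_cut P V = (case V of (C, D) \<Rightarrow> (P - {C \<union> D}) \<union> {C, D})"

definition redn :: "'a set set \<Rightarrow> 'a set \<Rightarrow> 'a set" where
  "redn P E = E - \<Union>{S \<in> P. S \<subseteq> E}"

text \<open>
  The four cases of \<open>X\<^sup>V\<close> are exclusive and exhaustive for \<open>S \<subseteq> \<Union>P\<close>, so the last one, \<open>0\<close> if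
  \<open>redn P S = {}\<close>, is left as the default.
\<close>

definition face_cut :: "'a set set \<Rightarrow> 'a cut \<Rightarrow> 'a face \<Rightarrow> 'a face" where
  "face_cut P V X = (\<lambda>S.
     if \<not> S \<subseteq> \<Union>P then 0
     else if redn P S = redn P (fst V) then 1
     else if redn P S = redn P (snd V) then -1
     else if redn (apply_cut P V) S \<noteq> {} then X S
     else 0)"

definition cut_deriv :: "'a set set \<Rightarrow> 'a cut \<Rightarrow> ('a face \<Rightarrow> 'k::field) \<Rightarrow> 'a face \<Rightarrow> 'k" where
  "cut_deriv P V f = (\<lambda>X.
     if X \<in> faces (apply_cut P V) then f (face_cut P V X) - f (face_cut P (prod.swap V) X) else 0)"

text \<open>
  A layered forest is represented by its sequence of successive cuts: the entry \<open>(C, D)\<close> is the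
  node whose left and right subtrees have leaf sets \<open>C\<close> and \<open>D\<close>, and the nodes are listed in the
  linear order. The underlying planar forest is therefore determined by the set of entries.
\<close>

type_synonym 'a forest = "'a cut list"

fun is_forest :: "'a set set \<Rightarrow> 'a forest \<Rightarrow> bool" where
  "is_forest P [] \<longleftrightarrow> True"
| "is_forest P (V # F) \<longleftrightarrow> is_cut P V \<and> is_forest (apply_cut P V) F"

definition leaves :: "'a set set \<Rightarrow> 'a forest \<Rightarrow> 'a set set" where
  "leaves P F = foldl apply_cut P F"

fun forest_deriv :: "'a set set \<Rightarrow> 'a forest \<Rightarrow> ('a face \<Rightarrow> 'k::field) \<Rightarrow> 'a face \<Rightarrow> 'k" where
  "forest_deriv P [] f = f"
| "forest_deriv P (V # F) f = forest_deriv (apply_cut P V) F (cut_deriv P V f)"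

text \<open>\<open>Gamma_part P\<close> is \<open>\<Gamma>\<^sup>*[P]\<close> for a partition \<open>P\<close>; \<open>Gamma I\<close> is \<open>\<Gamma>\<^sup>*[I]\<close> for a set \<open>I\<close>.\<close>

definition Gamma_part :: "'a set set \<Rightarrow> ('a face \<Rightarrow> 'k::field) set" where
  "Gamma_part P =
     {f \<in> L_dual P. \<forall>F. is_forest P F \<longrightarrow> semisimple (leaves P F) (forest_deriv P F f)}"

definition Gamma :: "'a set \<Rightarrow> ('a face \<Rightarrow> 'k::field) set" where
  "Gamma I = (if I = {} then {0} else Gamma_part {I})"

section \<open>Composition of species\<close>

text \<open>
  A species is given by its spaces \<open>p I\<close> of functions. An element of \<open>(p \<circ> q)[I]\<close> is
  a function of triples \<open>(P, t, x)\<close>, where \<open>P\<close> selects the direct summand, \<open>t\<close> is an argument for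
  \<open>p[P]\<close> and \<open>x S\<close> is an argument for \<open>q[S]\<close>. The set of blocks of \<open>P\<close> has type \<open>'a set set\<close>, so
  \<open>p\<close> is used at a different type than \<open>q\<close>.
\<close>

definition species_comp ::
    "('a set set \<Rightarrow> ('x \<Rightarrow> 'k::field) set) \<Rightarrow> ('a set \<Rightarrow> ('y \<Rightarrow> 'k) set) \<Rightarrow>
     'a set \<Rightarrow> ('a set set \<times> 'x \<times> ('a set \<Rightarrow> 'y) \<Rightarrow> 'k) set" where
  "species_comp p q I = {F. \<forall>P. if partition_on I P
      then (\<lambda>(t, x). F (P, t, x)) \<in> tensor2 (p P) (tensor P q)
      else \<forall>t x. F (P, t, x) = 0}"

text \<open>
  The maps \<open>\<eta> \<circ> id\<close> and \<open>id \<circ> \<theta>\<close>. For \<open>u \<in> U \<otimes> W\<close>, realized as a function of two arguments,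
  \<open>\<eta> \<otimes> id\<close> acts by applying \<open>\<eta>\<close> to \<open>u\<close> as a function of the first argument, for each fixed
  second one, and likewise for \<open>id \<otimes> \<theta>\<close>.
\<close>

definition comp_map_left ::
    "'a set \<Rightarrow> ('a set set \<Rightarrow> ('x \<Rightarrow> 'k::field) \<Rightarrow> ('z \<Rightarrow> 'k)) \<Rightarrow>
     ('a set set \<times> 'x \<times> ('a set \<Rightarrow> 'y) \<Rightarrow> 'k) \<Rightarrow> ('a set set \<times> 'z \<times> ('a set \<Rightarrow> 'y) \<Rightarrow> 'k)" where
  "comp_map_left I \<eta> F = (\<lambda>(P, t, x). if partition_on I P then \<eta> P (\<lambda>s. F (P, s, x)) t else 0)"

definition comp_map_right ::
    "'a set \<Rightarrow> ('a set \<Rightarrow> ('y \<Rightarrow> 'k::field) set) \<Rightarrow> ('a set \<Rightarrow> ('y \<Rightarrow> 'k) \<Rightarrow> ('z \<Rightarrow> 'k)) \<Rightarrow>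
     ('a set set \<times> 'x \<times> ('a set \<Rightarrow> 'y) \<Rightarrow> 'k) \<Rightarrow> ('a set set \<times> 'x \<times> ('a set \<Rightarrow> 'z) \<Rightarrow> 'k)" where
  "comp_map_right I q \<theta> F =
     (\<lambda>(P, t, x). if partition_on I P then tensor_map P q \<theta> (\<lambda>y. F (P, t, y)) x else 0)"

text \<open>The set on which the elements of \<open>(p \<circ> q)[I]\<close> live if \<open>p[P]\<close> and \<open>q[S]\<close> live on \<open>X P\<close>, \<open>Y S\<close>.\<close>

definition comp_dom ::
    "('a set set \<Rightarrow> 'x set) \<Rightarrow> ('a set \<Rightarrow> 'y set) \<Rightarrow>
     'a set \<Rightarrow> ('a set set \<times> 'x \<times> ('a set \<Rightarrow> 'y)) set" where
  "comp_dom X Y I = {(P, t, x). partition_on I P \<and> t \<in> X P \<and> x \<in> PiE P Y}"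

section \<open>Layered trees and the cooperad dual to the Lie operad\<close>

definition layered_trees :: "'a set \<Rightarrow> 'a forest set" where
  "layered_trees I = {T. I \<noteq> {} \<and> is_forest {I} T \<and> leaves {I} T = {{i} |i. i \<in> I}}"

definition Lay_dual :: "'a set \<Rightarrow> ('a forest \<Rightarrow> 'k::field) set" where
  "Lay_dual I = dual_on (layered_trees I)"

definition dual_basis :: "'x \<Rightarrow> 'x \<Rightarrow> 'k::field" where
  "dual_basis T = (\<lambda>T'. if T' = T then 1 else 0)"

text \<open>
  Generators of the relations of \<open>Lie[I]\<close> in \<open>Lay[I]\<close>, the elements of \<open>Lay[I]\<close> being given by
  their coefficients: antisymmetry, Jacobi identity, independence of the layering. By the latter,
  the Jacobi identity is only needed for a node whose left child is next in the linear order.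
\<close>

definition Lie_relations :: "'a set \<Rightarrow> ('a forest \<Rightarrow> 'k::field) set" where
  "Lie_relations I =
     {dual_basis (xs @ [(C, D)] @ ys) + dual_basis (xs @ [(D, C)] @ ys) |xs C D ys.
        xs @ [(C, D)] @ ys \<in> layered_trees I}
   \<union> {dual_basis (xs @ [(A \<union> B, C), (A, B)] @ ys)
       + dual_basis (xs @ [(B \<union> C, A), (B, C)] @ ys)
       + dual_basis (xs @ [(C \<union> A, B), (C, A)] @ ys) |xs A B C ys.
        xs @ [(A \<union> B, C), (A, B)] @ ys \<in> layered_trees I}
   \<union> {dual_basis T - dual_basis T' |T T'.
        T \<in> layered_trees I \<and> T' \<in> layered_trees I \<and> set T = set T'}"

text \<open>The dual of the quotient \<open>Lie[I]\<close> of \<open>Lay[I]\<close>, embedded in \<open>Lay\<^sup>*[I]\<close>.\<close>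

definition Lie_dual :: "'a set \<Rightarrow> ('a forest \<Rightarrow> 'k::field) set" where
  "Lie_dual I =
     {\<phi> \<in> Lay_dual I. \<forall>r\<in>Lie_relations I. (\<Sum>T\<in>layered_trees I. r T * \<phi> T) = 0}"

definition map_tree :: "('a \<Rightarrow> 'b) \<Rightarrow> 'a forest \<Rightarrow> 'b forest" where
  "map_tree g T = map (\<lambda>(C, D). (g ` C, g ` D)) T"

text \<open>
  A layered tree over the set of blocks of a partition \<open>P\<close> of \<open>I\<close>, regarded as a layered forest
  from the one-block partition of \<open>I\<close> to \<open>P\<close>.
\<close>

definition flatten :: "'a set forest \<Rightarrow> 'a forest" where
  "flatten T = map (\<lambda>(C, D). (\<Union>C, \<Union>D)) T"

text \<open>
  Grafting of the trees \<open>U S\<close> at the leaves \<open>S\<close> of \<open>T\<close>. The nodes of \<open>T\<close> come first, followed by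
  those of the \<open>U S\<close>, one tree after the other. The class in \<open>Lie\<close> does not depend on this choice
  of a layering.
\<close>

definition graft :: "'a set set \<Rightarrow> 'a set forest \<Rightarrow> ('a set \<Rightarrow> 'a forest) \<Rightarrow> 'a forest" where
  "graft P T U = flatten T @ concat (map U (SOME Ss. distinct Ss \<and> set Ss = P))"

text \<open>The cooperad structure: the transposes of grafting and of the inclusion of the stick.\<close>

definition Lie_decomp ::
    "'a set \<Rightarrow> ('a forest \<Rightarrow> 'k::field) \<Rightarrow>
     ('a set set \<times> 'a set forest \<times> ('a set \<Rightarrow> 'a forest) \<Rightarrow> 'k)" where
  "Lie_decomp I \<phi> = (\<lambda>(P, T, U).
     if (P, T, U) \<in> comp_dom layered_trees layered_trees I then \<phi> (graft P T U) else 0)"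

text \<open>The unit species is \<open>unit \<Rightarrow> 'k\<close> on singletons and \<open>0\<close> on other sets.\<close>

definition Lie_counit :: "'a set \<Rightarrow> ('a forest \<Rightarrow> 'k::field) \<Rightarrow> (unit \<Rightarrow> 'k)" where
  "Lie_counit I \<phi> = (\<lambda>_. if card I = 1 then \<phi> [] else 0)"

text \<open>
  The structure isomorphisms \<open>(X \<circ> q)[I] \<cong> q[I]\<close> for the unit species \<open>X\<close>, and
  \<open>((Lie\<^sup>* \<circ> Lie\<^sup>*) \<circ> q)[I] \<cong> (Lie\<^sup>* \<circ> (Lie\<^sup>* \<circ> q))[I]\<close>, where \<open>q[S]\<close> lives on \<open>Y S\<close>. In the latter, a
  partition \<open>P\<close> of \<open>I\<close> with a partition \<open>fst (y S)\<close> of each block \<open>S\<close> corresponds to the partition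
  \<open>Q\<close> of \<open>I\<close> into all the smaller blocks together with a partition \<open>\<P>\<close> of \<open>Q\<close>; the element of
  \<open>\<P>\<close> corresponding to \<open>S \<in> P\<close> is \<open>fst (y S)\<close>, and that corresponding to \<open>B \<in> \<P>\<close> is \<open>\<Union>B\<close>.
\<close>

definition left_unitor ::
    "'a set \<Rightarrow> ('a set set \<times> unit \<times> ('a set \<Rightarrow> 'y) \<Rightarrow> 'k::field) \<Rightarrow> 'y \<Rightarrow> 'k" where
  "left_unitor I F = (\<lambda>x. F ({I}, (), \<lambda>S\<in>{I}. x))"

definition Lie_assoc ::
    "('a set \<Rightarrow> 'y set) \<Rightarrow> 'a set \<Rightarrow>
     ('a set set \<times> ('a set set set \<times> 'a set set forest \<times> ('a set set \<Rightarrow> 'a set forest))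
        \<times> ('a set \<Rightarrow> 'y) \<Rightarrow> 'k::field) \<Rightarrow>
     ('a set set \<times> 'a set forest
        \<times> ('a set \<Rightarrow> 'a set set \<times> 'a set forest \<times> ('a set \<Rightarrow> 'y)) \<Rightarrow> 'k)" where
  "Lie_assoc Y I F = (\<lambda>(P, T, y).
     if (P, T, y) \<in> comp_dom layered_trees (comp_dom layered_trees Y) I then
       let part = (\<lambda>S. fst (y S));
           tree = (\<lambda>S. fst (snd (y S)));
           arg = (\<lambda>S. snd (snd (y S)));
           Q = (\<Union>S\<in>P. part S);
           \<P> = part ` P;
           block = (\<lambda>R. THE S. S \<in> P \<and> R \<subseteq> S)
       in F (Q, (\<P>, map_tree part T, \<lambda>B\<in>\<P>. tree (\<Union>B)), \<lambda>R\<in>Q. arg (block R) R)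
     else 0)"

section \<open>The coaction\<close>

text \<open>\<open>T\<close> is a layered tree over the set of blocks of the partition \<open>P\<close> of \<open>I\<close>.\<close>

definition tree_deriv ::
    "'a set \<Rightarrow> 'a set set \<Rightarrow> 'a set forest \<Rightarrow> ('a face \<Rightarrow> 'k::field) \<Rightarrow>
     (('a set \<Rightarrow> 'a face) \<Rightarrow> 'k)" where
  "tree_deriv I P T f =
     the_inv_into (tensor P Gamma) (ext_prod P) (forest_deriv {I} (flatten T) f)"

definition coaction ::
    "'a set \<Rightarrow> ('a face \<Rightarrow> 'k::field) \<Rightarrow>
     ('a set set \<times> 'a set forest \<times> ('a set \<Rightarrow> 'a face) \<Rightarrow> 'k)" where
  "coaction I f = (\<lambda>(P, t, x).
     if partition_on I P then \<Sum>T\<in>layered_trees P. dual_basis T t * tree_deriv I P T f x else 0)"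

section \<open>Relabelling\<close>

text \<open>
  The maps induced by a bijection \<open>\<sigma>\<close> from \<open>I\<close> to \<open>J\<close>: faces, partitions and trees over \<open>J\<close> are
  transported back to \<open>I\<close>.
\<close>

definition pull_face :: "('a \<Rightarrow> 'b) \<Rightarrow> 'a set \<Rightarrow> 'b face \<Rightarrow> 'a face" where
  "pull_face \<sigma> I Y = (\<lambda>S. if S \<subseteq> I then Y (\<sigma> ` S) else 0)"

definition Gamma_relabel ::
    "('a \<Rightarrow> 'b) \<Rightarrow> 'a set \<Rightarrow> 'b set \<Rightarrow> ('a face \<Rightarrow> 'k::field) \<Rightarrow> ('b face \<Rightarrow> 'k)" where
  "Gamma_relabel \<sigma> I J f = (\<lambda>Y. if Y \<in> faces {J} then f (pull_face \<sigma> I Y) else 0)"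

definition Lie_Gamma_relabel ::
    "('a \<Rightarrow> 'b) \<Rightarrow> 'a set \<Rightarrow> 'b set \<Rightarrow>
     ('a set set \<times> 'a set forest \<times> ('a set \<Rightarrow> 'a face) \<Rightarrow> 'k::field) \<Rightarrow>
     ('b set set \<times> 'b set forest \<times> ('b set \<Rightarrow> 'b face) \<Rightarrow> 'k)" where
  "Lie_Gamma_relabel \<sigma> I J F = (\<lambda>(P, T, y).
     if (P, T, y) \<in> comp_dom layered_trees (\<lambda>S. faces {S}) J then
       let pull = (\<lambda>S. inv_into I \<sigma> ` S)
       in F (pull ` P, map_tree pull T, \<lambda>S\<in>pull ` P. pull_face \<sigma> S (y (\<sigma> ` S)))
     else 0)"

end

theory Submission
  imports Defs
begin

text \<open>
  A functional is semisimple iff its value on a face depends only on the restrictions of the face to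
  the blocks, because faces over the blocks can be glued by perturbing one generic vector by a small
  multiple of another. Two cuts of different blocks then commute on semisimple functionals, which
  makes the derivative along a forest independent of the layering; antisymmetry is immediate, and the
  Jacobi identity is a cancellation over the six chambers of the plane \<open>a + b + c = 0\<close>.

  A tensor lies in a product of subspaces iff all its slices lie in the respective factors. The
  slices of a semisimply differentiable functional over a partition are again semisimply
  differentiable, so it is a tensor of elements of \<open>\<Gamma>\<^sup>*\<close>, and the coaction is determined by
  evaluating forest derivatives at faces. Coassociativity becomes the product rule for
  derivatives along a forest made of one tree over each block.
\<close>

section \<open>Linear algebra of function spaces\<close>

text \<open>Most computations rest on a formula for \<open>face_cut\<close> that does not mention
  reduction modulo a partition. If \<open>h\<close> is a generic vector for \<open>X\<close>, the
  cut face is the sign function of \<open>h + \<epsilon> * (e_c - e_d)\<close> for small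
  \<open>\<epsilon>\<close> and any \<open>c\<close> in \<open>C\<close>, \<open>d\<close> in
  \<open>D\<close>: the signs of \<open>X\<close> take precedence, and the cut only decides the sets
  where \<open>X\<close> vanishes. Restrictions, commutation, the Jacobi identity and relabelling
  are then checked one set at a time.

  The obstacle is that a face over a partition is not determined by its restrictions to the blocks:
  two orders of cutting may give different faces, and gluing involves a choice. Semisimplicity at
  every stage of differentiation makes these choices invisible to the functional.

  \<open>tensor_map\<close> is obtained by choice and is known only on the span of the pure tensors,
  so coassociativity is tested on pure tensors and extended by linearity. Relabelling and the
  passage from trees over a set of blocks to forests over the ground set are two instances of one
  notion, \<open>block_hom\<close>.\<close>

definition fun_delta :: "'x \<Rightarrow> 'x \<Rightarrow> 'k::field" where
  "fun_delta x = (\<lambda>y. if y = x then 1 else 0)"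

lemma subspace_dual_on: "fun_vs.subspace (dual_on X)"
  by (rule fun_vs.subspaceI) (auto simp: dual_on_def fscale_def)

lemma dual_on_eq_sum_delta:
  assumes "finite X" "f \<in> dual_on X"
  shows "f = (\<Sum>x\<in>X. fscale (f x) (fun_delta x))"
proof
  fix y
  have "(\<Sum>x\<in>X. fscale (f x) (fun_delta x)) y = (\<Sum>x\<in>X. if y = x then f x else 0)"
    by (subst sum_fun_apply) (auto simp: fscale_def fun_delta_def intro!: sum.cong)
  also have "\<dots> = f y" using assms by (auto simp: dual_on_def)
  finally show "f y = (\<Sum>x\<in>X. fscale (f x) (fun_delta x)) y" by simp
qed

text \<open>The kernel is the matrix of a linear projection onto \<open>V\<close>.\<close>

lemma reproducing_kernel:
  fixes V :: "('x \<Rightarrow> 'k::field) set"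
  assumes X: "finite X" and V: "fun_vs.subspace V" "V \<subseteq> dual_on X"
  shows "\<exists>k. (\<forall>x. k x \<in> V) \<and> (\<forall>f\<in>V. \<forall>y. f y = (\<Sum>x\<in>X. f x * k x y))"
proof -
  interpret vp: vector_space_pair "fscale :: 'k \<Rightarrow> ('x \<Rightarrow> 'k) \<Rightarrow> 'x \<Rightarrow> 'k"
      "fscale :: 'k \<Rightarrow> ('x \<Rightarrow> 'k) \<Rightarrow> 'x \<Rightarrow> 'k"
    by unfold_locales
  obtain B where B: "B \<subseteq> V" "fun_vs.independent B" "V \<subseteq> fun_vs.span B"
    using fun_vs.maximal_independent_subset[of V] by blast
  have sp: "fun_vs.span B = V"
    using B V(1) by (metis fun_vs.span_minimal subset_antisym)
  define M where "M = vp.construct B id"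
  have lin: "Vector_Spaces.linear fscale fscale M"
    unfolding M_def using B(2) by (rule vp.linear_construct)
  have inV: "M f \<in> V" for f
    using vp.construct_in_span[OF B(2), of id f] sp by (simp add: M_def)
  have fixV: "M f = f" if "f \<in> V" for f
  proof -
    have "f \<in> fun_vs.span B" using that sp by simp
    then show ?thesis
      by (rule vp.linear_eq_on_span[OF lin fun_vs.linear_ident, rotated])
        (simp add: M_def vp.construct_basis[OF B(2)])
  qed
  have "f y = (\<Sum>x\<in>X. f x * M (fun_delta x) y)" if "f \<in> V" for f y
  proof -
    have "f = M (\<Sum>x\<in>X. fscale (f x) (fun_delta x))"
      using fixV[OF that] dual_on_eq_sum_delta[OF X, of f] that V(2) by auto
    also have "\<dots> = (\<Sum>x\<in>X. fscale (f x) (M (fun_delta x)))"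
      by (simp add: vp.linear_sum[OF lin] vp.linear_scale[OF lin])
    finally show ?thesis
      by (metis (mono_tags, lifting) fscale_def sum.cong sum_fun_apply)
  qed
  with inV show ?thesis by (intro exI[of _ "\<lambda>x. M (fun_delta x)"]) blast
qed

text \<open>Expanding \<open>F\<close> in its first variable with the kernel of \<open>U\<close>
  gives \<open>F (x, y) = (\<Sum>s\<in>X. k s x * F (s, y))\<close>, a finite sum of products of a
  vector of \<open>U\<close> with a slice in \<open>V\<close>.\<close>

lemma mem_tensor2I:
  fixes F :: "'x \<times> 'y \<Rightarrow> 'k::field"
  assumes X: "finite X" and U: "fun_vs.subspace U" "U \<subseteq> dual_on X"
    and F: "\<And>y. (\<lambda>x. F (x, y)) \<in> U" "\<And>x. x \<in> X \<Longrightarrow> (\<lambda>y. F (x, y)) \<in> V"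
  shows "F \<in> tensor2 U V"
proof -
  obtain k where k: "\<And>x. k x \<in> U" "\<And>f y. f \<in> U \<Longrightarrow> f y = (\<Sum>x\<in>X. f x * k x y)"
    using reproducing_kernel[OF X U] by metis
  have "F = (\<Sum>s\<in>X. (\<lambda>(x, y). k s x * F (s, y)))"
  proof
    fix p show "F p = (\<Sum>s\<in>X. (\<lambda>(x, y). k s x * F (s, y))) p"
      using k(2)[OF F(1)[of "snd p"], of "fst p"]
      by (auto simp: sum_fun_apply case_prod_beta mult.commute)
  qed
  moreover have "(\<lambda>(x, y). k s x * F (s, y)) \<in> tensor2 U V" if "s \<in> X" for s
    unfolding tensor2_def
    by (rule fun_vs.span_base, intro CollectI exI conjI) (rule refl, rule k(1), rule F(2)[OF that])
  ultimately show ?thesis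
    unfolding tensor2_def by (metis (no_types, lifting) fun_vs.span_sum)
qed

lemma sum_PiE_insert:
  fixes g :: "_ \<Rightarrow> 'k::comm_monoid_add"
  assumes "j \<notin> K"
  shows "(\<Sum>x\<in>PiE (insert j K) X. g x) = (\<Sum>x\<in>PiE K X. \<Sum>z\<in>X j. g (x(j := z)))"
proof -
  have "(\<Sum>x\<in>PiE (insert j K) X. g x) = (\<Sum>(z, x)\<in>X j \<times> PiE K X. g (x(j := z)))"
    unfolding PiE_insert_eq
    by (subst sum.reindex[OF inj_combinator[OF assms]]) (simp add: case_prod_unfold o_def)
  also have "\<dots> = (\<Sum>z\<in>X j. \<Sum>x\<in>PiE K X. g (x(j := z)))"
    by (simp add: sum.cartesian_product)
  finally show ?thesis by (subst sum.swap) simp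
qed

text \<open>The tensor product of the projections onto the \<open>V j\<close> fixes
  \<open>t\<close>, because each projection fixes the slices in its own variable. Written out, this
  makes \<open>t\<close> a combination of pure tensors of kernel vectors.\<close>

lemma mem_tensorI:
  fixes V :: "'j \<Rightarrow> ('x \<Rightarrow> 'k::field) set"
  assumes J: "finite J" and X: "\<And>j. j \<in> J \<Longrightarrow> finite (X j)"
    and V: "\<And>j. j \<in> J \<Longrightarrow> fun_vs.subspace (V j)" "\<And>j. j \<in> J \<Longrightarrow> V j \<subseteq> dual_on (X j)"
    and t: "t \<in> dual_on (PiE J X)"
    and slice: "\<And>j x. j \<in> J \<Longrightarrow> x \<in> PiE J X \<Longrightarrow> (\<lambda>z. t (x(j := z))) \<in> V j"
  shows "t \<in> tensor J V"
proof -
  have "\<forall>j\<in>J. \<exists>k. (\<forall>x. k x \<in> V j) \<and> (\<forall>f y. f \<in> V j \<longrightarrow> f y = (\<Sum>x\<in>X j. f x * k x y))"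
    using reproducing_kernel[OF X V] by metis
  then obtain k where k: "\<And>j x. j \<in> J \<Longrightarrow> k j x \<in> V j"
      "\<And>j f y. j \<in> J \<Longrightarrow> f \<in> V j \<Longrightarrow> f y = (\<Sum>x\<in>X j. f x * k j x y)"
    by metis
  \<comment> \<open>The variables in \<open>K\<close> have been expanded, the others still hold the
    values of \<open>y\<close>; at \<open>K = J\<close> nothing of \<open>y\<close> remains inside
    \<open>t\<close>.\<close>
  have rep: "t y = (\<Sum>x\<in>PiE K X. t (\<lambda>j. if j \<in> K then x j else y j) * (\<Prod>j\<in>K. k j (x j) (y j)))"
    if "K \<subseteq> J" "y \<in> PiE J X" for K y
    using finite_subset[OF that(1) J] that(1)
  proof (induction K rule: finite_induct)
    case empty
    show ?case by simp
  next
    case (insert j K)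
    have upd: "(\<lambda>i. if i \<in> insert j K then (x(j := z)) i else y i)
        = (\<lambda>i. if i \<in> K then x i else y i)(j := z)" for x z
      using insert.hyps by auto
    have pr: "(\<Prod>i\<in>insert j K. k i ((x(j := z)) i) (y i))
        = k j z (y j) * (\<Prod>i\<in>K. k i (x i) (y i))" for x z
    proof -
      have "(\<Prod>i\<in>K. k i ((x(j := z)) i) (y i)) = (\<Prod>i\<in>K. k i (x i) (y i))"
        using insert.hyps by (intro prod.cong) auto
      then show ?thesis using insert.hyps by simp
    qed
    have one: "t (\<lambda>i. if i \<in> K then x i else y i)
        = (\<Sum>z\<in>X j. t ((\<lambda>i. if i \<in> K then x i else y i)(j := z)) * k j z (y j))"
      if x: "x \<in> PiE K X" for x
    proof -
      let ?w = "\<lambda>i. if i \<in> K then x i else y i"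
      have w: "?w \<in> PiE J X"
        using x \<open>y \<in> PiE J X\<close> insert.prems by (auto simp: PiE_iff extensional_def)
      have "?w(j := y j) = ?w" using insert.hyps by auto
      then show ?thesis using k(2)[OF _ slice[OF _ w], of j "y j"] insert.prems by simp
    qed
    have "t y = (\<Sum>x\<in>PiE K X. t (\<lambda>i. if i \<in> K then x i else y i) * (\<Prod>i\<in>K. k i (x i) (y i)))"
      using insert by simp
    also have "\<dots> = (\<Sum>x\<in>PiE K X. \<Sum>z\<in>X j.
        t ((\<lambda>i. if i \<in> K then x i else y i)(j := z)) * (k j z (y j) * (\<Prod>i\<in>K. k i (x i) (y i))))"
      by (intro sum.cong refl) (simp add: one sum_distrib_right mult.assoc)
    finally show ?case
      by (subst sum_PiE_insert[OF insert.hyps(2)]) (simp only: upd pr)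
  qed
  define p where "p x = pure_tensor J (\<lambda>j. k j (x j))" for x
  have "t y = (\<Sum>x\<in>PiE J X. t x * p x y)" for y
  proof (cases "y \<in> PiE J X")
    case True
    have "t y = (\<Sum>x\<in>PiE J X. t (\<lambda>j. if j \<in> J then x j else y j) * (\<Prod>j\<in>J. k j (x j) (y j)))"
      using rep[OF subset_refl True] .
    also have "\<dots> = (\<Sum>x\<in>PiE J X. t x * p x y)"
    proof (rule sum.cong[OF refl])
      fix x assume "x \<in> PiE J X"
      then have "(\<lambda>j. if j \<in> J then x j else y j) = x"
        using True by (auto simp: PiE_iff extensional_def)
      then show "t (\<lambda>j. if j \<in> J then x j else y j) * (\<Prod>j\<in>J. k j (x j) (y j)) = t x * p x y"
        using True by (simp add: p_def pure_tensor_def PiE_iff)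
    qed
    finally show ?thesis .
  next
    case False
    \<comment> \<open>A coordinate of \<open>y\<close> outside \<open>X j\<close> kills its factor,
      since kernel vectors lie in \<open>V j\<close>.\<close>
    have "p x y = 0" for x
    proof (cases "y \<in> extensional J")
      case True
      with False obtain j where j: "j \<in> J" "y j \<notin> X j" by (auto simp: PiE_iff)
      then have "k j (x j) (y j) = 0" using k(1)[OF j(1)] V(2)[OF j(1)] by (auto simp: dual_on_def)
      then show ?thesis using J j(1) by (auto simp: p_def pure_tensor_def)
    qed (simp add: p_def pure_tensor_def)
    then show ?thesis using t False by (simp add: dual_on_def)
  qed
  then have "t = (\<Sum>x\<in>PiE J X. fscale (t x) (p x))"
    unfolding fun_eq_iff sum_fun_apply fscale_def by blast
  moreover have "p x \<in> tensor J V" for x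
    unfolding tensor_def p_def using k(1) by (intro fun_vs.span_base) blast
  ultimately show ?thesis
    unfolding tensor_def by (metis (no_types, lifting) fun_vs.span_scale fun_vs.span_sum)
qed

lemma tensor_subset_dual_on:
  assumes J: "finite J" and V: "\<And>j. j \<in> J \<Longrightarrow> V j \<subseteq> dual_on (X j)"
  shows "tensor J V \<subseteq> dual_on (PiE J X)"
  unfolding tensor_def
proof (rule fun_vs.span_minimal[OF _ subspace_dual_on], safe)
  fix f assume f: "\<forall>j\<in>J. f j \<in> V j"
  have "pure_tensor J f x = 0" if x: "x \<notin> PiE J X" for x
  proof (cases "x \<in> extensional J")
    case True
    with x obtain j where j: "j \<in> J" "x j \<notin> X j" by (auto simp: PiE_iff)
    then have "f j (x j) = 0" using f V[OF j(1)] by (auto simp: dual_on_def)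
    then show ?thesis using J j(1) by (auto simp: pure_tensor_def)
  qed (simp add: pure_tensor_def)
  then show "pure_tensor J f \<in> dual_on (PiE J X)" by (simp add: dual_on_def)
qed

lemma subspace_tensor: "fun_vs.subspace (tensor J V)"
  unfolding tensor_def by (rule fun_vs.subspace_span)

section \<open>Faces as sign functions of generic vectors\<close>

text \<open>The ground set is implicit as \<open>\<Union>P\<close>, so that any subset of a
  partition is again a partition, of a smaller ground set.\<close>

definition fin_part :: "'a set set \<Rightarrow> bool" where
  "fin_part P \<longleftrightarrow> finite (\<Union>P) \<and> disjoint P \<and> {} \<notin> P"

lemma fin_part_iff: "finite I \<Longrightarrow> partition_on I P \<longleftrightarrow> fin_part P \<and> \<Union>P = I"
  by (auto simp: fin_part_def partition_on_def)

lemma fin_part_eq: "fin_part P \<Longrightarrow> S \<in> P \<Longrightarrow> S' \<in> P \<Longrightarrow> i \<in> S \<Longrightarrow> i \<in> S' \<Longrightarrow> S = S'"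
  by (auto simp: fin_part_def disjoint_def)

lemma fin_part_ne: "fin_part P \<Longrightarrow> S \<in> P \<Longrightarrow> S \<noteq> {}"
  by (auto simp: fin_part_def)

lemma fin_part_finite: "fin_part P \<Longrightarrow> finite P"
  by (simp add: fin_part_def finite_UnionD)

lemma fin_part_subset: "fin_part P \<Longrightarrow> Q \<subseteq> P \<Longrightarrow> fin_part Q"
  by (auto simp: fin_part_def disjoint_def intro: finite_subset[OF Union_mono])

lemma fin_part_singleton: "fin_part {S} \<longleftrightarrow> finite S \<and> S \<noteq> {}"
  by (auto simp: fin_part_def)

lemma redn_empty_iff: "redn P E = {} \<longleftrightarrow> (\<forall>i\<in>E. \<exists>S\<in>P. i \<in> S \<and> S \<subseteq> E)"
  by (auto simp: redn_def)

lemma sum_eq_0_if_redn_empty: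
  assumes P: "fin_part P" and h: "\<And>S. S \<in> P \<Longrightarrow> sum h S = (0::real)" and E: "redn P E = {}"
  shows "sum h E = 0"
proof -
  have E: "E = \<Union>{S \<in> P. S \<subseteq> E}" using E by (auto simp: redn_empty_iff)
  have "sum h (\<Union>{S \<in> P. S \<subseteq> E}) = sum (sum h) {S \<in> P. S \<subseteq> E}"
  proof (subst sum.Union_disjoint)
    show "\<forall>A\<in>{S \<in> P. S \<subseteq> E}. finite A"
      using P by (auto simp: fin_part_def intro: finite_subset)
    show "\<forall>A\<in>{S \<in> P. S \<subseteq> E}. \<forall>B\<in>{S \<in> P. S \<subseteq> E}. A \<noteq> B \<longrightarrow> A \<inter> B = {}"
      using P by (auto simp: fin_part_def disjoint_def)
  qed simp
  also have "\<dots> = 0" using h by (intro sum.neutral) auto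
  finally show ?thesis using E by simp
qed

text \<open>The hyperplane of \<open>E\<close> contains \<open>Tvee P\<close> exactly when
  \<open>E\<close> is a union of blocks, that is, when \<open>redn P E = {}\<close>. So these are
  the points of \<open>Tvee P\<close> on no other hyperplane: the points of the faces with support
  \<open>Tvee P\<close>.\<close>

definition generic :: "'a set set \<Rightarrow> ('a \<Rightarrow> real) \<Rightarrow> bool" where
  "generic P h \<longleftrightarrow> h \<in> Tvee P \<and> (\<forall>E\<subseteq>\<Union>P. sum h E = 0 \<longrightarrow> redn P E = {})"

lemma generic_sum_eq_0_iff:
  "fin_part P \<Longrightarrow> generic P h \<Longrightarrow> E \<subseteq> \<Union>P \<Longrightarrow> sum h E = 0 \<longleftrightarrow> redn P E = {}"
  using sum_eq_0_if_redn_empty[of P h E] by (auto simp: generic_def Tvee_def)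

section \<open>Signs of small perturbations of a vector\<close>

lemma eventually_sgn_perturb:
  "eventually (\<lambda>\<epsilon>. sgn (a + \<epsilon> * b) = (if a \<noteq> 0 then sgn a else sgn (b::real))) (at_right 0)"
proof -
  have lim: "((\<lambda>\<epsilon>. a + \<epsilon> * b) \<longlongrightarrow> a + 0 * b) (at_right 0)"
    by (intro tendsto_intros)
  consider "a = 0" | "a > 0" | "a < 0" by linarith
  then show ?thesis
  proof cases
    case 1
    have "eventually (\<lambda>\<epsilon>::real. \<epsilon> > 0) (at_right 0)" by (rule eventually_at_right_less)
    then show ?thesis by eventually_elim (simp add: 1 sgn_mult)
  next
    case 2
    then have "eventually (\<lambda>\<epsilon>. a + \<epsilon> * b > 0) (at_right 0)"
      using order_tendstoD(1)[OF lim, of 0] by simp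
    then show ?thesis by eventually_elim (use 2 in simp)
  next
    case 3
    then have "eventually (\<lambda>\<epsilon>. a + \<epsilon> * b < 0) (at_right 0)"
      using order_tendstoD(2)[OF lim, of 0] by simp
    then show ?thesis by eventually_elim (use 3 in simp)
  qed
qed

text \<open>There are finitely many \<open>E\<close>, so one \<open>\<epsilon>\<close> serves all.
  The resulting signs are those of the lexicographic pair \<open>(h, k)\<close>, the composition of
  sign vectors known from oriented matroids; gluing and cutting of faces are both of this
  kind.\<close>

lemma sgn_perturb:
  assumes "finite I"
  obtains \<epsilon> :: real where "\<epsilon> > 0" "\<And>E. E \<subseteq> I \<Longrightarrow>
    sgn (sum (\<lambda>i. h i + \<epsilon> * k i) E) = (if sum h E \<noteq> 0 then sgn (sum h E) else sgn (sum k E))"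
proof -
  have "eventually (\<lambda>\<epsilon>::real. \<epsilon> > 0 \<and> (\<forall>E\<in>Pow I. sgn (sum h E + \<epsilon> * sum k E)
      = (if sum h E \<noteq> 0 then sgn (sum h E) else sgn (sum k E)))) (at_right 0)"
    using assms
    by (intro eventually_conj eventually_at_right_less eventually_ball_finite ballI
        eventually_sgn_perturb) auto
  then obtain \<epsilon> :: real where "\<epsilon> > 0" "\<forall>E\<in>Pow I. sgn (sum h E + \<epsilon> * sum k E)
      = (if sum h E \<noteq> 0 then sgn (sum h E) else sgn (sum k E))"
    using eventually_happens'[OF trivial_limit_at_right_real] by blast
  then show ?thesis
    using that[of \<epsilon>] by (auto simp: sum.distrib sum_distrib_left)
qed

lemma subspace_Tvee: "fun_vs.subspace (Tvee P)"
  by (rule fun_vs.subspaceI)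
    (auto simp: Tvee_def fscale_def sum.distrib sum_distrib_left[symmetric])

lemma subspace_sum_eq_0: "fun_vs.subspace {h. sum h E = (0::real)}"
  by (rule fun_vs.subspaceI) (auto simp: fscale_def sum.distrib sum_distrib_left[symmetric])

text \<open>If the sum over \<open>E\<close> vanishes at one point of a cone, it vanishes on the
  whole cone, hence on its span \<open>Tvee P\<close>, which forces \<open>E\<close> to be a union
  of blocks. Conversely, a generic \<open>h\<close> stays in its cone when moved slightly in any
  direction of \<open>Tvee P\<close>, so the cone spans \<open>Tvee P\<close>.\<close>

lemma faces_iff:
  assumes P: "fin_part P"
  shows "X \<in> faces P \<longleftrightarrow> (\<exists>h. generic P h \<and> X = sign_fun (\<Union>P) h)"
proof
  let ?I = "\<Union>P"
  assume X: "X \<in> faces P"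
  then have sp: "fun_vs.span (cone ?I X) = Tvee P" by (simp add: faces_def support_def)
  from X obtain h where h: "h \<in> cone ?I X" by (auto simp: faces_def adjoint_faces_def)
  have "h \<in> Tvee P" using h sp fun_vs.span_base by metis
  moreover have "redn P E = {}" if E: "E \<subseteq> ?I" "sum h E = 0" for E
  proof -
    have "X E = 0" using h E by (auto simp: cone_def sign_fun_def)
    moreover have "X E = sgn (sum v E)" if "v \<in> cone ?I X" for v
      using that E(1) by (auto simp: cone_def sign_fun_def)
    ultimately have "cone ?I X \<subseteq> {h. sum h E = 0}"
      by (force simp: sgn_zero_iff)
    then have sub: "Tvee P \<subseteq> {h. sum h E = 0}"
      unfolding sp[symmetric] by (rule fun_vs.span_minimal[OF _ subspace_sum_eq_0])
    show ?thesis
      unfolding redn_empty_iff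
    proof
      fix i assume i: "i \<in> E"
      then obtain S where S: "S \<in> P" "i \<in> S" using E by auto
      have "S \<subseteq> E"
      proof
        fix j assume j: "j \<in> S"
        show "j \<in> E"
        proof (rule ccontr)
          assume nj: "j \<notin> E"
          \<comment> \<open>The vector \<open>e_i - e_j\<close> lies in \<open>Tvee P\<close>
            because \<open>i\<close> and \<open>j\<close> share the block \<open>S\<close>, but its
            sum over \<open>E\<close> is 1.\<close>
          define v :: "'a \<Rightarrow> real" where "v x = (if x = i then 1 else 0) - (if x = j then 1 else 0)" for x
          have fin: "finite S'" if "S' \<subseteq> ?I" for S'
            using P that by (auto simp: fin_part_def intro: finite_subset)
          have sv: "sum v S' = (if i \<in> S' then 1 else 0) - (if j \<in> S' then 1 else 0)"
            if "S' \<subseteq> ?I" for S'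
            using fin[OF that] by (simp add: v_def sum_subtractf)
          have "v \<in> Tvee P"
          proof -
            have "sum v S' = 0" if "S' \<in> P" for S'
            proof -
              have "S' \<subseteq> ?I" using that by auto
              then show ?thesis
                using sv[of S'] fin_part_eq[OF P S(1) that] S(2) j by auto
            qed
            moreover have "v x = 0" if "x \<notin> ?I" for x
              using that S j by (auto simp: v_def)
            ultimately show ?thesis by (auto simp: Tvee_def)
          qed
          then have "sum v E = 0" using sub by auto
          then show False using sv[OF E(1)] i nj by simp
        qed
      qed
      then show "\<exists>S\<in>P. i \<in> S \<and> S \<subseteq> E" using S by auto
    qed
  qed
  ultimately have "generic P h" by (auto simp: generic_def)
  moreover have "X = sign_fun ?I h" using h by (simp add: cone_def)
  ultimately show "\<exists>h. generic P h \<and> X = sign_fun ?I h" by blast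
next
  let ?I = "\<Union>P"
  assume "\<exists>h. generic P h \<and> X = sign_fun ?I h"
  then obtain h where h: "generic P h" and X: "X = sign_fun ?I h" by blast
  have hT: "h \<in> Tvee P" using h by (simp add: generic_def)
  have redn_I: "redn P ?I = {}" by (auto simp: redn_empty_iff)
  have TI: "v \<in> Tvee {?I}" if "v \<in> Tvee P" for v
    using that sum_eq_0_if_redn_empty[OF P _ redn_I, of v] by (auto simp: Tvee_def)
  have hc: "h \<in> cone ?I X" using TI[OF hT] X by (simp add: cone_def)
  have sub: "cone ?I X \<subseteq> Tvee P"
  proof
    fix v assume v: "v \<in> cone ?I X"
    have "sum v S = 0" if S: "S \<in> P" for S
    proof -
      have "S \<subseteq> ?I" using S by auto
      then have "sgn (sum v S) = sgn (sum h S)"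
        using v X by (auto simp: cone_def sign_fun_def fun_eq_iff split: if_splits)
      then show ?thesis using hT S by (simp add: Tvee_def sgn_zero_iff)
    qed
    then show "v \<in> Tvee P" using v by (auto simp: Tvee_def cone_def)
  qed
  have "Tvee P \<subseteq> fun_vs.span (cone ?I X)"
  proof
    fix v assume v: "v \<in> Tvee P"
    obtain \<epsilon> where e: "\<epsilon> > 0" "\<And>E. E \<subseteq> ?I \<Longrightarrow> sgn (sum (\<lambda>i. h i + \<epsilon> * v i) E)
        = (if sum h E \<noteq> 0 then sgn (sum h E) else sgn (sum v E))"
      using sgn_perturb[of ?I h v] P by (auto simp: fin_part_def)
    let ?w = "\<lambda>i. h i + \<epsilon> * v i"
    have wT: "?w \<in> Tvee P"
      using fun_vs.subspace_add[OF subspace_Tvee hT fun_vs.subspace_scale[OF subspace_Tvee v, of \<epsilon>]]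
      by (simp add: fscale_def plus_fun_def)
    have "sign_fun ?I ?w = X"
    proof
      fix E
      have "sum v E = 0" if "E \<subseteq> ?I" "sum h E = 0"
        using generic_sum_eq_0_iff[OF P h that(1)] that(2) sum_eq_0_if_redn_empty[OF P, of v E] v
        by (auto simp: Tvee_def)
      then show "sign_fun ?I ?w E = X E"
        using e(2)[of E] by (auto simp: X sign_fun_def)
    qed
    then have "?w \<in> cone ?I X" using TI[OF wT] by (simp add: cone_def)
    then have "fscale (1/\<epsilon>) (?w - h) \<in> fun_vs.span (cone ?I X)"
      using hc by (intro fun_vs.span_scale fun_vs.span_diff fun_vs.span_base)
    moreover have "fscale (1/\<epsilon>) (?w - h) = v" using e(1) by (auto simp: fscale_def)
    ultimately show "v \<in> fun_vs.span (cone ?I X)" by simp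
  qed
  moreover have "fun_vs.span (cone ?I X) \<subseteq> Tvee P"
    using sub by (rule fun_vs.span_minimal[OF _ subspace_Tvee])
  ultimately show "X \<in> faces P"
    using hc by (auto simp: faces_def support_def adjoint_faces_def)
qed

lemma faces_outside: "X \<in> faces P \<Longrightarrow> \<not> E \<subseteq> \<Union>P \<Longrightarrow> X E = 0"
proof -
  assume X: "X \<in> faces P" and E: "\<not> E \<subseteq> \<Union>P"
  from X obtain h where "X = sign_fun (\<Union>P) h" by (auto simp: faces_def adjoint_faces_def cone_def)
  then show "X E = 0" using E by (simp add: sign_fun_def)
qed

lemma faces_eq_0_iff: "fin_part P \<Longrightarrow> X \<in> faces P \<Longrightarrow> E \<subseteq> \<Union>P \<Longrightarrow> X E = 0 \<longleftrightarrow> redn P E = {}"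
  by (auto simp: faces_iff sign_fun_def generic_sum_eq_0_iff sgn_zero_iff)

lemma finite_faces:
  assumes P: "fin_part P"
  shows "finite (faces P)"
proof (rule finite_subset)
  show "faces P \<subseteq> {X. \<forall>E. (E \<in> Pow (\<Union>P) \<longrightarrow> X E \<in> {-1, 0, 1}) \<and> (E \<notin> Pow (\<Union>P) \<longrightarrow> X E = 0)}"
  proof (intro subsetI CollectI allI conjI impI)
    fix X E assume X: "X \<in> faces P"
    then obtain h where h: "X = sign_fun (\<Union>P) h" using P by (auto simp: faces_iff)
    show "X E \<in> {-1, 0, 1}" by (simp add: h sign_fun_def sgn_if)
    show "X E = 0" if "E \<notin> Pow (\<Union>P)" using faces_outside[OF X, of E] that by simp
  qed
  show "finite {X :: 'a face. \<forall>E. (E \<in> Pow (\<Union>P) \<longrightarrow> X E \<in> {-1, 0, 1}) \<and> (E \<notin> Pow (\<Union>P) \<longrightarrow> X E = 0)}"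
    using P by (intro finite_set_of_finite_funs) (auto simp: fin_part_def)
qed

text \<open>Truncating a generic \<open>h\<close> outside \<open>\<Union>Q\<close> keeps all its
  sums over subsets of \<open>\<Union>Q\<close>. \<open>Q\<close> is any set of blocks, so that the
  lemma covers a single block as well as all blocks away from a cut.\<close>

lemma face_restrict_in_faces:
  assumes P: "fin_part P" and Q: "Q \<subseteq> P" and X: "X \<in> faces P"
  shows "face_restrict X (\<Union>Q) \<in> faces Q"
proof -
  obtain h where h: "generic P h" "X = sign_fun (\<Union>P) h" using X P by (auto simp: faces_iff)
  let ?h = "\<lambda>i. if i \<in> \<Union>Q then h i else 0"
  have sum: "sum ?h E = sum h E" if "E \<subseteq> \<Union>Q" for E
    using that by (intro sum.cong) auto
  have "generic Q ?h"
    unfolding generic_def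
  proof (intro conjI allI impI)
    have "sum ?h S = 0" if "S \<in> Q" for S
    proof -
      have "S \<subseteq> \<Union>Q" "S \<in> P" using that Q by auto
      then show ?thesis using h(1) sum[of S] by (simp add: generic_def Tvee_def del: Union_iff)
    qed
    then show "?h \<in> Tvee Q" by (auto simp: Tvee_def)
    fix E assume E: "E \<subseteq> \<Union>Q" "sum ?h E = 0"
    then have "E \<subseteq> \<Union>P" "sum h E = 0" using Q sum[of E] by (auto simp del: Union_iff)
    then have "redn P E = {}" using h(1) by (simp add: generic_def)
    \<comment> \<open>A block of \<open>P\<close> inside \<open>E\<close> meets a block of
      \<open>Q\<close>, hence equals it.\<close>
    moreover have "S \<in> Q" if "S \<in> P" "S \<subseteq> E" "i \<in> S" for S i
      using that E(1) Q fin_part_eq[OF P, of S] by blast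
    ultimately show "redn Q E = {}" unfolding redn_empty_iff by meson
  qed
  moreover have "face_restrict X (\<Union>Q) = sign_fun (\<Union>Q) ?h"
  proof
    fix E
    have "E \<subseteq> \<Union>P" if "E \<subseteq> \<Union>Q" using that Q by blast
    then show "face_restrict X (\<Union>Q) E = sign_fun (\<Union>Q) ?h E"
      using sum[of E] by (simp add: face_restrict_def h(2) sign_fun_def del: Union_iff)
  qed
  ultimately show ?thesis using fin_part_subset[OF P Q] by (auto simp: faces_iff)
qed

lemma face_restrict_block: "fin_part P \<Longrightarrow> S \<in> P \<Longrightarrow> X \<in> faces P \<Longrightarrow> face_restrict X S \<in> faces {S}"
  using face_restrict_in_faces[of P "{S}" X] by simp

lemma face_restrict_face_restrict:
  "S' \<subseteq> S \<Longrightarrow> face_restrict (face_restrict X S) S' = face_restrict X S'"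
  by (force simp: face_restrict_def fun_eq_iff)

lemma face_restrict_self: "X \<in> faces P \<Longrightarrow> face_restrict X (\<Union>P) = X"
  using faces_outside[of X P] by (simp add: face_restrict_def fun_eq_iff)

text \<open>The vector \<open>h + \<epsilon> * k\<close> works: \<open>h\<close> and
  \<open>k\<close> vanish on the ground set of each other, so either half shows only its own signs.
  On a mixed set the smallness of \<open>\<epsilon>\<close> excludes cancellation: a vanishing sum
  forces both parts to vanish, which gives genericity over \<open>Q \<union> R\<close>.\<close>

lemma glue_generic:
  assumes P: "fin_part (Q \<union> R)" and disj: "\<Union>Q \<inter> \<Union>R = {}" and h: "generic Q h" and k: "generic R k"
  obtains g where "generic (Q \<union> R) g" "\<And>E. E \<subseteq> \<Union>Q \<Longrightarrow> sgn (sum g E) = sgn (sum h E)"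
    "\<And>E. E \<subseteq> \<Union>R \<Longrightarrow> sgn (sum g E) = sgn (sum k E)"
proof -
  have fp: "fin_part Q" "fin_part R" using P fin_part_subset by blast+
  obtain \<epsilon> where e: "\<epsilon> > 0" "\<And>E. E \<subseteq> \<Union>(Q \<union> R) \<Longrightarrow> sgn (sum (\<lambda>i. h i + \<epsilon> * k i) E)
      = (if sum h E \<noteq> 0 then sgn (sum h E) else sgn (sum k E))"
    using sgn_perturb[of "\<Union>(Q \<union> R)" h k] P unfolding fin_part_def by blast
  define g where "g i = h i + \<epsilon> * k i" for i
  have out: "h i = 0" if "i \<notin> \<Union>Q" for i using that h by (auto simp: generic_def Tvee_def)
  have out': "k i = 0" if "i \<notin> \<Union>R" for i using that k by (auto simp: generic_def Tvee_def)
  have sg: "sgn (sum g E) = (if sum h E \<noteq> 0 then sgn (sum h E) else sgn (sum k E))"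
    if "E \<subseteq> \<Union>(Q \<union> R)" for E using e(2)[OF that] by (simp add: g_def)
  have kQ: "sum k E = 0" if "E \<subseteq> \<Union>Q" for E
    using that disj out' by (intro sum.neutral) blast
  have hR: "sum h E = 0" if "E \<subseteq> \<Union>R" for E
    using that disj out by (intro sum.neutral) blast
  have 1: "sgn (sum g E) = sgn (sum h E)" if "E \<subseteq> \<Union>Q" for E
  proof -
    have "E \<subseteq> \<Union>(Q \<union> R)" using that by auto
    then show ?thesis using sg[of E] kQ[OF that] by auto
  qed
  have 2: "sgn (sum g E) = sgn (sum k E)" if "E \<subseteq> \<Union>R" for E
  proof -
    have "E \<subseteq> \<Union>(Q \<union> R)" using that by auto
    then show ?thesis using sg[of E] hR[OF that] by auto
  qed
  have "generic (Q \<union> R) g"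
    unfolding generic_def
  proof (intro conjI allI impI)
    have "sum g S = 0" if "S \<in> Q \<union> R" for S
    proof -
      have "sgn (sum g S) = 0"
      proof (cases "S \<in> Q")
        case True
        then show ?thesis using 1[of S] h by (auto simp: generic_def Tvee_def)
      next
        case False
        then have "S \<in> R" using that by auto
        then show ?thesis using 2[of S] k by (auto simp: generic_def Tvee_def)
      qed
      then show ?thesis by (simp add: sgn_zero_iff)
    qed
    moreover have "g i = 0" if "i \<notin> \<Union>(Q \<union> R)" for i
      using out[of i] out'[of i] that by (auto simp: g_def)
    ultimately show "g \<in> Tvee (Q \<union> R)" by (auto simp: Tvee_def)
    fix E assume E: "E \<subseteq> \<Union>(Q \<union> R)" "sum g E = 0"
    then have z: "sum h E = 0" "sum k E = 0"
      using sg[OF E(1)] by (auto simp: sgn_zero_iff split: if_splits)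
    have fin: "finite E" using P E(1) by (auto simp: fin_part_def intro: finite_subset)
    have "sum h (E \<inter> \<Union>Q) = sum h E"
      using out fin by (intro sum.mono_neutral_left) auto
    then have "redn Q (E \<inter> \<Union>Q) = {}" using h z by (auto simp: generic_def)
    moreover have "sum k (E \<inter> \<Union>R) = sum k E"
      using out' fin by (intro sum.mono_neutral_left) auto
    then have "redn R (E \<inter> \<Union>R) = {}" using k z by (auto simp: generic_def)
    ultimately show "redn (Q \<union> R) E = {}"
      using E(1) unfolding redn_empty_iff by (metis Int_iff UnCI UnE Union_Un_distrib le_inf_iff subsetD)
  qed
  then show ?thesis using 1 2 by (rule that)
qed

text \<open>Repeated use of \<open>glue_generic\<close>, one index at a time. \<open>u S\<close> is
  \<open>{S}\<close> when tuples of block faces are glued, and a refinement of one block when a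
  slice is differentiated. The glued face is in general not unique.\<close>

lemma glue_faces:
  assumes fin: "finite K" and u: "fin_part (\<Union>S\<in>K. u S)"
    and disj: "\<And>S S'. S \<in> K \<Longrightarrow> S' \<in> K \<Longrightarrow> S \<noteq> S' \<Longrightarrow> \<Union>(u S) \<inter> \<Union>(u S') = {}"
    and x: "\<And>S. S \<in> K \<Longrightarrow> x S \<in> faces (u S)"
  obtains X where "X \<in> faces (\<Union>S\<in>K. u S)" "\<And>S. S \<in> K \<Longrightarrow> face_restrict X (\<Union>(u S)) = x S"
proof -
  have "\<exists>h. generic (\<Union>S\<in>K. u S) h \<and> (\<forall>S\<in>K. sign_fun (\<Union>(u S)) h = x S)"
    using fin u disj x
  proof (induction K rule: finite_induct)
    case empty
    show ?case by (intro exI[of _ 0]) (auto simp: generic_def Tvee_def redn_def)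
  next
    case (insert S K)
    have fp: "fin_part (\<Union>S\<in>K. u S)" "fin_part (u S)"
      using insert.prems(1) by (auto intro: fin_part_subset)
    obtain h where h: "generic (\<Union>S\<in>K. u S) h" "\<forall>S\<in>K. sign_fun (\<Union>(u S)) h = x S"
      using insert.IH[OF fp(1)] insert.prems by (metis insertCI)
    obtain k where k: "generic (u S) k" "x S = sign_fun (\<Union>(u S)) k"
      using insert.prems(3)[of S] fp(2) by (auto simp: faces_iff)
    have "\<Union>(u S) \<inter> \<Union>(\<Union>S\<in>K. u S) = {}"
      using insert.prems(2)[of S] insert.hyps(2) by fastforce
    moreover have "fin_part (u S \<union> (\<Union>S\<in>K. u S))" using insert.prems(1) by simp
    ultimately obtain g where g: "generic (u S \<union> (\<Union>S\<in>K. u S)) g"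
        "\<And>E. E \<subseteq> \<Union>(u S) \<Longrightarrow> sgn (sum g E) = sgn (sum k E)"
        "\<And>E. E \<subseteq> \<Union>(\<Union>S\<in>K. u S) \<Longrightarrow> sgn (sum g E) = sgn (sum h E)"
      using glue_generic[OF _ _ k(1) h(1)] by metis
    have "sign_fun (\<Union>(u S')) g = x S'" if "S' \<in> insert S K" for S'
    proof (cases "S' = S")
      case True
      then show ?thesis using g(2) k(2) by (auto simp: sign_fun_def)
    next
      case False
      then have S': "S' \<in> K" using that by auto
      have "sgn (sum g E) = sgn (sum h E)" if "E \<subseteq> \<Union>(u S')" for E
        by (rule g(3)) (use that S' in blast)
      then have "sign_fun (\<Union>(u S')) g = sign_fun (\<Union>(u S')) h"
        by (simp add: sign_fun_def fun_eq_iff)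
      then show ?thesis using h(2) S' by simp
    qed
    then show ?case using g(1) by auto
  qed
  then obtain h where h: "generic (\<Union>S\<in>K. u S) h" "\<forall>S\<in>K. sign_fun (\<Union>(u S)) h = x S" by blast
  let ?X = "sign_fun (\<Union>(\<Union>S\<in>K. u S)) h"
  have "?X \<in> faces (\<Union>S\<in>K. u S)" using h(1) u by (auto simp: faces_iff)
  moreover have "face_restrict ?X (\<Union>(u S)) = x S" if "S \<in> K" for S
  proof -
    have "\<Union>(u S) \<subseteq> \<Union>(\<Union>S\<in>K. u S)" using that by auto
    then have "face_restrict ?X (\<Union>(u S)) = sign_fun (\<Union>(u S)) h"
      by (auto simp: face_restrict_def sign_fun_def fun_eq_iff)
    then show ?thesis using h(2) that by simp
  qed
  ultimately show ?thesis by (rule that)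
qed

text \<open>Every tuple of block faces thus comes from a face over \<open>P\<close>, so tensors can
  be compared by evaluating their external products at faces.\<close>

lemma glue_blocks:
  assumes P: "fin_part P" and x: "x \<in> PiE P (\<lambda>S. faces {S})"
  obtains X where "X \<in> faces P" "restrict (face_restrict X) P = x"
proof -
  obtain X where X: "X \<in> faces (\<Union>S\<in>P. {S})" "\<And>S. S \<in> P \<Longrightarrow> face_restrict X (\<Union>{S}) = x S"
  proof (rule glue_faces[of P "\<lambda>S. {S}" x])
    show "finite P" using P by (rule fin_part_finite)
    show "\<Union> {S} \<inter> \<Union> {S'} = {}" if "S \<in> P" "S' \<in> P" "S \<noteq> S'" for S S'
      using fin_part_eq[OF P, of S S'] that by auto
  qed (use P x in auto)
  have "restrict (face_restrict X) P = x"
    using X(2) x by (auto simp: fun_eq_iff restrict_def PiE_iff extensional_def)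
  then show ?thesis using that[of X] X(1) by simp
qed

lemma restrict_face_restrict_in_PiE:
  "fin_part P \<Longrightarrow> X \<in> faces P \<Longrightarrow> restrict (face_restrict X) P \<in> PiE P (\<lambda>S. faces {S})"
  by (auto intro: face_restrict_block)

section \<open>Cuts\<close>

lemma is_cut_pair: "is_cut P (C, D) \<longleftrightarrow> C \<noteq> {} \<and> D \<noteq> {} \<and> C \<inter> D = {} \<and> C \<union> D \<in> P"
  by (simp add: is_cut_def)

lemma apply_cut_pair: "apply_cut P (C, D) = (P - {C \<union> D}) \<union> {C, D}"
  by (simp add: apply_cut_def)

lemma is_cut_swap [simp]: "is_cut P (prod.swap V) = is_cut P V"
  by (cases V) (simp add: is_cut_def, metis Un_commute Int_commute)

lemma apply_cut_swap [simp]: "apply_cut P (prod.swap V) = apply_cut P V"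
  by (auto simp: apply_cut_def split: prod.split)

lemma Union_apply_cut: "is_cut P V \<Longrightarrow> \<Union>(apply_cut P V) = \<Union>P"
  by (auto simp: is_cut_def apply_cut_def split: prod.splits)

lemma fin_part_apply_cut:
  assumes P: "fin_part P" and V: "is_cut P V"
  shows "fin_part (apply_cut P V)"
proof -
  obtain C D where V': "V = (C, D)" by force
  have CD: "C \<noteq> {}" "D \<noteq> {}" "C \<inter> D = {}" "C \<union> D \<in> P" using V by (auto simp: V' is_cut_pair)
  have out: "S \<inter> C = {}" "S \<inter> D = {}" if "S \<in> P" "S \<noteq> C \<union> D" for S
    using fin_part_eq[OF P that(1) CD(4)] that(2) by blast+
  have "disjoint (P - {C \<union> D})" using P by (auto simp: fin_part_def disjoint_def)
  moreover have "disjoint {C, D}" using CD(3) by (auto simp: disjoint_def)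
  moreover have "\<Union>(P - {C \<union> D}) \<inter> \<Union>{C, D} = {}" using out by blast
  ultimately have "disjoint (apply_cut P V)"
    unfolding V' apply_cut_pair by (rule disjoint_union)
  then show ?thesis
    using P CD Union_apply_cut[OF V] by (auto simp: fin_part_def V' apply_cut_pair)
qed

lemma redn_cut:
  assumes P: "fin_part P" and V: "is_cut P (C, D)"
  shows "redn P C = C" "redn P D = D"
proof -
  have CD: "C \<noteq> {}" "D \<noteq> {}" "C \<inter> D = {}" "C \<union> D \<in> P" using V by (auto simp: is_cut_pair)
  have "\<not> S \<subseteq> C \<and> \<not> S \<subseteq> D" if "S \<in> P" for S
  proof -
    have "S \<noteq> {}" using fin_part_ne[OF P that] .
    then show ?thesis using CD fin_part_eq[OF P that CD(4)] by blast
  qed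
  then show "redn P C = C" "redn P D = D" by (auto simp: redn_def)
qed

lemma redn_apply_cut_empty:
  assumes "is_cut P (C, D)" and "redn P E = C \<or> redn P E = D \<or> redn P E = {}"
  shows "redn (apply_cut P (C, D)) E = {}"
  unfolding redn_empty_iff
proof
  fix i assume i: "i \<in> E"
  show "\<exists>S\<in>apply_cut P (C, D). i \<in> S \<and> S \<subseteq> E"
  proof (cases "i \<in> redn P E")
    case True
    moreover have "redn P E \<subseteq> E" by (auto simp: redn_def)
    ultimately show ?thesis using assms(2) by (auto simp: apply_cut_pair)
  next
    case False
    then obtain S where S: "S \<in> P" "i \<in> S" "S \<subseteq> E" using i by (auto simp: redn_def)
    then show ?thesis
      by (cases "S = C \<union> D") (auto simp: apply_cut_pair)
  qed
qed

text \<open>\<open>E\<close> is a union of blocks of the finer partition, so it contains or misses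
  each of \<open>C\<close> and \<open>D\<close>. It fails to be a union of blocks of
  \<open>P\<close> only when it contains exactly one of them.\<close>

lemma redn_cut_eq:
  assumes P: "fin_part P" and V: "is_cut P (C, D)" and E: "redn (apply_cut P (C, D)) E = {}"
  shows "redn P E = (if C \<subseteq> E \<and> \<not> D \<subseteq> E then C else if D \<subseteq> E \<and> \<not> C \<subseteq> E then D else {})"
proof -
  have CD: "C \<noteq> {}" "D \<noteq> {}" "C \<inter> D = {}" "C \<union> D \<in> P" using V by (auto simp: is_cut_pair)
  let ?Q = "apply_cut P (C, D)"
  have Q: "fin_part ?Q" using P V by (rule fin_part_apply_cut)
  have sub: "S \<subseteq> E" if "S \<in> ?Q" "i \<in> S" "i \<in> E" for S i
    using E that fin_part_eq[OF Q that(1)] unfolding redn_empty_iff by metis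
  have C: "C \<subseteq> E \<or> C \<inter> E = {}" and D: "D \<subseteq> E \<or> D \<inter> E = {}"
    using sub[of C] sub[of D] by (auto simp: apply_cut_pair)
  have out: "\<exists>S\<in>P. i \<in> S \<and> S \<subseteq> E" if i: "i \<in> E" "i \<notin> C \<union> D" for i
  proof -
    obtain S where "S \<in> ?Q" "i \<in> S" "S \<subseteq> E" using E i(1) unfolding redn_empty_iff by metis
    then show ?thesis using i(2) by (auto simp: apply_cut_pair)
  qed
  have inn: "(\<exists>S\<in>P. i \<in> S \<and> S \<subseteq> E) \<longleftrightarrow> C \<subseteq> E \<and> D \<subseteq> E" if i: "i \<in> C \<union> D" for i
    using fin_part_eq[OF P _ CD(4) _ i] CD(4) i by (metis Un_subset_iff)
  have "i \<in> redn P E \<longleftrightarrow> i \<in> E \<and> i \<in> C \<union> D \<and> \<not> (C \<subseteq> E \<and> D \<subseteq> E)" for i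
    using out[of i] inn[of i] unfolding redn_def by blast
  then have "redn P E = (if C \<subseteq> E \<and> D \<subseteq> E then {} else E \<inter> (C \<union> D))" by auto
  moreover have "E \<inter> (C \<union> D) = (if C \<subseteq> E then C else {}) \<union> (if D \<subseteq> E then D else {})"
    using C D CD(1,2) by auto
  ultimately show ?thesis by simp
qed

text \<open>Where \<open>X\<close> does not vanish, \<open>E\<close> is not a union of blocks of the
  finer partition and none of the special cases of \<open>face_cut\<close> applies. Where it
  vanishes, \<open>redn_cut_eq\<close> leaves four cases according to which of \<open>C\<close> and
  \<open>D\<close> lie in \<open>E\<close>; the difference of indicators encodes them.\<close>

lemma face_cut_apply:
  assumes P: "fin_part P" and V: "is_cut P (C, D)" and X: "X \<in> faces (apply_cut P (C, D))"
    and E: "E \<subseteq> \<Union>P"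
  shows "face_cut P (C, D) X E =
    (if X E \<noteq> 0 then X E else (if C \<subseteq> E then 1 else 0) - (if D \<subseteq> E then 1 else 0))"
proof -
  have CD: "C \<noteq> {}" "D \<noteq> {}" "C \<inter> D = {}" using V by (auto simp: is_cut_pair)
  let ?Q = "apply_cut P (C, D)"
  have 0: "X E = 0 \<longleftrightarrow> redn ?Q E = {}"
    using faces_eq_0_iff[OF fin_part_apply_cut[OF P V] X] E Union_apply_cut[OF V] by simp
  have CnD: "C \<noteq> D" using CD by auto
  show ?thesis
  proof (cases "X E = 0")
    case True
    then show ?thesis
      using 0 E CD CnD by (simp add: face_cut_def redn_cut[OF P V] redn_cut_eq[OF P V])
  next
    case False
    then have "redn ?Q E \<noteq> {}" using 0 by simp
    then show ?thesis
      using False E redn_apply_cut_empty[OF V, of E] by (auto simp: face_cut_def redn_cut[OF P V])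
  qed
qed

lemma face_cut_outside: "\<not> E \<subseteq> \<Union>P \<Longrightarrow> face_cut P V X E = 0"
  by (simp add: face_cut_def)

text \<open>The cut face is the sign function of a generic vector of the finer partition, pushed
  slightly in the direction \<open>e_c - e_d\<close> with \<open>c\<close> in \<open>C\<close> and
  \<open>d\<close> in \<open>D\<close>.\<close>

lemma face_cut_in_faces:
  assumes P: "fin_part P" and V: "is_cut P V" and X: "X \<in> faces (apply_cut P V)"
  shows "face_cut P V X \<in> faces P"
proof -
  obtain C D where V': "V = (C, D)" by force
  have CD: "C \<noteq> {}" "D \<noteq> {}" "C \<inter> D = {}" "C \<union> D \<in> P" using V by (auto simp: V' is_cut_pair)
  let ?Q = "apply_cut P V"
  have Q: "fin_part ?Q" and UQ: "\<Union>?Q = \<Union>P"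
    using fin_part_apply_cut[OF P V] Union_apply_cut[OF V] by auto
  have fin: "finite E" if "E \<subseteq> \<Union>P" for E
    using P that by (auto simp: fin_part_def intro: finite_subset)
  obtain h where h: "generic ?Q h" "X = sign_fun (\<Union>P) h"
    using X Q UQ by (auto simp: faces_iff)
  obtain c d where cd: "c \<in> C" "d \<in> D" using CD by blast
  then have cdP: "c \<in> \<Union>P" "d \<in> \<Union>P" "c \<noteq> d" using CD by auto
  define k :: "'a \<Rightarrow> real" where "k x = (if x = c then 1 else 0) - (if x = d then 1 else 0)" for x
  have sk: "sum k E = (if c \<in> E then 1 else 0) - (if d \<in> E then 1 else 0)" if "E \<subseteq> \<Union>P" for E
    using fin[OF that] by (simp add: k_def sum_subtractf)
  obtain \<epsilon> where e: "\<epsilon> > 0" "\<And>E. E \<subseteq> \<Union>P \<Longrightarrow> sgn (sum (\<lambda>i. h i + \<epsilon> * k i) E)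
      = (if sum h E \<noteq> 0 then sgn (sum h E) else sgn (sum k E))"
    using sgn_perturb[of "\<Union>P" h k] P by (auto simp: fin_part_def)
  define g where "g i = h i + \<epsilon> * k i" for i
  have sg: "sgn (sum g E) = (if sum h E \<noteq> 0 then sgn (sum h E) else sgn (sum k E))"
    if "E \<subseteq> \<Union>P" for E using e(2)[OF that] by (simp add: g_def)
  have h0: "sum h E = 0 \<longleftrightarrow> redn ?Q E = {}" if "E \<subseteq> \<Union>P" for E
    using generic_sum_eq_0_iff[OF Q h(1)] that UQ by simp
  have sub: "S \<subseteq> E" if "redn ?Q E = {}" "S \<in> ?Q" "i \<in> S" "i \<in> E" for S i E
    using that fin_part_eq[OF Q that(2)] unfolding redn_empty_iff by metis
  \<comment> \<open>The push matters only on unions of blocks of the finer partition. On these,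
    membership of \<open>c\<close> means containment of \<open>C\<close>, so the result does not
    depend on the choice of \<open>c\<close> and \<open>d\<close>.\<close>
  have cE: "c \<in> E \<longleftrightarrow> C \<subseteq> E" "d \<in> E \<longleftrightarrow> D \<subseteq> E" if "redn ?Q E = {}" for E
    using sub[OF that, of C c] sub[OF that, of D d] cd by (auto simp: V' apply_cut_pair)
  have "generic P g"
    unfolding generic_def
  proof (intro conjI allI impI)
    have "sum g S = 0" if "S \<in> P" for S
    proof -
      have SP: "S \<subseteq> \<Union>P" using that by auto
      have "redn ?Q S = {}"
        using redn_apply_cut_empty[of P C D S] V that by (auto simp: V' redn_def)
      moreover have "sum k S = 0"
        using sk[OF SP] cd fin_part_eq[OF P that CD(4)] by (cases "S = C \<union> D") auto
      ultimately show ?thesis using sg[OF SP] h0[OF SP] by (simp add: sgn_zero_iff)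
    qed
    moreover have "g i = 0" if "i \<notin> \<Union>P" for i
    proof -
      have "h i = 0" using h(1) that UQ by (simp add: generic_def Tvee_def del: Union_iff)
      then show ?thesis using that cdP by (auto simp: g_def k_def)
    qed
    ultimately show "g \<in> Tvee P" by (simp add: Tvee_def del: Union_iff)
    fix E assume E: "E \<subseteq> \<Union>P" "sum g E = 0"
    have z: "sum h E = 0" "sum k E = 0"
      using sg[OF E(1)] E(2) by (auto simp: sgn_zero_iff split: if_splits)
    have r: "redn ?Q E = {}" using z h0[OF E(1)] by simp
    have "c \<in> E \<longleftrightarrow> d \<in> E" using z(2) sk[OF E(1)] by (auto split: if_splits)
    then show "redn P E = {}"
      using redn_cut_eq[of P C D E] P V r cE[OF r] by (auto simp: V')
  qed
  moreover have "face_cut P V X = sign_fun (\<Union>P) g"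
  proof
    fix E
    show "face_cut P V X E = sign_fun (\<Union>P) g E"
    proof (cases "E \<subseteq> \<Union>P")
      case True
      have X0: "X E = sgn (sum h E)" using True by (simp add: h(2) sign_fun_def)
      show ?thesis
      proof (cases "sum h E = 0")
        case z: True
        then have r: "redn ?Q E = {}" using h0[OF True] by simp
        have "face_cut P V X E = (if C \<subseteq> E then 1 else 0) - (if D \<subseteq> E then 1 else 0)"
          using face_cut_apply[of P C D X E] P V X True X0 z by (simp add: V')
        moreover have "sgn (sum k E) = (if C \<subseteq> E then 1 else 0) - (if D \<subseteq> E then 1 else 0)"
          using sk[OF True] cE[OF r] by auto
        ultimately show ?thesis using sg[OF True] z True by (simp add: sign_fun_def)
      next
        case False
        then show ?thesis
          using face_cut_apply[of P C D X E] P V X True X0 sg[OF True]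
          by (simp add: V' sign_fun_def sgn_zero_iff)
      qed
    qed (simp add: face_cut_outside sign_fun_def)
  qed
  ultimately show ?thesis using P by (auto simp: faces_iff)
qed

text \<open>By \<open>face_cut_apply\<close> the new sign at \<open>E\<close> involves only
  \<open>X E\<close> and whether \<open>C\<close> and \<open>D\<close> lie in \<open>E\<close>; none
  of this refers to the rest of \<open>P\<close>.\<close>

lemma face_restrict_face_cut_inside:
  assumes P: "fin_part P" and Q: "Q \<subseteq> P" and V: "is_cut Q V" and X: "X \<in> faces (apply_cut P V)"
  shows "face_restrict (face_cut P V X) (\<Union>Q) = face_cut Q V (face_restrict X (\<Union>Q))"
proof
  fix E
  obtain C D where V': "V = (C, D)" by force
  have VP: "is_cut P V" using V Q by (auto simp: V' is_cut_pair)
  have sub: "apply_cut Q V \<subseteq> apply_cut P V" using Q by (auto simp: V' apply_cut_pair)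
  have R: "face_restrict X (\<Union>Q) \<in> faces (apply_cut Q V)"
    using face_restrict_in_faces[OF fin_part_apply_cut[OF P VP] sub X] Union_apply_cut[OF V] by simp
  show "face_restrict (face_cut P V X) (\<Union>Q) E = face_cut Q V (face_restrict X (\<Union>Q)) E"
  proof (cases "E \<subseteq> \<Union>Q")
    case True
    then have "E \<subseteq> \<Union>P" using Q by blast
    then show ?thesis
      using True face_cut_apply[OF P, of C D X E] VP X
        face_cut_apply[OF fin_part_subset[OF P Q], of C D "face_restrict X (\<Union>Q)" E] V R
      by (simp add: V' face_restrict_def del: Union_iff)
  qed (simp add: face_restrict_def face_cut_outside)
qed

text \<open>A subset of \<open>S\<close> contains neither \<open>C\<close> nor \<open>D\<close>, so
  the cut changes no sign there.\<close>

lemma face_restrict_face_cut_outside: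
  assumes P: "fin_part P" and V: "is_cut P (C, D)" and S: "S \<subseteq> \<Union>P" "S \<inter> (C \<union> D) = {}"
    and X: "X \<in> faces (apply_cut P (C, D))"
  shows "face_restrict (face_cut P (C, D) X) S = face_restrict X S"
proof
  fix E
  show "face_restrict (face_cut P (C, D) X) S E = face_restrict X S E"
  proof (cases "E \<subseteq> S")
    case True
    then have "E \<subseteq> \<Union>P" "\<not> C \<subseteq> E" "\<not> D \<subseteq> E" using S V by (auto simp: is_cut_pair)
    then show ?thesis using face_cut_apply[OF P V X] by (simp add: face_restrict_def)
  qed (simp add: face_restrict_def)
qed

lemma faces_eqI:
  assumes "X \<in> faces P" "Y \<in> faces P" "\<And>E. E \<subseteq> \<Union>P \<Longrightarrow> X E = Y E"
  shows "X = Y"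
proof
  fix E
  show "X E = Y E"
    by (cases "E \<subseteq> \<Union>P") (simp_all add: assms faces_outside[OF assms(1)] faces_outside[OF assms(2)]
      del: Union_iff)
qed

section \<open>Semisimple functionals\<close>

lemma L_dual_subspace: "fun_vs.subspace (L_dual P)"
  by (simp add: L_dual_def subspace_dual_on)

text \<open>Each factor is the full function space on its faces, so the slice condition of
  \<open>mem_tensorI\<close> reduces to vanishing outside the product.\<close>

lemma tensor_L_dual:
  assumes P: "fin_part P"
  shows "tensor P (\<lambda>S. L_dual {S}) = dual_on (PiE P (\<lambda>S. faces {S}))"
proof
  have fin: "finite P" using P by (rule fin_part_finite)
  show "tensor P (\<lambda>S. L_dual {S}) \<subseteq> dual_on (PiE P (\<lambda>S. faces {S}))"
    by (rule tensor_subset_dual_on[OF fin]) (simp add: L_dual_def)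
  show "dual_on (PiE P (\<lambda>S. faces {S})) \<subseteq> tensor P (\<lambda>S. L_dual {S} :: ('a face \<Rightarrow> 'b) set)"
  proof
    fix t :: "('a set \<Rightarrow> 'a face) \<Rightarrow> 'b" assume t: "t \<in> dual_on (PiE P (\<lambda>S. faces {S}))"
    show "t \<in> tensor P (\<lambda>S. L_dual {S})"
    proof (rule mem_tensorI[OF fin, where X = "\<lambda>S. faces {S}"])
      show "finite (faces {S})" if "S \<in> P" for S
        using P that by (intro finite_faces fin_part_subset[OF P]) auto
      fix S x assume S: "S \<in> P" "x \<in> PiE P (\<lambda>S. faces {S})"
      have "x(S := z) \<notin> PiE P (\<lambda>S. faces {S})" if "z \<notin> faces {S}" for z
        using that S by (metis PiE_mem fun_upd_same)
      then show "(\<lambda>z. t (x(S := z))) \<in> L_dual {S}"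
        using t by (simp add: L_dual_def dual_on_def)
    qed (auto simp: t L_dual_subspace, auto simp: L_dual_def)
  qed
qed

text \<open>The external products are the functionals that factor through the tuple of block
  restrictions, since by \<open>tensor_L_dual\<close> the tensor may be any function of such
  tuples.\<close>

lemma semisimple_iff:
  assumes P: "fin_part P"
  shows "semisimple P f \<longleftrightarrow> f \<in> L_dual P \<and> (\<forall>X\<in>faces P. \<forall>Y\<in>faces P.
    (\<forall>S\<in>P. face_restrict X S = face_restrict Y S) \<longrightarrow> f X = f Y)"
proof (intro iffI conjI ballI impI)
  assume "semisimple P f"
  then obtain t where t: "f = ext_prod P t" by (auto simp: semisimple_def)
  show "f \<in> L_dual P" by (simp add: t L_dual_def dual_on_def ext_prod_def)
  fix X Y assume XY: "X \<in> faces P" "Y \<in> faces P" "\<forall>S\<in>P. face_restrict X S = face_restrict Y S"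
  have "restrict (face_restrict X) P = restrict (face_restrict Y) P"
    using XY(3) by (intro restrict_ext) simp
  then show "f X = f Y" using XY by (simp add: t ext_prod_def)
next
  assume f: "f \<in> L_dual P \<and> (\<forall>X\<in>faces P. \<forall>Y\<in>faces P.
    (\<forall>S\<in>P. face_restrict X S = face_restrict Y S) \<longrightarrow> f X = f Y)"
  \<comment> \<open>Any face over the tuple will do, as \<open>f\<close> has the same value on all
    of them. \<open>ext_prod\<close> reads \<open>t\<close> only at tuples that come from a face,
    where the choice succeeds.\<close>
  define glue where "glue x = (SOME X. X \<in> faces P \<and> restrict (face_restrict X) P = x)" for x
  define t where "t x = (if x \<in> PiE P (\<lambda>S. faces {S}) then f (glue x) else 0)" for x
  have "f = ext_prod P t"
  proof
    fix X
    show "f X = ext_prod P t X"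
    proof (cases "X \<in> faces P")
      case True
      let ?x = "restrict (face_restrict X) P"
      have g: "glue ?x \<in> faces P \<and> restrict (face_restrict (glue ?x)) P = ?x"
        unfolding glue_def by (rule someI[of _ X]) (simp add: True)
      have "face_restrict (glue ?x) S = face_restrict X S" if "S \<in> P" for S
        using fun_cong[OF conjunct2[OF g], of S] that by simp
      then have "f (glue ?x) = f X" using f True g by blast
      then show ?thesis
        using True restrict_face_restrict_in_PiE[OF P True] by (simp add: ext_prod_def t_def)
    next
      case False
      then show ?thesis using f by (simp add: ext_prod_def L_dual_def dual_on_def)
    qed
  qed
  moreover have "t \<in> tensor P (\<lambda>S. L_dual {S})"
    by (simp add: tensor_L_dual[OF P] dual_on_def t_def)
  ultimately show "semisimple P f" by (auto simp: semisimple_def)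
qed

section \<open>Forest derivatives\<close>

lemma is_forest_append: "is_forest P (F @ G) \<longleftrightarrow> is_forest P F \<and> is_forest (leaves P F) G"
  by (induction F arbitrary: P) (auto simp: leaves_def)

lemma leaves_Nil [simp]: "leaves P [] = P"
  by (simp add: leaves_def)

lemma leaves_Cons [simp]: "leaves P (V # F) = leaves (apply_cut P V) F"
  by (simp add: leaves_def)

lemma leaves_append: "leaves P (F @ G) = leaves (leaves P F) G"
  by (simp add: leaves_def)

lemma forest_deriv_append:
  "forest_deriv P (F @ G) f = forest_deriv (leaves P F) G (forest_deriv P F f)"
  by (induction F arbitrary: P f) auto

lemma fin_part_leaves: "fin_part P \<Longrightarrow> is_forest P F \<Longrightarrow> fin_part (leaves P F)"
  by (induction F arbitrary: P) (auto simp: fin_part_apply_cut)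

lemma Union_leaves: "is_forest P F \<Longrightarrow> \<Union>(leaves P F) = \<Union>P"
  by (induction F arbitrary: P) (auto simp: Union_apply_cut simp del: Union_iff)

lemma cut_deriv_add: "cut_deriv P V (f + g) = cut_deriv P V f + cut_deriv P V g"
  by (auto simp: cut_deriv_def fun_eq_iff)

lemma cut_deriv_scale: "cut_deriv P V (fscale c f) = fscale c (cut_deriv P V f)"
  by (auto simp: cut_deriv_def fun_eq_iff fscale_def algebra_simps)

lemma forest_deriv_add: "forest_deriv P F (f + g) = forest_deriv P F f + forest_deriv P F g"
  by (induction F arbitrary: P f g) (auto simp: cut_deriv_add)

lemma forest_deriv_scale: "forest_deriv P F (fscale c f) = fscale c (forest_deriv P F f)"
  by (induction F arbitrary: P f) (auto simp: cut_deriv_scale)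

lemma forest_deriv_0: "forest_deriv P F 0 = 0"
  using forest_deriv_scale[of P F 0 0] by (simp add: fscale_def zero_fun_def)

lemma cut_deriv_in_L_dual: "cut_deriv P V f \<in> L_dual (apply_cut P V)"
  by (simp add: L_dual_def dual_on_def cut_deriv_def)

lemma forest_deriv_in_L_dual: "f \<in> L_dual P \<Longrightarrow> forest_deriv P F f \<in> L_dual (leaves P F)"
  by (induction F arbitrary: P f) (auto simp: cut_deriv_in_L_dual)

section \<open>Semisimply differentiable functionals\<close>

lemma Gamma_partD:
  assumes "f \<in> Gamma_part P"
  shows "f \<in> L_dual P" "is_forest P F \<Longrightarrow> semisimple (leaves P F) (forest_deriv P F f)"
  using assms by (auto simp: Gamma_part_def)

lemma Gamma_part_semisimple: "f \<in> Gamma_part P \<Longrightarrow> semisimple P f"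
  using Gamma_partD(2)[of f P "[]"] by simp

text \<open>A forest over the leaves of \<open>F\<close> can be appended to \<open>F\<close>, giving
  a forest over \<open>P\<close>.\<close>

lemma forest_deriv_in_Gamma_part:
  assumes f: "f \<in> Gamma_part P" and F: "is_forest P F"
  shows "forest_deriv P F f \<in> Gamma_part (leaves P F)"
proof -
  have "semisimple (leaves (leaves P F) G) (forest_deriv (leaves P F) G (forest_deriv P F f))"
    if "is_forest (leaves P F) G" for G
    using Gamma_partD(2)[OF f, of "F @ G"] that F
    by (simp add: is_forest_append leaves_append forest_deriv_append)
  then show ?thesis
    using forest_deriv_in_L_dual[OF Gamma_partD(1)[OF f]] by (simp add: Gamma_part_def)
qed

lemma cut_deriv_in_Gamma_part:
  "f \<in> Gamma_part P \<Longrightarrow> is_cut P V \<Longrightarrow> cut_deriv P V f \<in> Gamma_part (apply_cut P V)"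
  using forest_deriv_in_Gamma_part[of f P "[V]"] by simp

lemma semisimple_0: "fin_part P \<Longrightarrow> semisimple P 0"
  by (simp add: semisimple_iff L_dual_def dual_on_def)

lemma semisimple_add:
  assumes P: "fin_part P" and f: "semisimple P f" and g: "semisimple P g"
  shows "semisimple P (f + g)"
  unfolding semisimple_iff[OF P]
proof (intro conjI ballI impI)
  show "f + g \<in> L_dual P"
    using f g by (simp add: semisimple_iff[OF P] L_dual_def dual_on_def)
  fix X Y assume XY: "X \<in> faces P" "Y \<in> faces P" "\<forall>S\<in>P. face_restrict X S = face_restrict Y S"
  have "f X = f Y" "g X = g Y" using f g XY unfolding semisimple_iff[OF P] by blast+
  then show "(f + g) X = (f + g) Y" by simp
qed

lemma semisimple_scale:
  assumes P: "fin_part P" and f: "semisimple P f"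
  shows "semisimple P (fscale c f)"
  unfolding semisimple_iff[OF P]
proof (intro conjI ballI impI)
  show "fscale c f \<in> L_dual P"
    using f by (simp add: semisimple_iff[OF P] L_dual_def dual_on_def fscale_def)
  fix X Y assume XY: "X \<in> faces P" "Y \<in> faces P" "\<forall>S\<in>P. face_restrict X S = face_restrict Y S"
  have "f X = f Y" using f XY unfolding semisimple_iff[OF P] by blast
  then show "fscale c f X = fscale c f Y" by (simp add: fscale_def)
qed

lemma subspace_Gamma_part:
  assumes P: "fin_part P"
  shows "fun_vs.subspace (Gamma_part P)"
proof (rule fun_vs.subspaceI)
  note L = fin_part_leaves[OF P]
  show "0 \<in> Gamma_part P"
    by (simp add: Gamma_part_def forest_deriv_0 semisimple_0 L L_dual_def dual_on_def)
  show "f + g \<in> Gamma_part P" if f: "f \<in> Gamma_part P" and g: "g \<in> Gamma_part P" for f g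
  proof -
    have "f + g \<in> L_dual P"
      using Gamma_partD(1)[OF f] Gamma_partD(1)[OF g] by (simp add: L_dual_def dual_on_def)
    moreover have "semisimple (leaves P F) (forest_deriv P F (f + g))" if "is_forest P F" for F
      unfolding forest_deriv_add
      by (intro semisimple_add L that Gamma_partD(2)[OF f] Gamma_partD(2)[OF g])
    ultimately show ?thesis by (simp add: Gamma_part_def)
  qed
  show "fscale c f \<in> Gamma_part P" if f: "f \<in> Gamma_part P" for f c
  proof -
    have "fscale c f \<in> L_dual P"
      using Gamma_partD(1)[OF f] by (simp add: L_dual_def dual_on_def fscale_def)
    moreover have "semisimple (leaves P F) (forest_deriv P F (fscale c f))" if "is_forest P F" for F
      unfolding forest_deriv_scale
      by (intro semisimple_scale L that Gamma_partD(2)[OF f])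
    ultimately show ?thesis by (simp add: Gamma_part_def)
  qed
qed

section \<open>The relations of the Lie operad\<close>

lemma cut_deriv_swap: "cut_deriv P (prod.swap V) f = - cut_deriv P V f"
  by (rule ext) (simp add: cut_deriv_def)

lemma fin_part_disjoint: "fin_part P \<Longrightarrow> S \<in> P \<Longrightarrow> S' \<in> P \<Longrightarrow> S \<noteq> S' \<Longrightarrow> S \<inter> S' = {}"
  by (auto simp: fin_part_def disjoint_def)

lemma apply_cut_commute:
  assumes P: "fin_part P" and V: "is_cut P (C, D)" and W: "is_cut P (A, B)"
    and ne: "C \<union> D \<noteq> A \<union> B"
  shows "is_cut (apply_cut P (C, D)) (A, B)"
    "apply_cut (apply_cut P (C, D)) (A, B) = apply_cut (apply_cut P (A, B)) (C, D)"
proof -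
  have CD: "C \<noteq> {}" "D \<noteq> {}" "C \<union> D \<in> P" and AB: "A \<noteq> {}" "B \<noteq> {}" "A \<inter> B = {}" "A \<union> B \<in> P"
    using V W by (simp_all add: is_cut_pair)
  have "(C \<union> D) \<inter> (A \<union> B) = {}" using fin_part_eq[OF P CD(3) AB(4)] ne by blast
  then have neq: "C \<noteq> A \<union> B" "D \<noteq> A \<union> B" "A \<noteq> C \<union> D" "B \<noteq> C \<union> D"
    using CD(1,2) AB(1,2) by blast+
  show "is_cut (apply_cut P (C, D)) (A, B)"
    using AB ne by (simp add: is_cut_pair apply_cut_pair)
  show "apply_cut (apply_cut P (C, D)) (A, B) = apply_cut (apply_cut P (A, B)) (C, D)"
    unfolding apply_cut_pair using neq by blast
qed

text \<open>
  The two faces differ in general, but on a single block at most one of the two cuts is visible.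
\<close>

lemma semisimple_face_cut_commute:
  assumes P: "fin_part P" and V: "is_cut P (C, D)" and W: "is_cut P (A, B)"
    and ne: "C \<union> D \<noteq> A \<union> B" and f: "semisimple P f"
    and X: "X \<in> faces (apply_cut (apply_cut P (C, D)) (A, B))"
  shows "f (face_cut P (C, D) (face_cut (apply_cut P (C, D)) (A, B) X))
    = f (face_cut P (A, B) (face_cut (apply_cut P (A, B)) (C, D) X))"
proof -
  let ?PV = "apply_cut P (C, D)" and ?PW = "apply_cut P (A, B)"
  note W' = apply_cut_commute(1)[OF P V W ne] and V' = apply_cut_commute(1)[OF P W V ne[symmetric]]
  have fp: "fin_part ?PV" "fin_part ?PW" using fin_part_apply_cut P V W by blast+
  have X': "X \<in> faces (apply_cut ?PW (C, D))" using X apply_cut_commute(2)[OF P V W ne] by simp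
  let ?Y = "face_cut ?PV (A, B) X" and ?Z = "face_cut ?PW (C, D) X"
  have Y: "?Y \<in> faces ?PV" and Z: "?Z \<in> faces ?PW"
    using face_cut_in_faces fp W' V' X X' by blast+
  have "face_restrict (face_cut P (C, D) ?Y) S = face_restrict (face_cut P (A, B) ?Z) S"
    if S: "S \<in> P" for S
  proof
    fix E
    show "face_restrict (face_cut P (C, D) ?Y) S E = face_restrict (face_cut P (A, B) ?Z) S E"
    proof (cases "E \<subseteq> S")
      case True
      then have E: "E \<subseteq> \<Union>P" "E \<subseteq> \<Union>?PV" "E \<subseteq> \<Union>?PW"
        using S Union_apply_cut[OF V] Union_apply_cut[OF W] by auto
      have "S \<inter> (C \<union> D) = {} \<or> S \<inter> (A \<union> B) = {}"
        using V W ne fin_part_disjoint[OF P S] unfolding is_cut_pair by metis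
      then have "\<not> C \<subseteq> E \<and> \<not> D \<subseteq> E \<or> \<not> A \<subseteq> E \<and> \<not> B \<subseteq> E"
        using True V W unfolding is_cut_pair by blast
      then show ?thesis
        using True face_cut_apply[OF P V Y E(1)] face_cut_apply[OF P W Z E(1)]
          face_cut_apply[OF fp(1) W' X E(2)] face_cut_apply[OF fp(2) V' X' E(3)]
        by (auto simp: face_restrict_def)
    qed (simp add: face_restrict_def)
  qed
  moreover have "face_cut P (C, D) ?Y \<in> faces P" "face_cut P (A, B) ?Z \<in> faces P"
    using face_cut_in_faces P V W Y Z by blast+
  ultimately show ?thesis using f unfolding semisimple_iff[OF P] by blast
qed

text \<open>Both sides are alternating sums over the four orientations of the two cuts, and
  \<open>semisimple_face_cut_commute\<close> matches them term by term.\<close>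

lemma cut_deriv_commute:
  assumes P: "fin_part P" and V: "is_cut P (C, D)" and W: "is_cut P (A, B)"
    and ne: "C \<union> D \<noteq> A \<union> B" and f: "semisimple P f"
  shows "cut_deriv (apply_cut P (C, D)) (A, B) (cut_deriv P (C, D) f)
    = cut_deriv (apply_cut P (A, B)) (C, D) (cut_deriv P (A, B) f)"
proof
  fix X
  let ?PV = "apply_cut P (C, D)" and ?PW = "apply_cut P (A, B)"
  have sw: "apply_cut P (D, C) = ?PV" "apply_cut P (B, A) = ?PW"
      "apply_cut ?PV (B, A) = apply_cut ?PV (A, B)" "apply_cut ?PW (D, C) = apply_cut ?PW (C, D)"
    by (auto simp: apply_cut_pair)
  have isw: "is_cut P (D, C)" "is_cut P (B, A)" using V W by (auto simp: is_cut_pair Un_commute)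
  have ne': "D \<union> C \<noteq> A \<union> B" "C \<union> D \<noteq> B \<union> A" "D \<union> C \<noteq> B \<union> A" using ne by (auto simp: Un_commute)
  note comm = apply_cut_commute[OF P V W ne] apply_cut_commute(1)[OF P W V ne[symmetric]]
  have fp: "fin_part ?PV" "fin_part ?PW" using fin_part_apply_cut P V W by blast+
  show "cut_deriv ?PV (A, B) (cut_deriv P (C, D) f) X = cut_deriv ?PW (C, D) (cut_deriv P (A, B) f) X"
  proof (cases "X \<in> faces (apply_cut ?PV (A, B))")
    case True
    have "face_cut ?PV (A, B) X \<in> faces ?PV" "face_cut ?PV (B, A) X \<in> faces ?PV"
        "face_cut ?PW (C, D) X \<in> faces ?PW" "face_cut ?PW (D, C) X \<in> faces ?PW"
      using face_cut_in_faces[OF fp(1) comm(1)] face_cut_in_faces[OF fp(2) comm(3)]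
        face_cut_in_faces[OF fp(1), of "(B, A)"] face_cut_in_faces[OF fp(2), of "(D, C)"]
        True comm(2)[symmetric] comm(1,3) sw is_cut_swap[of ?PV "(A, B)"] is_cut_swap[of ?PW "(C, D)"]
      by (simp_all del: is_cut_swap)
    then show ?thesis
      using True comm(2) semisimple_face_cut_commute[OF P V W ne f, of X]
        semisimple_face_cut_commute[OF P isw(1) W ne'(1) f, of X]
        semisimple_face_cut_commute[OF P V isw(2) ne'(2) f, of X]
        semisimple_face_cut_commute[OF P isw ne'(3) f, of X]
      by (simp add: cut_deriv_def sw)
  next
    case False
    then show ?thesis using comm(2) by (simp add: cut_deriv_def)
  qed
qed

section \<open>Independence of the layering\<close>

lemma forest_cut_subset:
  "is_forest P F \<Longrightarrow> (C, D) \<in> set F \<Longrightarrow> C \<noteq> {} \<and> D \<noteq> {} \<and> C \<inter> D = {} \<and> (\<exists>S\<in>P. C \<union> D \<subseteq> S)"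
proof (induction F arbitrary: P)
  case (Cons V F)
  show ?case
  proof (cases "(C, D) = V")
    case True
    then show ?thesis using Cons.prems by (auto simp: is_cut_def)
  next
    case False
    then have "C \<noteq> {} \<and> D \<noteq> {} \<and> C \<inter> D = {} \<and> (\<exists>S\<in>apply_cut P V. C \<union> D \<subseteq> S)"
      using Cons by auto
    then show ?thesis
      using Cons.prems(1) by (fastforce simp: is_cut_def apply_cut_def split: prod.splits)
  qed
qed simp

text \<open>After the cut, all blocks inside \<open>C \<union> D\<close> are proper subsets of it,
  so no later node can split it again. Hence two entries of a forest never split the same block, and
  in particular no entry is repeated.\<close>

lemma cut_not_in_forest:
  assumes P: "fin_part P" and V: "is_cut P (C, D)" and F: "is_forest (apply_cut P (C, D)) F"
    and AB: "A \<union> B = C \<union> D"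
  shows "(A, B) \<notin> set F"
proof
  assume "(A, B) \<in> set F"
  then obtain S where S: "S \<in> apply_cut P (C, D)" "C \<union> D \<subseteq> S"
    using forest_cut_subset[OF F, of A B] AB by auto
  note CD = V[unfolded is_cut_pair]
  have "C = S" "D = S"
    using fin_part_eq[OF fin_part_apply_cut[OF P V], of _ S] S CD
    by (auto simp: apply_cut_pair)
  then show False using CD by auto
qed

lemma distinct_forest: "fin_part P \<Longrightarrow> is_forest P F \<Longrightarrow> distinct F"
proof (induction F arbitrary: P)
  case (Cons V F)
  obtain C D where "V = (C, D)" by force
  then show ?case using Cons cut_not_in_forest[of P C D F C D] fin_part_apply_cut[of P V] by auto
qed simp

text \<open>\<open>V\<close> already splits a block of \<open>P\<close>, so each entry before it
  splits a different block and the two commute. The exchanges happen at intermediate partitions,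
  where the functional must be semisimple; this is why \<open>f\<close> is taken in
  \<open>Gamma_part P\<close>.\<close>

lemma forest_cut_to_front:
  assumes "fin_part P" "is_forest P (xs @ V # ys)" "is_cut P V" "f \<in> Gamma_part P"
  shows "is_forest P (V # xs @ ys) \<and> forest_deriv P (xs @ V # ys) f = forest_deriv P (V # xs @ ys) f"
  using assms
proof (induction xs arbitrary: P f)
  case (Cons W xs)
  obtain C D where V: "V = (C, D)" by force
  obtain A B where W: "W = (A, B)" by force
  have cW: "is_cut P (A, B)" and F: "is_forest (apply_cut P (A, B)) (xs @ V # ys)"
    using Cons.prems by (auto simp: W)
  have cV: "is_cut P (C, D)" using Cons.prems by (simp add: V)
  have ne: "C \<union> D \<noteq> A \<union> B" using cut_not_in_forest[OF Cons.prems(1) cW F, of C D] by (auto simp: V)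
  note comm = apply_cut_commute(1)[OF Cons.prems(1) cW cV ne[symmetric]]
    apply_cut_commute[OF Cons.prems(1) cV cW ne]
  have IH: "is_forest (apply_cut P W) (V # xs @ ys)"
    "forest_deriv (apply_cut P W) (xs @ V # ys) (cut_deriv P W f)
       = forest_deriv (apply_cut P W) (V # xs @ ys) (cut_deriv P W f)"
    using Cons.IH[of "apply_cut P W" "cut_deriv P W f"] Cons.prems(1,4) comm(1) F cW
    by (simp_all add: fin_part_apply_cut cut_deriv_in_Gamma_part V W)
  show ?case
    using IH comm(2) comm(3)[symmetric] cV cW cut_deriv_commute[OF Cons.prems(1) cV cW ne Gamma_part_semisimple[OF Cons.prems(4)]]
    by (simp add: V W)
qed simp

text \<open>The first node of \<open>F\<close> is a cut of \<open>P\<close> and occurs somewhere in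
  \<open>G\<close>. Bring it to the front of \<open>G\<close> and continue with the remaining nodes,
  whose sets agree because no node is repeated.\<close>

lemma forest_deriv_layering:
  assumes "fin_part P" "is_forest P F" "is_forest P G" "set F = set G" "f \<in> Gamma_part P"
  shows "forest_deriv P F f = forest_deriv P G f"
  using assms
proof (induction F arbitrary: P G f)
  case (Cons V F)
  then have "V \<in> set G" by auto
  then obtain xs ys where G: "G = xs @ V # ys" by (meson split_list)
  have front: "is_forest P (V # xs @ ys)" "forest_deriv P G f = forest_deriv P (V # xs @ ys) f"
    using forest_cut_to_front[of P xs V ys f] Cons.prems by (auto simp: G)
  have "distinct (V # F)" "distinct G" using distinct_forest Cons.prems by blast+
  then have "set F = set (xs @ ys)" using Cons.prems(4) by (auto simp: G)
  then show ?case
    using Cons.IH[of "apply_cut P V" "xs @ ys" "cut_deriv P V f"] Cons.prems front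
    by (simp add: fin_part_apply_cut cut_deriv_in_Gamma_part)
qed simp

text \<open>The hypotheses are symmetric, so a lemma proved for one order of \<open>A\<close>,
  \<open>B\<close>, \<open>C\<close> is available for all six through \<open>permute\<close>. The
  partition \<open>split3\<close> is where the three double cuts of the Jacobi identity
  meet.\<close>

locale three_blocks =
  fixes P :: "'a set set" and A B C :: "'a set"
  assumes P: "fin_part P" and ABC: "A \<union> B \<union> C \<in> P"
    and ne: "A \<noteq> {}" "B \<noteq> {}" "C \<noteq> {}"
    and disj: "A \<inter> B = {}" "B \<inter> C = {}" "C \<inter> A = {}"
begin

definition split3 :: "'a set set" where
  "split3 = (P - {A \<union> B \<union> C}) \<union> {A, B, C}"

lemma permute: "three_blocks P B A C" "three_blocks P B C A" "three_blocks P C B A"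
    "three_blocks P C A B" "three_blocks P A C B"
  using P ABC ne disj by (simp_all add: three_blocks_def Un_ac Int_commute)

lemma cut1: "is_cut P (A \<union> B, C)" "is_cut P (C, A \<union> B)"
  using ABC ne disj by (auto simp: is_cut_pair Un_ac)

lemma cut2: "is_cut (apply_cut P (A \<union> B, C)) (A, B)"
  using ne disj by (auto simp: is_cut_pair apply_cut_pair)

lemma apply_cut_twice: "apply_cut (apply_cut P (A \<union> B, C)) (A, B) = split3"
proof -
  have "(A \<union> B) \<inter> (A \<union> B \<union> C) = A \<union> B" "A \<union> B \<noteq> A \<union> B \<union> C" "A \<union> B \<noteq> {}"
    using ne disj by auto
  \<comment> \<open>Otherwise the second cut would remove a block that \<open>split3\<close>
    keeps.\<close>
  then have "A \<union> B \<notin> P" using fin_part_disjoint[OF P _ ABC, of "A \<union> B"] by metis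
  moreover have "A \<union> B \<noteq> C" using ne disj by auto
  ultimately show ?thesis by (auto simp: apply_cut_pair split3_def)
qed

lemma two_cuts_in_faces:
  assumes X: "X \<in> faces split3"
  shows "face_cut (apply_cut P (A \<union> B, C)) (A, B) X \<in> faces (apply_cut P (A \<union> B, C))"
    "face_cut P (A \<union> B, C) (face_cut (apply_cut P (A \<union> B, C)) (A, B) X) \<in> faces P"
    "face_cut P (C, A \<union> B) (face_cut (apply_cut P (A \<union> B, C)) (A, B) X) \<in> faces P"
proof -
  have sw: "apply_cut P (C, A \<union> B) = apply_cut P (A \<union> B, C)" by (simp add: apply_cut_pair Un_ac insert_commute)
  show 1: "face_cut (apply_cut P (A \<union> B, C)) (A, B) X \<in> faces (apply_cut P (A \<union> B, C))"
    using face_cut_in_faces[OF fin_part_apply_cut[OF P cut1(1)] cut2] X apply_cut_twice by simp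
  show "face_cut P (A \<union> B, C) (face_cut (apply_cut P (A \<union> B, C)) (A, B) X) \<in> faces P"
    using face_cut_in_faces[OF P cut1(1) 1] .
  show "face_cut P (C, A \<union> B) (face_cut (apply_cut P (A \<union> B, C)) (A, B) X) \<in> faces P"
    using face_cut_in_faces[OF P cut1(2)] 1 sw by simp
qed

text \<open>The signs are decided in the order \<open>X\<close>, then \<open>A\<close> against
  \<open>B\<close>, then \<open>A \<union> B\<close> against \<open>C\<close>: the later cut of the
  forest has priority.\<close>

lemma two_cuts_apply:
  assumes X: "X \<in> faces split3" and E: "E \<subseteq> \<Union>P"
  defines "Y \<equiv> (if X E \<noteq> 0 then X E else (if A \<subseteq> E then 1 else 0) - (if B \<subseteq> E then 1 else 0))"
  shows "face_cut P (A \<union> B, C) (face_cut (apply_cut P (A \<union> B, C)) (A, B) X) E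
      = (if Y \<noteq> 0 then Y else (if A \<union> B \<subseteq> E then 1 else 0) - (if C \<subseteq> E then 1 else 0))"
    "face_cut P (C, A \<union> B) (face_cut (apply_cut P (A \<union> B, C)) (A, B) X) E
      = (if Y \<noteq> 0 then Y else (if C \<subseteq> E then 1 else 0) - (if A \<union> B \<subseteq> E then 1 else 0))"
proof -
  have sw: "apply_cut P (C, A \<union> B) = apply_cut P (A \<union> B, C)" by (simp add: apply_cut_pair Un_ac insert_commute)
  have Y: "face_cut (apply_cut P (A \<union> B, C)) (A, B) X E = Y"
    using face_cut_apply[OF fin_part_apply_cut[OF P cut1(1)] cut2, of X E] X E
    unfolding apply_cut_twice Union_apply_cut[OF cut1(1)] Y_def by blast
  note F = two_cuts_in_faces(1)[OF X]
  show "face_cut P (A \<union> B, C) (face_cut (apply_cut P (A \<union> B, C)) (A, B) X) E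
      = (if Y \<noteq> 0 then Y else (if A \<union> B \<subseteq> E then 1 else 0) - (if C \<subseteq> E then 1 else 0))"
    using face_cut_apply[OF P cut1(1) F E] unfolding Y .
  show "face_cut P (C, A \<union> B) (face_cut (apply_cut P (A \<union> B, C)) (A, B) X) E
      = (if Y \<noteq> 0 then Y else (if C \<subseteq> E then 1 else 0) - (if A \<union> B \<subseteq> E then 1 else 0))"
    using face_cut_apply[OF P cut1(2) F[folded sw] E] unfolding sw Y .
qed

text \<open>
  Each of the six chambers cut out by the signs on \<open>A\<close>, \<open>B\<close>, \<open>C\<close> is reached by exactly two of the
  successive perturbations, with opposite signs in the Jacobi sum.
\<close>

lemma chamber_positive:
  assumes X: "X \<in> faces split3"
  shows "face_cut P (A \<union> B, C) (face_cut (apply_cut P (A \<union> B, C)) (A, B) X)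
    = face_cut P (A \<union> C, B) (face_cut (apply_cut P (A \<union> C, B)) (A, C) X)"
proof -
  interpret o: three_blocks P A C B by (rule permute)
  have X': "X \<in> faces o.split3" using X by (simp add: split3_def o.split3_def Un_ac insert_commute)
  show ?thesis
  proof (rule faces_eqI[OF two_cuts_in_faces(2)[OF X] o.two_cuts_in_faces(2)[OF X']])
    fix E assume "E \<subseteq> \<Union>P"
    then show "face_cut P (A \<union> B, C) (face_cut (apply_cut P (A \<union> B, C)) (A, B) X) E
        = face_cut P (A \<union> C, B) (face_cut (apply_cut P (A \<union> C, B)) (A, C) X) E"
      by (simp add: two_cuts_apply(1)[OF X] o.two_cuts_apply(1)[OF X'])
  qed
qed

text \<open>This is the chamber in which \<open>B\<close> alone is negative, a description symmetric
  in \<open>A\<close> and \<open>C\<close>. Likewise \<open>chamber_positive\<close> concerns the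
  chamber in which \<open>A\<close> alone is positive, symmetric in \<open>B\<close> and
  \<open>C\<close>.\<close>

lemma chamber_negative:
  assumes X: "X \<in> faces split3"
  shows "face_cut P (C, A \<union> B) (face_cut (apply_cut P (A \<union> B, C)) (A, B) X)
    = face_cut P (A, C \<union> B) (face_cut (apply_cut P (C \<union> B, A)) (C, B) X)"
proof -
  interpret o: three_blocks P C B A by (rule permute)
  have X': "X \<in> faces o.split3" using X by (simp add: split3_def o.split3_def Un_ac insert_commute)
  show ?thesis
  proof (rule faces_eqI[OF two_cuts_in_faces(3)[OF X] o.two_cuts_in_faces(3)[OF X']])
    fix E assume "E \<subseteq> \<Union>P"
    then show "face_cut P (C, A \<union> B) (face_cut (apply_cut P (A \<union> B, C)) (A, B) X) E
        = face_cut P (A, C \<union> B) (face_cut (apply_cut P (C \<union> B, A)) (C, B) X) E"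
      by (simp add: two_cuts_apply(2)[OF X] o.two_cuts_apply(2)[OF X'])
  qed
qed

end

lemma cut_deriv_jacobi:
  assumes ABC: "three_blocks P A B C"
  shows "cut_deriv (apply_cut P (A \<union> B, C)) (A, B) (cut_deriv P (A \<union> B, C) f)
    + cut_deriv (apply_cut P (B \<union> C, A)) (B, C) (cut_deriv P (B \<union> C, A) f)
    + cut_deriv (apply_cut P (C \<union> A, B)) (C, A) (cut_deriv P (C \<union> A, B) f) = 0"
proof
  fix X
  interpret a: three_blocks P A B C by (rule ABC)
  interpret b: three_blocks P B C A by (rule a.permute)
  interpret c: three_blocks P C A B by (rule a.permute)
  interpret a': three_blocks P B A C by (rule a.permute)
  interpret b': three_blocks P C B A by (rule a.permute)
  interpret c': three_blocks P A C B by (rule a.permute)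
  have s: "b.split3 = a.split3" "c.split3 = a.split3" "a'.split3 = a.split3" "b'.split3 = a.split3"
    "c'.split3 = a.split3"
    by (simp_all add: three_blocks.split3_def[OF a.permute(1)] three_blocks.split3_def[OF a.permute(2)]
      three_blocks.split3_def[OF a.permute(3)] three_blocks.split3_def[OF a.permute(4)]
      three_blocks.split3_def[OF a.permute(5)] a.split3_def Un_ac insert_commute)
  have u: "B \<union> A = A \<union> B" "C \<union> B = B \<union> C" "A \<union> C = C \<union> A" by auto
  show "(cut_deriv (apply_cut P (A \<union> B, C)) (A, B) (cut_deriv P (A \<union> B, C) f)
    + cut_deriv (apply_cut P (B \<union> C, A)) (B, C) (cut_deriv P (B \<union> C, A) f)
    + cut_deriv (apply_cut P (C \<union> A, B)) (C, A) (cut_deriv P (C \<union> A, B) f)) X = 0 X"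
  proof (cases "X \<in> faces a.split3")
    case True
    note F = a.two_cuts_in_faces(1) b.two_cuts_in_faces(1) c.two_cuts_in_faces(1)
      a'.two_cuts_in_faces(1) b'.two_cuts_in_faces(1) c'.two_cuts_in_faces(1)
    \<comment> \<open>Alone positive are \<open>A\<close>, \<open>B\<close>, \<open>C\<close> in
      \<open>a\<close>, \<open>a'\<close>, \<open>b'\<close>; alone negative are \<open>B\<close>,
      \<open>A\<close>, \<open>C\<close> in \<open>a\<close>, \<open>a'\<close>, \<open>b\<close>.
      These six equations pair off the twelve terms of the sum.\<close>
    note E = a.chamber_positive a.chamber_negative a'.chamber_positive a'.chamber_negative
      b'.chamber_positive b.chamber_negative
    show ?thesis
      using F[unfolded s, OF True, unfolded u] E[unfolded s, OF True, unfolded u] True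
      by (simp add: cut_deriv_def a.apply_cut_twice b.apply_cut_twice[unfolded s]
          c.apply_cut_twice[unfolded s])
  next
    case False
    then show ?thesis
      by (simp add: cut_deriv_def a.apply_cut_twice b.apply_cut_twice[unfolded s]
          c.apply_cut_twice[unfolded s])
  qed
qed

section \<open>Transport of forests\<close>

text \<open>Common to the direct image under an injection and to \<open>Union\<close> on sets of
  blocks. These are the properties that carry cuts to cuts.\<close>

definition block_hom :: "'a set \<Rightarrow> ('a set \<Rightarrow> 'b set) \<Rightarrow> bool" where
  "block_hom U \<phi> \<longleftrightarrow> (\<forall>A\<subseteq>U. \<forall>B\<subseteq>U. \<phi> (A \<union> B) = \<phi> A \<union> \<phi> B \<and> (A \<inter> B = {} \<longrightarrow> \<phi> A \<inter> \<phi> B = {}))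
    \<and> (\<forall>A\<subseteq>U. A \<noteq> {} \<longrightarrow> \<phi> A \<noteq> {})"

lemma block_homD:
  assumes "block_hom U \<phi>" "A \<subseteq> U"
  shows "B \<subseteq> U \<Longrightarrow> \<phi> (A \<union> B) = \<phi> A \<union> \<phi> B" "B \<subseteq> U \<Longrightarrow> A \<inter> B = {} \<Longrightarrow> \<phi> A \<inter> \<phi> B = {}"
    "A \<noteq> {} \<Longrightarrow> \<phi> A \<noteq> {}"
  using assms unfolding block_hom_def by simp_all

text \<open>If \<open>\<phi> A = \<phi> B\<close>, the image of \<open>A - B\<close> lies in
  \<open>\<phi> A\<close> and is disjoint from \<open>\<phi> B\<close>, hence empty, so
  \<open>A - B\<close> is empty.\<close>

lemma block_hom_inj:
  assumes \<phi>: "block_hom U \<phi>"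
  shows "inj_on \<phi> (Pow U)"
proof -
  have sub: "A \<subseteq> B" if A: "A \<subseteq> U" and B: "B \<subseteq> U" and eq: "\<phi> A = \<phi> B" for A B
  proof (rule ccontr)
    assume "\<not> A \<subseteq> B"
    then have ne: "A - B \<noteq> {}" by blast
    have sub: "A - B \<subseteq> U" using A by blast
    have "\<phi> (A \<union> (A - B)) = \<phi> A \<union> \<phi> (A - B)" by (rule block_homD(1)[OF \<phi> A sub])
    moreover have "A \<union> (A - B) = A" by blast
    moreover have "\<phi> (A - B) \<inter> \<phi> B = {}" by (rule block_homD(2)[OF \<phi> sub B]) blast
    moreover have "\<phi> (A - B) \<noteq> {}" by (rule block_homD(3)[OF \<phi> sub ne])
    ultimately show False using eq by auto
  qed
  show ?thesis
  proof (rule inj_onI)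
    fix A B assume "A \<in> Pow U" "B \<in> Pow U" "\<phi> A = \<phi> B"
    then show "A = B" using sub[of A B] sub[of B A] by auto
  qed
qed

lemma forest_image:
  assumes "block_hom (\<Union>P) \<phi>" "is_forest P F"
  shows "is_forest (\<phi> ` P) (map (map_prod \<phi> \<phi>) F) \<and>
    leaves (\<phi> ` P) (map (map_prod \<phi> \<phi>) F) = \<phi> ` leaves P F"
  using assms
proof (induction F arbitrary: P)
  case (Cons V F)
  obtain C D where V: "V = (C, D)" by force
  have cV: "is_cut P (C, D)" using Cons.prems by (simp add: V)
  then have CD: "C \<noteq> {}" "D \<noteq> {}" "C \<inter> D = {}" "C \<union> D \<in> P" by (simp_all add: is_cut_pair)
  then have sub: "C \<subseteq> \<Union>P" "D \<subseteq> \<Union>P" by auto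
  have un: "\<phi> (C \<union> D) = \<phi> C \<union> \<phi> D" and disj: "\<phi> C \<inter> \<phi> D = {}" "\<phi> C \<noteq> {}" "\<phi> D \<noteq> {}"
    using block_homD[OF Cons.prems(1)] sub CD by simp_all
  have cut: "is_cut (\<phi> ` P) (\<phi> C, \<phi> D)"
    using disj CD(4) un by (auto simp: is_cut_pair simp flip: un)
  \<comment> \<open>By injectivity, removing the image of the cut block removes no other
    block.\<close>
  have "\<phi> ` (P - {C \<union> D}) = \<phi> ` P - \<phi> ` {C \<union> D}"
    by (rule inj_on_image_set_diff[OF block_hom_inj[OF Cons.prems(1)]]) (use CD(4) in auto)
  then have ap: "apply_cut (\<phi> ` P) (\<phi> C, \<phi> D) = \<phi> ` apply_cut P (C, D)"
    by (simp add: apply_cut_pair un image_Un)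
  have "block_hom (\<Union>(apply_cut P (C, D))) \<phi>" using Cons.prems(1) Union_apply_cut[OF cV] by simp
  then show ?case using Cons.IH[of "apply_cut P (C, D)"] Cons.prems(2) cut ap by (simp add: V)
qed simp

lemma map_tree_eq: "map_tree g T = map (map_prod ((`) g) ((`) g)) T"
  by (simp add: map_tree_def map_prod_def)

lemma flatten_eq: "flatten T = map (map_prod Union Union) T"
  by (simp add: flatten_def map_prod_def)

lemma block_hom_image: "inj_on g U \<Longrightarrow> block_hom U ((`) g)"
  unfolding block_hom_def by (auto simp: image_Un dest: inj_onD)

lemma block_hom_Union:
  assumes "fin_part P"
  shows "block_hom P Union"
  unfolding block_hom_def
proof (intro conjI allI impI)
  fix A B assume AB: "A \<subseteq> P" "B \<subseteq> P"
  show "\<Union>(A \<union> B) = \<Union>A \<union> \<Union>B" by simp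
  assume "A \<inter> B = {}"
  show "\<Union>A \<inter> \<Union>B = {}"
  proof (rule ccontr)
    assume "\<Union>A \<inter> \<Union>B \<noteq> {}"
    then obtain i S S' where i: "S \<in> A" "S' \<in> B" "i \<in> S" "i \<in> S'" by auto
    then have "S = S'" using fin_part_eq[OF assms, of S S' i] AB by blast
    then show False using i \<open>A \<inter> B = {}\<close> by blast
  qed
next
  fix A assume "A \<subseteq> P" "A \<noteq> {}"
  then show "\<Union>A \<noteq> {}" using fin_part_ne[OF assms] by blast
qed

lemma map_tree_layered_trees:
  assumes g: "inj_on g I" and T: "T \<in> layered_trees I"
  shows "map_tree g T \<in> layered_trees (g ` I)"
proof -
  have "block_hom (\<Union>{I}) ((`) g)" using block_hom_image[OF g] by simp
  from forest_image[OF this, of T] T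
  have "is_forest {g ` I} (map_tree g T)" "leaves {g ` I} (map_tree g T) = (`) g ` {{i} |i. i \<in> I}"
    by (auto simp: layered_trees_def map_tree_eq)
  moreover have "(`) g ` {{i} |i. i \<in> I} = {{i} |i. i \<in> g ` I}" by auto
  ultimately show ?thesis using T by (simp add: layered_trees_def)
qed

text \<open>Under \<open>Union\<close> the singleton leaf \<open>{S}\<close> of the tree becomes the
  block \<open>S\<close>.\<close>

lemma flatten_forest:
  assumes P: "fin_part P" and T: "T \<in> layered_trees P"
  shows "is_forest {\<Union>P} (flatten T)" "leaves {\<Union>P} (flatten T) = P"
proof -
  have "block_hom (\<Union>{P}) Union" using block_hom_Union[OF P] by simp
  from forest_image[OF this, of T] T
  have *: "is_forest {\<Union>P} (flatten T)" "leaves {\<Union>P} (flatten T) = Union ` {{i} |i. i \<in> P}"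
    by (auto simp: layered_trees_def flatten_eq)
  then show "is_forest {\<Union>P} (flatten T)" by simp
  have "Union ` {{i} |i. i \<in> P} = P" by force
  then show "leaves {\<Union>P} (flatten T) = P" using * by simp
qed

lemma finite_layered_trees:
  assumes "finite I"
  shows "finite (layered_trees I)"
proof (rule finite_subset)
  show "layered_trees I \<subseteq> {T. set T \<subseteq> Pow I \<times> Pow I \<and> distinct T}"
  proof
    fix T assume "T \<in> layered_trees I"
    then have T: "I \<noteq> {}" "is_forest {I} T" by (auto simp: layered_trees_def)
    have "distinct T" using distinct_forest[OF _ T(2)] T(1) assms by (simp add: fin_part_singleton)
    moreover have "set T \<subseteq> Pow I \<times> Pow I"
    proof
      fix V assume "V \<in> set T"
      obtain C D where V: "V = (C, D)" by force
      then show "V \<in> Pow I \<times> Pow I"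
        using forest_cut_subset[OF T(2), of C D] \<open>V \<in> set T\<close> by simp
    qed
    ultimately show "T \<in> {T. set T \<subseteq> Pow I \<times> Pow I \<and> distinct T}" by simp
  qed
  show "finite {T. set T \<subseteq> Pow I \<times> Pow I \<and> distinct T}"
    using assms by (intro finite_subset_distinct) simp
qed

section \<open>Derivatives along forests over part of a partition\<close>

lemma apply_cut_Un:
  assumes P: "fin_part (Q0 \<union> Q1)" and disj: "Q0 \<inter> Q1 = {}" and V: "is_cut Q1 V"
  shows "is_cut (Q0 \<union> Q1) V" "apply_cut (Q0 \<union> Q1) V = Q0 \<union> apply_cut Q1 V"
    "Q0 \<inter> apply_cut Q1 V = {}"
proof -
  obtain C D where V': "V = (C, D)" by force
  have CD: "C \<noteq> {}" "D \<noteq> {}" "C \<inter> D = {}" "C \<union> D \<in> Q1" using V by (auto simp: V' is_cut_pair)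
  show "is_cut (Q0 \<union> Q1) V" using CD by (simp add: V' is_cut_pair)
  have "C \<union> D \<notin> Q0" using CD(4) disj by blast
  then show "apply_cut (Q0 \<union> Q1) V = Q0 \<union> apply_cut Q1 V" by (auto simp: V' apply_cut_pair)
  have "S \<inter> (C \<union> D) = {}" if "S \<in> Q0" for S
    using fin_part_disjoint[OF P, of S "C \<union> D"] CD(4) that \<open>C \<union> D \<notin> Q0\<close> by blast
  then have "C \<notin> Q0" "D \<notin> Q0" using CD(1,2) by blast+
  then show "Q0 \<inter> apply_cut Q1 V = {}" using disj by (auto simp: V' apply_cut_pair)
qed

lemma forest_Un:
  assumes "fin_part (Q0 \<union> Q1)" "Q0 \<inter> Q1 = {}" "is_forest Q1 F"
  shows "is_forest (Q0 \<union> Q1) F \<and> leaves (Q0 \<union> Q1) F = Q0 \<union> leaves Q1 F \<and> Q0 \<inter> leaves Q1 F = {}"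
  using assms
proof (induction F arbitrary: Q1)
  case (Cons V F)
  have V: "is_cut Q1 V" using Cons.prems by simp
  note ap = apply_cut_Un[OF Cons.prems(1,2) V]
  have "fin_part (Q0 \<union> apply_cut Q1 V)" using fin_part_apply_cut[OF Cons.prems(1) ap(1)] ap(2) by simp
  then show ?case using Cons.IH[of "apply_cut Q1 V"] ap Cons.prems(3) by simp
qed simp

text \<open>\<open>Q0\<close> is a spectator: cuts of blocks in \<open>Q1\<close> leave the
  restriction to \<open>\<Union>Q0\<close> alone, so it enters as a fixed parameter of
  \<open>g\<close> while the derivatives act on the other argument. The functional \<open>f\<close>
  is only assumed to factor through the coarse splitting into \<open>Q0\<close> and
  \<open>Q1\<close>. \<open>g\<close> varies in the induction, being replaced by its cut
  derivative.\<close>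

lemma forest_deriv_Un:
  assumes "fin_part (Q0 \<union> Q1)" "Q0 \<inter> Q1 = {}" "is_forest Q1 F"
    and "\<And>X. X \<in> faces (Q0 \<union> Q1) \<Longrightarrow> f X = g (face_restrict X (\<Union>Q0)) (face_restrict X (\<Union>Q1))"
    and "X \<in> faces (Q0 \<union> leaves Q1 F)"
  shows "forest_deriv (Q0 \<union> Q1) F f X
    = forest_deriv Q1 F (g (face_restrict X (\<Union>Q0))) (face_restrict X (\<Union>Q1))"
  using assms
proof (induction F arbitrary: Q1 f g)
  case (Cons V F)
  obtain C D where V: "V = (C, D)" by force
  have cV: "is_cut Q1 V" "is_cut Q1 (prod.swap V)" using Cons.prems(3) by simp_all
  note P = Cons.prems(1)
  note ap = apply_cut_Un[OF P Cons.prems(2) cV(1)]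
  let ?Q = "apply_cut Q1 V"
  have fp: "fin_part (Q0 \<union> ?Q)" using fin_part_apply_cut[OF P ap(1)] ap(2) by simp
  have UQ: "\<Union>?Q = \<Union>Q1" by (rule Union_apply_cut[OF cV(1)])
  have CD: "C \<union> D \<in> Q1" using cV by (simp add: V is_cut_pair)
  have out: "\<Union>Q0 \<inter> (C \<union> D) = {}"
  proof -
    have "S \<inter> (C \<union> D) = {}" if "S \<in> Q0" for S
      using fin_part_disjoint[OF P, of S "C \<union> D"] CD that Cons.prems(2) by blast
    then show ?thesis by blast
  qed
  have step: "cut_deriv (Q0 \<union> Q1) V f Y
      = cut_deriv Q1 V (g (face_restrict Y (\<Union>Q0))) (face_restrict Y (\<Union>?Q))"
    if Y: "Y \<in> faces (Q0 \<union> ?Q)" for Y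
  proof -
    have Y1: "Y \<in> faces (apply_cut (Q0 \<union> Q1) W)" if "W = V \<or> W = prod.swap V" for W
      using Y ap(2) that by auto
    have f: "f (face_cut (Q0 \<union> Q1) W Y)
        = g (face_restrict Y (\<Union>Q0)) (face_cut Q1 W (face_restrict Y (\<Union>Q1)))"
      if W: "W = V \<or> W = prod.swap V" for W
    proof -
      have cW: "is_cut (Q0 \<union> Q1) W" "is_cut Q1 W" using ap(1) cV W by auto
      obtain A B where AB: "W = (A, B)" by force
      have "A \<union> B = C \<union> D" using W by (auto simp: V AB)
      then have "face_restrict (face_cut (Q0 \<union> Q1) W Y) (\<Union>Q0) = face_restrict Y (\<Union>Q0)"
        using face_restrict_face_cut_outside[OF P, of A B "\<Union>Q0" Y] cW(1) Y1[OF W] out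
        by (auto simp: AB)
      moreover have "face_restrict (face_cut (Q0 \<union> Q1) W Y) (\<Union>Q1)
          = face_cut Q1 W (face_restrict Y (\<Union>Q1))"
        by (rule face_restrict_face_cut_inside[OF P _ cW(2) Y1[OF W]]) simp
      ultimately show ?thesis
        using Cons.prems(4)[OF face_cut_in_faces[OF P cW(1) Y1[OF W]]] by simp
    qed
    have "face_restrict Y (\<Union>?Q) \<in> faces ?Q"
      using face_restrict_in_faces[OF fp _ Y] by simp
    then show ?thesis
      using f[of V] f[of "prod.swap V"] Y ap(2) unfolding cut_deriv_def UQ by simp
  qed
  have "forest_deriv (Q0 \<union> ?Q) F (cut_deriv (Q0 \<union> Q1) V f) X
      = forest_deriv ?Q F (cut_deriv Q1 V (g (face_restrict X (\<Union>Q0)))) (face_restrict X (\<Union>?Q))"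
    by (rule Cons.IH[where g = "\<lambda>x. cut_deriv Q1 V (g x)"])
      (use fp ap(3) Cons.prems(3,5) step in simp_all)
  then show ?case using ap(2) UQ by simp
qed simp

section \<open>Semisimply differentiable functionals are tensors\<close>

lemma Gamma_nonempty: "S \<noteq> {} \<Longrightarrow> Gamma S = Gamma_part {S}"
  by (simp add: Gamma_def)

lemma subspace_Gamma: "finite S \<Longrightarrow> fun_vs.subspace (Gamma S)"
  using subspace_Gamma_part[of "{S}"] by (auto simp: Gamma_def fin_part_singleton fun_vs.subspace_def fscale_def)

lemma Gamma_subset: "Gamma S \<subseteq> dual_on (faces {S})"
  by (auto simp: Gamma_def dual_on_def L_dual_def dest: Gamma_partD(1))

lemma finite_faces_block: "fin_part P \<Longrightarrow> S \<in> P \<Longrightarrow> finite (faces {S})"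
  by (rule finite_faces[OF fin_part_subset[of P]]) auto

lemma tensor_Gamma_subset: "fin_part P \<Longrightarrow> tensor P Gamma \<subseteq> dual_on (PiE P (\<lambda>S. faces {S}))"
  by (rule tensor_subset_dual_on) (auto simp: fin_part_finite Gamma_subset[THEN subsetD])

text \<open>A forest over \<open>{S}\<close> is also a forest over \<open>P\<close> that leaves the
  other blocks alone. Gluing the fixed faces \<open>x\<close> to a face \<open>Y\<close> over its
  leaves identifies the derivative of the slice at \<open>Y\<close> with that of
  \<open>ext_prod P t\<close> at the glued face, so semisimplicity passes to the slice.\<close>

lemma slice_in_Gamma:
  assumes P: "fin_part P" and f: "ext_prod P t \<in> Gamma_part P"
    and t: "t \<in> dual_on (PiE P (\<lambda>S. faces {S}))"
    and S: "S \<in> P" and x: "x \<in> PiE P (\<lambda>S. faces {S})"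
  shows "(\<lambda>z. t (x(S := z))) \<in> Gamma S"
proof -
  let ?g = "\<lambda>z. t (x(S := z))"
  let ?Q = "P - {S}"
  have PQ: "?Q \<union> {S} = P" "?Q \<inter> {S} = {}" using S by auto
  have fp: "fin_part (?Q \<union> {S})" using P PQ(1) by simp
  have L: "?g \<in> L_dual {S}"
  proof -
    have "x(S := z) \<notin> PiE P (\<lambda>S. faces {S})" if "z \<notin> faces {S}" for z
      using that S by (metis PiE_mem fun_upd_same)
    then show ?thesis using t by (simp add: L_dual_def dual_on_def)
  qed
  have "semisimple (leaves {S} F) (forest_deriv {S} F ?g)" if F: "is_forest {S} F" for F
  proof -
    let ?R = "leaves {S} F"
    note FU = forest_Un[OF fp PQ(2) F, unfolded PQ(1)]
    have fpS: "fin_part {S}" by (rule fin_part_subset[OF P]) (use S in simp)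
    have fpR: "fin_part ?R" by (rule fin_part_leaves[OF fpS F])
    have UR: "\<Union>?R = S" using Union_leaves[OF F] by simp
    have fpQR: "fin_part (?Q \<union> ?R)" using fin_part_leaves[OF P, of F] FU by simp
    have ss: "semisimple (?Q \<union> ?R) (forest_deriv P F (ext_prod P t))"
      using Gamma_partD(2)[OF f, of F] FU by simp
    have ext: "\<exists>X\<in>faces (?Q \<union> ?R). (\<forall>S'\<in>?Q. face_restrict X S' = x S') \<and> face_restrict X S = Y
        \<and> forest_deriv P F (ext_prod P t) X = forest_deriv {S} F ?g Y"
      if Y: "Y \<in> faces ?R" for Y
    proof -
      define u where "u S' = (if S' = S then ?R else {S'})" for S'
      have Uu: "(\<Union>S'\<in>P. u S') = ?Q \<union> ?R" using S by (auto simp: u_def)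
      have Uu': "\<Union>(u S') = S'" for S' by (simp add: u_def UR)
      obtain X where X: "X \<in> faces (\<Union>S'\<in>P. u S')"
          "\<And>S'. S' \<in> P \<Longrightarrow> face_restrict X (\<Union>(u S')) = (if S' = S then Y else x S')"
      proof (rule glue_faces[of P u "\<lambda>S'. if S' = S then Y else x S'"])
        show "finite P" using P by (rule fin_part_finite)
        show "fin_part (\<Union>S'\<in>P. u S')" using fpQR Uu by simp
        show "\<Union>(u A) \<inter> \<Union>(u B) = {}" if "A \<in> P" "B \<in> P" "A \<noteq> B" for A B
          using fin_part_disjoint[OF P that] by (simp add: Uu')
        show "(if A = S then Y else x A) \<in> faces (u A)" if "A \<in> P" for A
          using that Y x by (auto simp: u_def)
      qed blast
      have X1: "X \<in> faces (?Q \<union> ?R)" using X(1) Uu by simp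
      have X2: "face_restrict X S' = x S'" if "S' \<in> ?Q" for S' using X(2)[of S'] that Uu' by simp
      have X3: "face_restrict X S = Y" using X(2)[OF S] Uu' by simp
      \<comment> \<open>The first argument supplies the entries at the blocks other than
        \<open>S\<close>; this is the form that \<open>forest_deriv_Un\<close> expects.\<close>
      define g where "g x0 z = t (restrict (\<lambda>S'. if S' = S then z else face_restrict x0 S') P)" for x0 z
      have "forest_deriv (?Q \<union> {S}) F (ext_prod P t) X
          = forest_deriv {S} F (g (face_restrict X (\<Union>?Q))) (face_restrict X (\<Union>{S}))"
      proof (rule forest_deriv_Un[OF fp PQ(2) F _ X1])
        fix Z assume Z: "Z \<in> faces (?Q \<union> {S})"
        have "restrict (face_restrict Z) P
          = restrict (\<lambda>S'. if S' = S then face_restrict Z S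
              else face_restrict (face_restrict Z (\<Union>?Q)) S') P"
        proof (rule restrict_ext)
          fix S' assume S': "S' \<in> P"
          show "face_restrict Z S' = (if S' = S then face_restrict Z S
              else face_restrict (face_restrict Z (\<Union>?Q)) S')"
          proof (cases "S' = S")
            case False
            then have "S' \<subseteq> \<Union>?Q" using S' by blast
            then show ?thesis using False by (simp add: face_restrict_face_restrict)
          qed simp
        qed
        then show "ext_prod P t Z = g (face_restrict Z (\<Union>?Q)) (face_restrict Z (\<Union>{S}))"
          using Z PQ(1) by (simp add: ext_prod_def g_def)
      qed
      moreover have "g (face_restrict X (\<Union>?Q)) = ?g"
      proof
        fix z
        have "restrict (\<lambda>S'. if S' = S then z else face_restrict (face_restrict X (\<Union>?Q)) S') P
            = x(S := z)"
        proof
          fix S'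
          show "restrict (\<lambda>S'. if S' = S then z else face_restrict (face_restrict X (\<Union>?Q)) S') P S'
            = (x(S := z)) S'"
          proof (cases "S' \<in> ?Q")
            case True
            then have "S' \<subseteq> \<Union>?Q" by blast
            then show ?thesis using True X2[OF True] by (simp add: face_restrict_face_restrict)
          next
            case False
            moreover have "x S' = undefined" if "S' \<notin> P" using x that by (rule PiE_arb)
            ultimately show ?thesis using S by (cases "S' = S") simp_all
          qed
        qed
        then show "g (face_restrict X (\<Union>?Q)) z = t (x(S := z))" by (simp add: g_def)
      qed
      ultimately have "forest_deriv P F (ext_prod P t) X = forest_deriv {S} F ?g Y"
        using X3 PQ(1) by (simp only: ccpo_Sup_singleton)
      then show ?thesis using X1 X2 X3 by blast
    qed
    show ?thesis
      unfolding semisimple_iff[OF fpR]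
    proof (intro conjI ballI impI)
      show "forest_deriv {S} F ?g \<in> L_dual ?R" by (rule forest_deriv_in_L_dual[OF L])
      fix Y Y' assume Y: "Y \<in> faces ?R" "Y' \<in> faces ?R"
        and eq: "\<forall>E\<in>?R. face_restrict Y E = face_restrict Y' E"
      obtain X where X: "X \<in> faces (?Q \<union> ?R)" "\<forall>S'\<in>?Q. face_restrict X S' = x S'"
          "face_restrict X S = Y" "forest_deriv P F (ext_prod P t) X = forest_deriv {S} F ?g Y"
        using ext[OF Y(1)] by blast
      obtain X' where X': "X' \<in> faces (?Q \<union> ?R)" "\<forall>S'\<in>?Q. face_restrict X' S' = x S'"
          "face_restrict X' S = Y'" "forest_deriv P F (ext_prod P t) X' = forest_deriv {S} F ?g Y'"
        using ext[OF Y(2)] by blast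
      \<comment> \<open>Blocks away from \<open>S\<close> carry the same fixed faces and those
        inside \<open>S\<close> agree by assumption, so the semisimple derivative over
        \<open>P\<close> cannot distinguish the two glued faces.\<close>
      have "face_restrict X E = face_restrict X' E" if "E \<in> ?Q \<union> ?R" for E
      proof (cases "E \<in> ?R")
        case True
        then have "E \<subseteq> S" using UR by blast
        then show ?thesis
          using True eq face_restrict_face_restrict[of E S X] face_restrict_face_restrict[of E S X'] X(3) X'(3)
          by simp
      next
        case False
        then show ?thesis using that X(2) X'(2) by simp
      qed
      then have "forest_deriv P F (ext_prod P t) X = forest_deriv P F (ext_prod P t) X'"
        using ss X(1) X'(1) unfolding semisimple_iff[OF fpQR] by blast
      then show "forest_deriv {S} F ?g Y = forest_deriv {S} F ?g Y'" using X(4) X'(4) by simp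
    qed
  qed
  then have "?g \<in> Gamma_part {S}" using L by (simp add: Gamma_part_def)
  then show ?thesis using fin_part_ne[OF P S] by (simp add: Gamma_def)
qed

text \<open>The slices of the tensor given by semisimplicity lie in \<open>Gamma S\<close>, so
  \<open>mem_tensorI\<close> applies. This is surjectivity of the external product onto
  \<open>Gamma_part P\<close>; with \<open>inj_on_ext_prod\<close> it makes the inverse in
  \<open>tree_deriv\<close> meaningful.\<close>

lemma Gamma_part_ext_prod:
  assumes P: "fin_part P" and f: "f \<in> Gamma_part P"
  shows "f \<in> ext_prod P ` tensor P Gamma"
proof -
  obtain t where t: "t \<in> tensor P (\<lambda>S. L_dual {S})" "f = ext_prod P t"
    using Gamma_part_semisimple[OF f] by (auto simp: semisimple_def)
  have t': "t \<in> dual_on (PiE P (\<lambda>S. faces {S}))" using t(1) tensor_L_dual[OF P] by blast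
  have "t \<in> tensor P Gamma"
  proof (rule mem_tensorI[OF fin_part_finite[OF P] finite_faces_block[OF P] _ _ t'])
    show "fun_vs.subspace (Gamma S)" if "S \<in> P" for S
      using that P by (intro subspace_Gamma) (auto simp: fin_part_def intro: finite_subset)
    show "Gamma S \<subseteq> dual_on (faces {S})" for S by (rule Gamma_subset)
    show "(\<lambda>z. t (x(S := z))) \<in> Gamma S" if "S \<in> P" "x \<in> PiE P (\<lambda>S. faces {S})" for S x
      by (rule slice_in_Gamma[OF P _ t' that]) (use f t(2) in simp)
  qed
  then show ?thesis using t(2) by blast
qed

lemma inj_on_ext_prod:
  assumes P: "fin_part P"
  shows "inj_on (ext_prod P) (dual_on (PiE P (\<lambda>S. faces {S})))"
proof (rule inj_onI)
  fix t t' assume t: "t \<in> dual_on (PiE P (\<lambda>S. faces {S}))" "t' \<in> dual_on (PiE P (\<lambda>S. faces {S}))"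
    and eq: "ext_prod P t = ext_prod P t'"
  show "t = t'"
  proof
    fix x
    show "t x = t' x"
    proof (cases "x \<in> PiE P (\<lambda>S. faces {S})")
      case True
      then obtain X where "X \<in> faces P" "restrict (face_restrict X) P = x" by (rule glue_blocks[OF P])
      then show ?thesis using fun_cong[OF eq, of X] by (simp add: ext_prod_def)
    next
      case False
      then show ?thesis using t by (simp add: dual_on_def)
    qed
  qed
qed

section \<open>Forests over all blocks of a partition\<close>

text \<open>\<open>u S\<close> is the current partition of the block \<open>S\<close>. It varies in
  the induction because each processed forest replaces \<open>u S\<close> by its leaves while the
  other blocks wait.\<close>

lemma forest_concat:
  assumes "fin_part (\<Union>S\<in>P. u S)"
    and "\<And>S S'. S \<in> P \<Longrightarrow> S' \<in> P \<Longrightarrow> S \<noteq> S' \<Longrightarrow> u S \<inter> u S' = {}"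
    and "distinct Ss" "set Ss \<subseteq> P" "\<And>S. S \<in> set Ss \<Longrightarrow> is_forest (u S) (F S)"
  shows "is_forest (\<Union>S\<in>P. u S) (concat (map F Ss)) \<and>
    leaves (\<Union>S\<in>P. u S) (concat (map F Ss)) = (\<Union>S\<in>P. if S \<in> set Ss then leaves (u S) (F S) else u S)"
  using assms
proof (induction Ss arbitrary: u)
  case (Cons S Ss)
  let ?Q = "\<Union>S'\<in>P - {S}. u S'"
  let ?u = "u(S := leaves (u S) (F S))"
  have S: "S \<in> P" "S \<notin> set Ss" "is_forest (u S) (F S)" using Cons.prems by auto
  have U: "(\<Union>S\<in>P. u S) = ?Q \<union> u S" "(\<Union>S\<in>P. ?u S) = ?Q \<union> leaves (u S) (F S)" using S(1) by auto
  have disj: "?Q \<inter> u S = {}"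
  proof -
    have "u S' \<inter> u S = {}" if "S' \<in> P - {S}" for S' using Cons.prems(2)[of S' S] S(1) that by simp
    then show ?thesis by blast
  qed
  have fp: "fin_part (?Q \<union> u S)" using Cons.prems(1) unfolding U(1) .
  note FU = forest_Un[OF fp disj S(3)]
  have fp': "fin_part (\<Union>S\<in>P. ?u S)"
    unfolding U(2) using fin_part_leaves[OF fp, of "F S"] FU by simp
  have disj': "?u A \<inter> ?u B = {}" if AB: "A \<in> P" "B \<in> P" "A \<noteq> B" for A B
  proof -
    have out: "u C \<inter> leaves (u S) (F S) = {}" if "C \<in> P" "C \<noteq> S" for C
      using FU that by blast
    show ?thesis
      using out[of A] out[of B] Cons.prems(2)[OF AB] AB by (auto simp: Int_commute)
  qed
  have IH: "is_forest (\<Union>S\<in>P. ?u S) (concat (map F Ss)) \<and>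
    leaves (\<Union>S\<in>P. ?u S) (concat (map F Ss)) = (\<Union>S\<in>P. if S \<in> set Ss then leaves (?u S) (F S) else ?u S)"
    by (rule Cons.IH[OF fp' disj']) (use Cons.prems(3-5) in \<open>auto split: if_splits\<close>)
  have "(\<Union>A\<in>P. if A \<in> set Ss then leaves (?u A) (F A) else ?u A)
      = (\<Union>A\<in>P. if A \<in> set (S # Ss) then leaves (u A) (F A) else u A)"
    using S(2) by (intro SUP_cong refl) auto
  then show ?case
    using IH FU unfolding U by (simp add: is_forest_append leaves_append)
qed simp

text \<open>A product rule: each forest differentiates only the factor of its own block. One is
  processed at a time by \<open>forest_deriv_Un\<close>, with the other blocks as spectators, and
  both \<open>u\<close> and \<open>g\<close> are updated at that block.\<close>

lemma forest_deriv_concat: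
  assumes "finite P" "fin_part (\<Union>S\<in>P. u S)"
    and "\<And>S S'. S \<in> P \<Longrightarrow> S' \<in> P \<Longrightarrow> S \<noteq> S' \<Longrightarrow> u S \<inter> u S' = {}"
    and "distinct Ss" "set Ss \<subseteq> P" "\<And>S. S \<in> set Ss \<Longrightarrow> is_forest (u S) (F S)"
    and "\<And>X. X \<in> faces (\<Union>S\<in>P. u S) \<Longrightarrow> f X = (\<Prod>S\<in>P. g S (face_restrict X (\<Union>(u S))))"
    and "X \<in> faces (\<Union>S\<in>P. if S \<in> set Ss then leaves (u S) (F S) else u S)"
  shows "forest_deriv (\<Union>S\<in>P. u S) (concat (map F Ss)) f X
    = (\<Prod>S\<in>P. (if S \<in> set Ss then forest_deriv (u S) (F S) (g S) else g S) (face_restrict X (\<Union>(u S))))"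
  using assms
proof (induction Ss arbitrary: u f g)
  case (Cons S Ss)
  let ?Q = "\<Union>S'\<in>P - {S}. u S'"
  let ?u = "u(S := leaves (u S) (F S))"
  let ?g = "g(S := forest_deriv (u S) (F S) (g S))"
  have S: "S \<in> P" "S \<notin> set Ss" "is_forest (u S) (F S)" using Cons.prems by auto
  have U: "(\<Union>S\<in>P. u S) = ?Q \<union> u S" "(\<Union>S\<in>P. ?u S) = ?Q \<union> leaves (u S) (F S)" using S(1) by auto
  have disj: "?Q \<inter> u S = {}"
  proof -
    have "u S' \<inter> u S = {}" if "S' \<in> P - {S}" for S' using Cons.prems(3)[of S' S] S(1) that by simp
    then show ?thesis by blast
  qed
  have fp: "fin_part (?Q \<union> u S)" using Cons.prems(2) unfolding U(1) .
  note FU = forest_Un[OF fp disj S(3)]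
  have fp': "fin_part (\<Union>S\<in>P. ?u S)"
    unfolding U(2) using fin_part_leaves[OF fp, of "F S"] FU by simp
  have disj': "?u A \<inter> ?u B = {}" if AB: "A \<in> P" "B \<in> P" "A \<noteq> B" for A B
  proof -
    have out: "u C \<inter> leaves (u S) (F S) = {}" if "C \<in> P" "C \<noteq> S" for C
      using FU that by blast
    show ?thesis
      using out[of A] out[of B] Cons.prems(3)[OF AB] AB by (auto simp: Int_commute)
  qed
  have Uu: "\<Union>(?u A) = \<Union>(u A)" for A using Union_leaves[OF S(3)] by simp
  have sub: "\<Union>(u A) \<subseteq> \<Union>?Q" if "A \<in> P - {S}" for A using that by blast
  have step: "forest_deriv (\<Union>S\<in>P. u S) (F S) f Y = (\<Prod>A\<in>P. ?g A (face_restrict Y (\<Union>(?u A))))"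
    if Y: "Y \<in> faces (\<Union>S\<in>P. ?u S)" for Y
  proof -
    \<comment> \<open>The other factors depend only on the restriction to the spectators, so they
      act as a scalar and come out by linearity.\<close>
    define c where "c x = (\<Prod>A\<in>P - {S}. g A (face_restrict x (\<Union>(u A))))" for x
    have cQ: "c (face_restrict Z (\<Union>?Q)) = (\<Prod>A\<in>P - {S}. g A (face_restrict Z (\<Union>(u A))))" for Z
      unfolding c_def using face_restrict_face_restrict[OF sub] by (intro prod.cong) simp_all
    have "forest_deriv (?Q \<union> u S) (F S) f Y
        = forest_deriv (u S) (F S) (fscale (c (face_restrict Y (\<Union>?Q))) (g S)) (face_restrict Y (\<Union>(u S)))"
    proof (rule forest_deriv_Un[OF fp disj S(3), where g = "\<lambda>x. fscale (c x) (g S)"])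
      show "Y \<in> faces (?Q \<union> leaves (u S) (F S))" using Y unfolding U(2) .
      fix Z assume "Z \<in> faces (?Q \<union> u S)"
      then have "f Z = (\<Prod>A\<in>P. g A (face_restrict Z (\<Union>(u A))))"
        by (rule Cons.prems(7)[unfolded U(1)])
      also have "\<dots> = g S (face_restrict Z (\<Union>(u S))) * (\<Prod>A\<in>P - {S}. g A (face_restrict Z (\<Union>(u A))))"
        by (rule prod.remove[OF Cons.prems(1) S(1)])
      finally show "f Z = fscale (c (face_restrict Z (\<Union>?Q))) (g S) (face_restrict Z (\<Union>(u S)))"
        by (simp only: cQ fscale_def mult.commute)
    qed
    also have "\<dots> = forest_deriv (u S) (F S) (g S) (face_restrict Y (\<Union>(u S)))
        * (\<Prod>A\<in>P - {S}. g A (face_restrict Y (\<Union>(u A))))"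
      unfolding forest_deriv_scale cQ by (simp add: fscale_def mult.commute)
    also have "(\<Prod>A\<in>P - {S}. g A (face_restrict Y (\<Union>(u A))))
        = (\<Prod>A\<in>P - {S}. ?g A (face_restrict Y (\<Union>(u A))))"
      by (intro prod.cong) auto
    finally show ?thesis
      unfolding U(1) Uu prod.remove[OF Cons.prems(1) S(1)] by simp
  qed
  have cong1: "(\<Union>A\<in>P. if A \<in> set (S # Ss) then leaves (u A) (F A) else u A)
      = (\<Union>A\<in>P. if A \<in> set Ss then leaves (?u A) (F A) else ?u A)"
    using S(2) by (intro SUP_cong refl) auto
  have "forest_deriv (\<Union>S\<in>P. ?u S) (concat (map F Ss)) (forest_deriv (\<Union>S\<in>P. u S) (F S) f) X
    = (\<Prod>A\<in>P. (if A \<in> set Ss then forest_deriv (?u A) (F A) (?g A) else ?g A) (face_restrict X (\<Union>(?u A))))"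
  proof (rule Cons.IH[where u = ?u and g = ?g, OF Cons.prems(1) fp' disj' _ _ _ step])
    show "X \<in> faces (\<Union>A\<in>P. if A \<in> set Ss then leaves (?u A) (F A) else ?u A)"
      using Cons.prems(8) unfolding cong1 .
    show "is_forest (?u A) (F A)" if "A \<in> set Ss" for A using Cons.prems(6)[of A] that S(2) by auto
  qed (use Cons.prems(4,5) in auto)
  also have "\<dots> = (\<Prod>A\<in>P. (if A \<in> set (S # Ss) then forest_deriv (u A) (F A) (g A) else g A)
      (face_restrict X (\<Union>(u A))))"
    unfolding Uu using S(2) by (intro prod.cong refl) auto
  finally show ?case using FU unfolding U by (simp add: forest_deriv_append)
qed simp

section \<open>The coaction\<close>

lemma tree_deriv:
  assumes P: "fin_part P" and f: "f \<in> Gamma (\<Union>P)" and T: "T \<in> layered_trees P"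
  shows "tree_deriv (\<Union>P) P T f \<in> tensor P Gamma"
    "ext_prod P (tree_deriv (\<Union>P) P T f) = forest_deriv {\<Union>P} (flatten T) f"
proof -
  have "P \<noteq> {}" using T by (simp add: layered_trees_def)
  then have ne: "\<Union>P \<noteq> {}" using fin_part_ne[OF P] by blast
  have "forest_deriv {\<Union>P} (flatten T) f \<in> Gamma_part P"
    using forest_deriv_in_Gamma_part[of f "{\<Union>P}" "flatten T"] f flatten_forest[OF P T]
    unfolding Gamma_nonempty[OF ne] by simp
  then have im: "forest_deriv {\<Union>P} (flatten T) f \<in> ext_prod P ` tensor P Gamma"
    by (rule Gamma_part_ext_prod[OF P])
  have inj: "inj_on (ext_prod P) (tensor P Gamma)"
    using inj_on_ext_prod[OF P] tensor_Gamma_subset[OF P] by (rule inj_on_subset)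
  show "tree_deriv (\<Union>P) P T f \<in> tensor P Gamma"
    unfolding tree_deriv_def using the_inv_into_into[OF inj im] by simp
  show "ext_prod P (tree_deriv (\<Union>P) P T f) = forest_deriv {\<Union>P} (flatten T) f"
    unfolding tree_deriv_def by (rule f_the_inv_into_f[OF inj im])
qed

lemma sum_dual_basis:
  assumes "finite A" "\<phi> \<in> dual_on A"
  shows "(\<Sum>T\<in>A. dual_basis T' T * \<phi> T) = \<phi> T'"
proof -
  have "(\<Sum>T\<in>A. dual_basis T' T * \<phi> T) = (\<Sum>T\<in>A. if T = T' then \<phi> T else 0)"
    by (intro sum.cong) (auto simp: dual_basis_def)
  also have "\<dots> = \<phi> T'" using assms by (auto simp: dual_on_def)
  finally show ?thesis .
qed

lemma coaction_apply:
  assumes "finite I" "partition_on I P"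
  shows "coaction I f (P, T, x) = (if T \<in> layered_trees P then tree_deriv I P T f x else 0)"
proof -
  have P: "fin_part P" using assms by (simp add: fin_part_iff)
  have "coaction I f (P, T, x)
      = (\<Sum>T'\<in>layered_trees P. if T' = T then tree_deriv I P T' f x else 0)"
    using assms(2) by (auto simp: coaction_def dual_basis_def intro!: sum.cong)
  then show ?thesis using finite_layered_trees[OF fin_part_finite[OF P]] by simp
qed

text \<open>Inverting the external product and evaluating at the restrictions of \<open>X\<close>
  gives back the value at \<open>X\<close>. With \<open>coaction_outside\<close> and
  \<open>comp_dom_faceE\<close>, this turns identities about \<open>coaction\<close> into identities
  about forest derivatives at faces.\<close>

lemma coaction_face:
  assumes I: "finite I" and P: "partition_on I P" and f: "f \<in> Gamma I"
    and T: "T \<in> layered_trees P" and X: "X \<in> faces P"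
  shows "coaction I f (P, T, restrict (face_restrict X) P) = forest_deriv {I} (flatten T) f X"
proof -
  have fp: "fin_part P" and U: "\<Union>P = I" using I P by (simp_all add: fin_part_iff)
  show ?thesis
    using fun_cong[OF tree_deriv(2)[OF fp _ T, unfolded U, OF f], of X] X T
    by (simp add: coaction_apply[OF I P] ext_prod_def)
qed

lemma coaction_outside:
  assumes I: "finite I" and f: "f \<in> Gamma I"
    and p: "p \<notin> comp_dom layered_trees (\<lambda>S. faces {S}) I"
  shows "coaction I f p = 0"
proof -
  obtain P T x where pp: "p = (P, T, x)" by (metis prod_cases3)
  show ?thesis
  proof (cases "partition_on I P \<and> T \<in> layered_trees P")
    case True
    then have fp: "fin_part P" and U: "\<Union>P = I" using I by (simp_all add: fin_part_iff)
    have "x \<notin> PiE P (\<lambda>S. faces {S})" using p True by (simp add: comp_dom_def pp)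
    moreover have "tree_deriv I P T f \<in> dual_on (PiE P (\<lambda>S. faces {S}))"
      using tree_deriv(1)[OF fp _ , of f T] f True tensor_Gamma_subset[OF fp] unfolding U by blast
    ultimately show ?thesis using True by (simp add: pp coaction_apply[OF I] dual_on_def)
  next
    case False
    then show ?thesis by (auto simp: pp coaction_def dual_basis_def intro!: sum.neutral)
  qed
qed

lemma comp_dom_faceE:
  assumes I: "finite I" and p: "p \<in> comp_dom layered_trees (\<lambda>S. faces {S}) I"
  obtains P T X where "p = (P, T, restrict (face_restrict X) P)" "partition_on I P"
    "T \<in> layered_trees P" "X \<in> faces P"
proof -
  obtain P T x where pp: "p = (P, T, x)" by (metis prod_cases3)
  then have P: "partition_on I P" "T \<in> layered_trees P" "x \<in> PiE P (\<lambda>S. faces {S})"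
    using p by (simp_all add: comp_dom_def)
  moreover obtain X where "X \<in> faces P" "restrict (face_restrict X) P = x"
    using glue_blocks[OF _ P(3)] I P(1) by (auto simp: fin_part_iff)
  ultimately show ?thesis using that pp by blast
qed

lemma linear_on_coaction:
  fixes I :: "'a set"
  assumes I: "finite I"
  shows "linear_on (Gamma I :: ('a face \<Rightarrow> 'k::field) set) (coaction I)"
  unfolding linear_on_def
proof (intro conjI ballI allI)
  note sub = subspace_Gamma[OF I]
  fix f g :: "'a face \<Rightarrow> 'k" assume f: "f \<in> Gamma I" and g: "g \<in> Gamma I"
  have fg: "f + g \<in> Gamma I" using fun_vs.subspace_add[OF sub f g] .
  show "coaction I (f + g) = coaction I f + coaction I g"
  proof
    fix p :: "'a set set \<times> 'a set forest \<times> ('a set \<Rightarrow> 'a face)"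
    show "coaction I (f + g) p = (coaction I f + coaction I g) p"
    proof (cases "p \<in> comp_dom layered_trees (\<lambda>S. faces {S}) I")
      case True
      then show ?thesis
        by (rule comp_dom_faceE[OF I])
          (simp add: coaction_face[OF I] f g fg forest_deriv_add)
    qed (simp add: coaction_outside[OF I] f g fg)
  qed
next
  note sub = subspace_Gamma[OF I]
  fix c :: 'k and f :: "'a face \<Rightarrow> 'k" assume f: "f \<in> Gamma I"
  have cf: "fscale c f \<in> Gamma I" using fun_vs.subspace_scale[OF sub f] .
  show "coaction I (fscale c f) = fscale c (coaction I f)"
  proof
    fix p :: "'a set set \<times> 'a set forest \<times> ('a set \<Rightarrow> 'a face)"
    show "coaction I (fscale c f) p = fscale c (coaction I f) p"
    proof (cases "p \<in> comp_dom layered_trees (\<lambda>S. faces {S}) I")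
      case True
      then show ?thesis
        by (rule comp_dom_faceE[OF I])
          (simp add: coaction_face[OF I] f cf forest_deriv_scale, simp add: fscale_def coaction_face[OF I] f)
    next
      case False
      then show ?thesis
        by (simp add: coaction_outside[OF I cf], simp add: fscale_def coaction_outside[OF I f])
    qed
  qed
qed

section \<open>The coaction takes values in the cooperad dual to the Lie operad\<close>

lemma is_cut_flip: "is_cut P (D, C) \<longleftrightarrow> is_cut P (C, D)"
  using is_cut_swap[of P "(C, D)"] by (simp del: is_cut_swap)

lemma apply_cut_flip: "apply_cut P (D, C) = apply_cut P (C, D)"
  using apply_cut_swap[of P "(C, D)"] by (simp del: apply_cut_swap)

lemma forest_deriv_antisym:
  "forest_deriv P (xs @ (C, D) # ys) f + forest_deriv P (xs @ (D, C) # ys) f = 0"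
proof -
  let ?R = "leaves P xs" and ?f = "forest_deriv P xs f"
  have "cut_deriv ?R (C, D) ?f + cut_deriv ?R (D, C) ?f = 0"
    using cut_deriv_swap[of ?R "(C, D)" ?f] by simp
  then show ?thesis
    using forest_deriv_add[of "apply_cut ?R (C, D)" ys "cut_deriv ?R (C, D) ?f" "cut_deriv ?R (D, C) ?f"]
    by (simp add: forest_deriv_append forest_deriv_0 apply_cut_flip[of ?R D C])
qed

lemma three_blocksI:
  assumes "fin_part R" "is_cut R (A \<union> B, C)" "is_cut (apply_cut R (A \<union> B, C)) (A, B)"
  shows "three_blocks R A B C"
  using assms unfolding three_blocks_def is_cut_pair by auto

text \<open>The prefix \<open>xs\<close> only changes the partition at which
  \<open>cut_deriv_jacobi\<close> is applied. The derivative along \<open>ys\<close> is linear and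
  starts from the same partition in all three forests.\<close>

lemma jacobi_forest:
  assumes P: "fin_part P" and F: "is_forest P (xs @ (A \<union> B, C) # (A, B) # ys)"
  shows "is_forest P (xs @ (B \<union> C, A) # (B, C) # ys)"
    "leaves P (xs @ (B \<union> C, A) # (B, C) # ys) = leaves P (xs @ (A \<union> B, C) # (A, B) # ys)"
    "is_forest P (xs @ (C \<union> A, B) # (C, A) # ys)"
    "leaves P (xs @ (C \<union> A, B) # (C, A) # ys) = leaves P (xs @ (A \<union> B, C) # (A, B) # ys)"
    "forest_deriv P (xs @ (A \<union> B, C) # (A, B) # ys) f + forest_deriv P (xs @ (B \<union> C, A) # (B, C) # ys) f
      + forest_deriv P (xs @ (C \<union> A, B) # (C, A) # ys) f = 0"
proof -
  let ?R = "leaves P xs"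
  have R: "fin_part ?R" using fin_part_leaves[OF P] F by (simp add: is_forest_append)
  have tb: "three_blocks ?R A B C"
    by (rule three_blocksI[OF R]) (use F in \<open>simp_all add: is_forest_append\<close>)
  interpret a: three_blocks ?R A B C by (rule tb)
  interpret b: three_blocks ?R B C A by (rule a.permute)
  interpret c: three_blocks ?R C A B by (rule a.permute)
  have s: "b.split3 = a.split3" "c.split3 = a.split3"
    by (simp_all add: b.split3_def c.split3_def a.split3_def Un_ac insert_commute)
  note ap = a.apply_cut_twice b.apply_cut_twice[unfolded s] c.apply_cut_twice[unfolded s]
  show "is_forest P (xs @ (B \<union> C, A) # (B, C) # ys)"
    "leaves P (xs @ (B \<union> C, A) # (B, C) # ys) = leaves P (xs @ (A \<union> B, C) # (A, B) # ys)"
    "is_forest P (xs @ (C \<union> A, B) # (C, A) # ys)"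
    "leaves P (xs @ (C \<union> A, B) # (C, A) # ys) = leaves P (xs @ (A \<union> B, C) # (A, B) # ys)"
    using F b.cut1(1) b.cut2 c.cut1(1) c.cut2 by (simp_all add: is_forest_append leaves_append ap)
  show "forest_deriv P (xs @ (A \<union> B, C) # (A, B) # ys) f + forest_deriv P (xs @ (B \<union> C, A) # (B, C) # ys) f
      + forest_deriv P (xs @ (C \<union> A, B) # (C, A) # ys) f = 0"
    using cut_deriv_jacobi[OF tb, of "forest_deriv P xs f"]
    by (simp add: forest_deriv_append ap forest_deriv_0 flip: forest_deriv_add)
qed

text \<open>Pairing a generator of the relations with \<open>\<phi>\<close> evaluates
  \<open>\<phi>\<close> at the lists in it; a list that is no layered tree contributes 0, and
  \<open>\<phi>\<close> vanishes there too.\<close>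

lemma Lie_dualI:
  assumes P: "finite P" and \<phi>: "\<phi> \<in> Lay_dual P"
    and antisym: "\<And>xs C D ys. xs @ (C, D) # ys \<in> layered_trees P \<Longrightarrow>
      \<phi> (xs @ (C, D) # ys) + \<phi> (xs @ (D, C) # ys) = 0"
    and jacobi: "\<And>xs A B C ys. xs @ (A \<union> B, C) # (A, B) # ys \<in> layered_trees P \<Longrightarrow>
      \<phi> (xs @ (A \<union> B, C) # (A, B) # ys) + \<phi> (xs @ (B \<union> C, A) # (B, C) # ys)
        + \<phi> (xs @ (C \<union> A, B) # (C, A) # ys) = 0"
    and layering: "\<And>T T'. T \<in> layered_trees P \<Longrightarrow> T' \<in> layered_trees P \<Longrightarrow> set T = set T' \<Longrightarrow> \<phi> T = \<phi> T'"
  shows "\<phi> \<in> Lie_dual P"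
proof -
  have sum: "(\<Sum>T\<in>layered_trees P. dual_basis T' T * \<phi> T) = \<phi> T'" for T'
    using sum_dual_basis[OF finite_layered_trees[OF P]] \<phi> by (simp add: Lay_dual_def)
  have "(\<Sum>T\<in>layered_trees P. r T * \<phi> T) = 0" if "r \<in> Lie_relations P" for r
    using that unfolding Lie_relations_def Un_iff
  proof (elim disjE CollectE exE conjE)
    fix xs C D ys assume "xs @ [(C, D)] @ ys \<in> layered_trees P"
      and "r = dual_basis (xs @ [(C, D)] @ ys) + dual_basis (xs @ [(D, C)] @ ys)"
    then show ?thesis using antisym[of xs C D ys] by (simp add: distrib_right sum.distrib sum)
  next
    fix xs A B C ys assume "xs @ [(A \<union> B, C), (A, B)] @ ys \<in> layered_trees P"
      and "r = dual_basis (xs @ [(A \<union> B, C), (A, B)] @ ys)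
        + dual_basis (xs @ [(B \<union> C, A), (B, C)] @ ys) + dual_basis (xs @ [(C \<union> A, B), (C, A)] @ ys)"
    then show ?thesis using jacobi[of xs A B C ys] by (simp add: distrib_right sum.distrib sum)
  next
    fix T T' assume "T \<in> layered_trees P" "T' \<in> layered_trees P" "set T = set T'"
      and "r = dual_basis T - dual_basis T'"
    then show ?thesis using layering[of T T'] by (simp add: left_diff_distrib sum_subtractf sum)
  qed
  then show ?thesis using \<phi> by (simp add: Lie_dual_def)
qed

lemma subspace_Lie_dual: "fun_vs.subspace (Lie_dual P)"
  by (rule fun_vs.subspaceI)
    (auto simp: Lie_dual_def Lay_dual_def dual_on_def fscale_def distrib_left sum.distrib
      mult.left_commute simp flip: sum_distrib_left)

text \<open>For a fixed tuple \<open>x\<close> of faces, all values are derivatives along flattened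
  trees at one and the same face \<open>X\<close> glued from it. \<open>flatten\<close> respects
  unions, concatenation and sets of nodes, so relations between trees become relations between
  forest derivatives.\<close>

lemma coaction_in_Lie_dual:
  assumes I: "finite I" and P: "partition_on I P" and f: "f \<in> Gamma I"
  shows "(\<lambda>T. coaction I f (P, T, x)) \<in> Lie_dual P"
proof (cases "x \<in> PiE P (\<lambda>S. faces {S})")
  case False
  then have "coaction I f (P, T, x) = 0" for T
    by (intro coaction_outside[OF I f]) (simp add: comp_dom_def)
  then show ?thesis using fun_vs.subspace_0[OF subspace_Lie_dual, of P] by (simp add: zero_fun_def)
next
  case True
  have fp: "fin_part P" and U: "\<Union>P = I" using I P by (simp_all add: fin_part_iff)
  obtain X where X: "X \<in> faces P" "x = restrict (face_restrict X) P"
    using glue_blocks[OF fp True] by metis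
  have finP: "finite P" using fp by (rule fin_part_finite)
  have fpP: "fin_part {P}" if "T \<in> layered_trees P" for T
    using that finP by (simp add: layered_trees_def fin_part_singleton)
  have fpI: "fin_part {I}" if "T \<in> layered_trees P" for T
  proof -
    have "P \<noteq> {}" using that by (simp add: layered_trees_def)
    then have "\<Union>P \<noteq> {}" using fin_part_ne[OF fp] by blast
    then show ?thesis using I U by (simp add: fin_part_singleton)
  qed
  have val: "coaction I f (P, T, x) = forest_deriv {I} (flatten T) f X" if "T \<in> layered_trees P" for T
    unfolding X(2) by (rule coaction_face[OF I P f that X(1)])
  show ?thesis
  proof (rule Lie_dualI[OF finP])
    show "(\<lambda>T. coaction I f (P, T, x)) \<in> Lay_dual P"
      by (simp add: Lay_dual_def dual_on_def coaction_apply[OF I P])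
    fix xs ys and C D :: "'a set set" assume T: "xs @ (C, D) # ys \<in> layered_trees P"
    then have T': "xs @ (D, C) # ys \<in> layered_trees P"
      by (simp add: layered_trees_def is_forest_append leaves_append is_cut_flip[of _ D C] apply_cut_flip[of _ D C])
    show "coaction I f (P, xs @ (C, D) # ys, x) + coaction I f (P, xs @ (D, C) # ys, x) = 0"
      using fun_cong[OF forest_deriv_antisym[of "{I}" "flatten xs" "\<Union>C" "\<Union>D" "flatten ys" f], of X]
      unfolding val[OF T] val[OF T'] by (simp add: flatten_def)
  next
    fix xs ys and A B C :: "'a set set"
    assume T: "xs @ (A \<union> B, C) # (A, B) # ys \<in> layered_trees P"
    then have F: "is_forest {P} (xs @ (A \<union> B, C) # (A, B) # ys)" by (simp add: layered_trees_def)
    note J = jacobi_forest(1-4)[OF fpP[OF T] F]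
    have T2: "xs @ (B \<union> C, A) # (B, C) # ys \<in> layered_trees P"
        and T3: "xs @ (C \<union> A, B) # (C, A) # ys \<in> layered_trees P"
      using J T unfolding layered_trees_def by simp_all
    have "is_forest {I} (flatten xs @ (\<Union>A \<union> \<Union>B, \<Union>C) # (\<Union>A, \<Union>B) # flatten ys)"
      using flatten_forest(1)[OF fp T] U by (simp add: flatten_def)
    from fun_cong[OF jacobi_forest(5)[OF fpI[OF T] this, of f], of X]
    show "coaction I f (P, xs @ (A \<union> B, C) # (A, B) # ys, x)
        + coaction I f (P, xs @ (B \<union> C, A) # (B, C) # ys, x)
        + coaction I f (P, xs @ (C \<union> A, B) # (C, A) # ys, x) = 0"
      unfolding val[OF T] val[OF T2] val[OF T3] by (simp add: flatten_def)
  next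
    fix T T' assume T: "T \<in> layered_trees P" "T' \<in> layered_trees P" "set T = set T'"
    have fI: "f \<in> Gamma_part {I}" using f fpI[OF T(1)] by (simp add: Gamma_def fin_part_singleton)
    have "forest_deriv {I} (flatten T) f = forest_deriv {I} (flatten T') f"
      by (rule forest_deriv_layering[OF fpI[OF T(1)] _ _ _ fI])
        (use flatten_forest(1)[OF fp T(1)] flatten_forest(1)[OF fp T(2)] T(3) U in \<open>simp_all add: flatten_def\<close>)
    then show "coaction I f (P, T, x) = coaction I f (P, T', x)" using T by (simp add: val)
  qed
qed

text \<open>By \<open>mem_tensor2I\<close> it suffices to test slices: those in the tree variable
  lie in \<open>Lie_dual P\<close>, those in the face variables are values of
  \<open>tree_deriv\<close>.\<close>

lemma coaction_in_species_comp:
  assumes I: "finite I" and f: "f \<in> Gamma I"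
  shows "coaction I f \<in> species_comp Lie_dual Gamma I"
proof -
  have "(\<lambda>(T, x). coaction I f (P, T, x)) \<in> tensor2 (Lie_dual P) (tensor P Gamma)"
    if P: "partition_on I P" for P
  proof -
    have fp: "fin_part P" and U: "\<Union>P = I" using I P by (simp_all add: fin_part_iff)
    show ?thesis
    proof (rule mem_tensor2I[OF finite_layered_trees[OF fin_part_finite[OF fp]] subspace_Lie_dual])
      show "Lie_dual P \<subseteq> dual_on (layered_trees P)" by (auto simp: Lie_dual_def Lay_dual_def)
      fix x
      show "(\<lambda>T. case (T, x) of (T, x) \<Rightarrow> coaction I f (P, T, x)) \<in> Lie_dual P"
        using coaction_in_Lie_dual[OF I P f] by simp
    next
      fix T assume T: "T \<in> layered_trees P"
      have "(\<lambda>x. coaction I f (P, T, x)) = tree_deriv I P T f"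
        using T by (auto simp: coaction_apply[OF I P])
      then show "(\<lambda>x. case (T, x) of (T, x) \<Rightarrow> coaction I f (P, T, x)) \<in> tensor P Gamma"
        using tree_deriv(1)[OF fp _ T, of f] f U by simp
    qed
  qed
  moreover have "coaction I f (P, T, x) = 0" if "\<not> partition_on I P" for P T x
    using that by (simp add: coaction_def)
  ultimately show ?thesis by (auto simp: species_comp_def)
qed

text \<open>The counit selects the partition \<open>{I}\<close> and the stick, which is the empty
  list of nodes. The derivative along it is the identity, and a face over \<open>I\<close>
  restricted to \<open>I\<close> is itself.\<close>

lemma coaction_counit:
  assumes I: "finite I" and f: "f \<in> Gamma I"
  shows "left_unitor I (comp_map_left I Lie_counit (coaction I f)) = f"
proof
  fix X
  show "left_unitor I (comp_map_left I Lie_counit (coaction I f)) X = f X"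
  proof (cases "I = {}")
    case True
    \<comment> \<open>\<open>{{}}\<close> is not a partition, so the left side vanishes, as does
      \<open>f\<close> in \<open>Gamma {}\<close>.\<close>
    then show ?thesis using f by (simp add: left_unitor_def comp_map_left_def Gamma_def partition_on_def)
  next
    case False
    have P: "partition_on I {I}" using False by (simp add: partition_on_def)
    have T: "[] \<in> layered_trees {I}" by (auto simp: layered_trees_def)
    have *: "left_unitor I (comp_map_left I Lie_counit (coaction I f)) X
        = coaction I f ({I}, [], \<lambda>S\<in>{I}. X)"
      using P by (simp add: left_unitor_def comp_map_left_def Lie_counit_def)
    show ?thesis
    proof (cases "X \<in> faces {I}")
      case True
      have "face_restrict X I = X" using face_restrict_self[OF True] by simp
      then have "(\<lambda>S\<in>{I}. X) = restrict (face_restrict X) {I}" by (intro restrict_ext) simp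
      then show ?thesis using * coaction_face[OF I P f T True] by (simp add: flatten_def)
    next
      case X: False
      have "(\<lambda>S\<in>{I}. X) \<notin> PiE {I} (\<lambda>S. faces {S})" using X by (auto simp: PiE_iff)
      then have "coaction I f ({I}, [], \<lambda>S\<in>{I}. X) = 0"
        by (intro coaction_outside[OF I f]) (simp add: comp_dom_def)
      moreover have "f X = 0" using Gamma_subset[of I] f X by (auto simp: dual_on_def)
      ultimately show ?thesis using * by simp
    qed
  qed
qed

section \<open>Naturality\<close>

locale relabelling =
  fixes \<sigma> :: "'a \<Rightarrow> 'b" and I :: "'a set" and J :: "'b set"
  assumes I: "finite I" and \<sigma>: "bij_betw \<sigma> I J"
begin

text \<open>The map \<open>pull\<close> of \<open>Lie_Gamma_relabel\<close>. It is a direct image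
  along the inverse bijection, so that \<open>block_hom_image\<close> and
  \<open>forest_image\<close> apply.\<close>

abbreviation (input) \<tau> :: "'b set \<Rightarrow> 'a set" where
  "\<tau> \<equiv> (`) (inv_into I \<sigma>)"

lemma J: "finite J"
  using I \<sigma> bij_betw_finite by blast

lemma \<sigma>_image: "\<sigma> ` I = J"
  using \<sigma> by (simp add: bij_betw_def)

lemma \<sigma>_\<tau>: "S \<subseteq> J \<Longrightarrow> \<sigma> ` \<tau> S = S"
  using \<sigma>_image by (intro image_inv_into_cancel)

lemma \<tau>_\<sigma>: "E \<subseteq> I \<Longrightarrow> \<tau> (\<sigma> ` E) = E"
  using \<sigma> by (simp add: bij_betw_def)

lemma \<tau>_sub: "S \<subseteq> J \<Longrightarrow> \<tau> S \<subseteq> I"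
  using \<sigma>_image by (auto intro: inv_into_into)

lemma \<tau>_le_iff: "S \<subseteq> J \<Longrightarrow> E \<subseteq> I \<Longrightarrow> \<tau> S \<subseteq> E \<longleftrightarrow> S \<subseteq> \<sigma> ` E"
  using \<sigma>_\<tau>[of S] \<tau>_\<sigma>[of E] by (metis image_mono)

lemma le_\<tau>_iff: "S \<subseteq> J \<Longrightarrow> E \<subseteq> I \<Longrightarrow> E \<subseteq> \<tau> S \<longleftrightarrow> \<sigma> ` E \<subseteq> S"
  using \<sigma>_\<tau>[of S] \<tau>_\<sigma>[of E] by (metis image_mono)

lemma inj_inv: "inj_on (inv_into I \<sigma>) J"
  using \<sigma>_image by (metis inj_on_inv_into subset_refl)

lemma \<tau>_hom: "block_hom J \<tau>"
  by (rule block_hom_image[OF inj_inv])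

lemma \<tau>_J: "\<tau> J = I"
  using \<tau>_\<sigma>[of I] \<sigma>_image by simp

lemma \<tau>_partition:
  assumes P: "fin_part P" "\<Union>P = J"
  shows "fin_part (\<tau> ` P)" "\<Union>(\<tau> ` P) = I"
proof -
  have sub: "S \<subseteq> J" if "S \<in> P" for S using that P(2) by blast
  show U: "\<Union>(\<tau> ` P) = I" using P(2) \<tau>_J by (metis image_Union)
  have "\<tau> S \<inter> \<tau> S' = {}" if "S \<in> P" "S' \<in> P" "\<tau> S \<noteq> \<tau> S'" for S S'
  proof -
    have "S \<inter> S' = {}" using fin_part_disjoint[OF P(1)] that by metis
    then show ?thesis using block_homD(2)[OF \<tau>_hom sub sub] that by blast
  qed
  then have "disjoint (\<tau> ` P)" by (auto simp: disjoint_def)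
  then show "fin_part (\<tau> ` P)" using P(1) I U by (auto simp: fin_part_def)
qed

lemma pull_face_in_faces:
  assumes P: "fin_part P" "\<Union>P = J" and Y: "Y \<in> faces P"
  shows "pull_face \<sigma> I Y \<in> faces (\<tau> ` P)"
proof -
  note P' = \<tau>_partition[OF P]
  obtain h where h: "generic P h" "Y = sign_fun J h" using Y P by (auto simp: faces_iff)
  \<comment> \<open>The generic vector is transported along \<open>\<sigma>\<close>; its sums over
    \<open>E\<close> become sums of \<open>h\<close> over the image of \<open>E\<close>.\<close>
  define k where "k i = (if i \<in> I then h (\<sigma> i) else 0)" for i
  have sum: "sum k E = sum h (\<sigma> ` E)" if E: "E \<subseteq> I" for E
  proof -
    have "inj_on \<sigma> E" using \<sigma> E by (auto simp: bij_betw_def intro: inj_on_subset)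
    then have "sum h (\<sigma> ` E) = sum (h \<circ> \<sigma>) E" by (rule sum.reindex)
    also have "\<dots> = sum k E" using E by (intro sum.cong) (auto simp: k_def)
    finally show ?thesis by simp
  qed
  have "generic (\<tau> ` P) k"
    unfolding generic_def P'(2)
  proof (intro conjI allI impI)
    have "sum k S = 0" if S: "S \<in> \<tau> ` P" for S
    proof -
      obtain S0 where S0: "S0 \<in> P" "S = \<tau> S0" using S by blast
      have "S0 \<subseteq> J" using S0(1) P(2) by blast
      then have "sum k S = sum h S0" using sum[OF \<tau>_sub] S0(2) \<sigma>_\<tau> by simp
      then show ?thesis using h(1) S0(1) by (simp add: generic_def Tvee_def)
    qed
    then show "k \<in> Tvee (\<tau> ` P)" unfolding Tvee_def P'(2) by (simp add: k_def)
    fix E assume E: "E \<subseteq> I" "sum k E = 0"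
    have "\<sigma> ` E \<subseteq> J" using E(1) \<sigma>_image by blast
    then have r: "redn P (\<sigma> ` E) = {}" using h(1) sum[OF E(1)] E(2) P(2) by (simp add: generic_def)
    show "redn (\<tau> ` P) E = {}"
      unfolding redn_empty_iff
    proof
      fix i assume i: "i \<in> E"
      then obtain S where S: "S \<in> P" "\<sigma> i \<in> S" "S \<subseteq> \<sigma> ` E" using r unfolding redn_empty_iff by blast
      have SJ: "S \<subseteq> J" using S(1) P(2) by blast
      have "i \<in> I" using i E(1) by blast
      then have "{i} \<subseteq> \<tau> S" using le_\<tau>_iff[OF SJ, of "{i}"] S(2) by simp
      moreover have "\<tau> S \<subseteq> E" using \<tau>_le_iff[OF SJ E(1)] S(3) by simp
      ultimately show "\<exists>S\<in>\<tau> ` P. i \<in> S \<and> S \<subseteq> E" using S(1) by blast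
    qed
  qed
  moreover have "pull_face \<sigma> I Y = sign_fun I k"
  proof
    fix E
    have "\<sigma> ` E \<subseteq> J" if "E \<subseteq> I" using that \<sigma>_image by blast
    then show "pull_face \<sigma> I Y E = sign_fun I k E" by (simp add: pull_face_def sign_fun_def h(2) sum)
  qed
  ultimately show ?thesis using P' by (auto simp: faces_iff)
qed

lemma face_restrict_pull_face:
  assumes S: "S \<subseteq> J"
  shows "face_restrict (pull_face \<sigma> I Y) (\<tau> S) = pull_face \<sigma> (\<tau> S) (face_restrict Y S)"
proof
  fix E
  show "face_restrict (pull_face \<sigma> I Y) (\<tau> S) E = pull_face \<sigma> (\<tau> S) (face_restrict Y S) E"
  proof (cases "E \<subseteq> \<tau> S")
    case True
    then have "E \<subseteq> I" using \<tau>_sub[OF S] by blast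
    then show ?thesis
      using True le_\<tau>_iff[OF S, of E] by (simp add: face_restrict_def pull_face_def)
  qed (simp add: face_restrict_def pull_face_def)
qed

lemma \<tau>_cut:
  assumes P: "\<Union>P = J" and V: "is_cut P V"
  shows "is_cut (\<tau> ` P) (map_prod \<tau> \<tau> V)"
    "apply_cut (\<tau> ` P) (map_prod \<tau> \<tau> V) = \<tau> ` apply_cut P V"
  using forest_image[of P \<tau> "[V]"] \<tau>_hom V by (simp_all add: P)

lemma pull_face_cut:
  assumes P: "fin_part P" "\<Union>P = J" and V: "is_cut P V" and Y: "Y \<in> faces (apply_cut P V)"
  shows "pull_face \<sigma> I (face_cut P V Y) = face_cut (\<tau> ` P) (map_prod \<tau> \<tau> V) (pull_face \<sigma> I Y)"
proof
  fix E
  note P' = \<tau>_partition[OF P] and V' = \<tau>_cut[OF P(2) V]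
  obtain C D where CD: "V = (C, D)" by force
  have sub: "C \<subseteq> J" "D \<subseteq> J" using V P(2) by (auto simp: CD is_cut_pair)
  have U: "\<Union>(apply_cut P V) = J" using Union_apply_cut[OF V] P(2) by simp
  have Y': "pull_face \<sigma> I Y \<in> faces (apply_cut (\<tau> ` P) (map_prod \<tau> \<tau> V))"
    unfolding V'(2) by (rule pull_face_in_faces[OF fin_part_apply_cut[OF P(1) V] U Y])
  show "pull_face \<sigma> I (face_cut P V Y) E = face_cut (\<tau> ` P) (map_prod \<tau> \<tau> V) (pull_face \<sigma> I Y) E"
  proof (cases "E \<subseteq> I")
    case True
    then have "\<sigma> ` E \<subseteq> \<Union>P" "E \<subseteq> \<Union>(\<tau> ` P)" unfolding P(2) P'(2) using \<sigma>_image by auto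
    then show ?thesis
      using True face_cut_apply[OF P(1), of C D Y "\<sigma> ` E"] V Y
        face_cut_apply[OF P'(1), of "\<tau> C" "\<tau> D" "pull_face \<sigma> I Y" E] V'(1) Y'
        \<tau>_le_iff[OF sub(1) True] \<tau>_le_iff[OF sub(2) True]
      by (simp add: CD pull_face_def)
  next
    case False
    then have "\<not> E \<subseteq> \<Union>(\<tau> ` P)" unfolding P'(2) .
    then have "face_cut (\<tau> ` P) (map_prod \<tau> \<tau> V) (pull_face \<sigma> I Y) E = 0" by (rule face_cut_outside)
    then show ?thesis using False by (simp add: pull_face_def)
  qed
qed

text \<open>The two functionals are related only at faces, which suffices because cuts carry faces
  to faces; in the induction both are replaced by their cut derivatives.\<close>

lemma forest_deriv_pull:
  assumes "fin_part P" "\<Union>P = J" "is_forest P F"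
    and "\<And>Y. Y \<in> faces P \<Longrightarrow> f' Y = f (pull_face \<sigma> I Y)"
    and "Y \<in> faces (leaves P F)"
  shows "forest_deriv P F f' Y = forest_deriv (\<tau> ` P) (map (map_prod \<tau> \<tau>) F) f (pull_face \<sigma> I Y)"
  using assms
proof (induction F arbitrary: P f f')
  case (Cons V F)
  have V: "is_cut P V" "is_cut P (prod.swap V)" using Cons.prems(3) by simp_all
  note V' = \<tau>_cut[OF Cons.prems(2) V(1)]
  have sw: "prod.swap (map_prod \<tau> \<tau> V) = map_prod \<tau> \<tau> (prod.swap V)" by (cases V) simp
  have fp: "fin_part (apply_cut P V)" and U: "\<Union>(apply_cut P V) = J"
    using fin_part_apply_cut[OF Cons.prems(1) V(1)] Union_apply_cut[OF V(1)] Cons.prems(2) by simp_all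
  have "cut_deriv P V f' Z = cut_deriv (\<tau> ` P) (map_prod \<tau> \<tau> V) f (pull_face \<sigma> I Z)"
    if Z: "Z \<in> faces (apply_cut P V)" for Z
  proof -
    have "pull_face \<sigma> I Z \<in> faces (apply_cut (\<tau> ` P) (map_prod \<tau> \<tau> V))"
      unfolding V'(2) by (rule pull_face_in_faces[OF fp U Z])
    moreover have "f' (face_cut P W Z) = f (face_cut (\<tau> ` P) (map_prod \<tau> \<tau> W) (pull_face \<sigma> I Z))"
      if W: "W = V \<or> W = prod.swap V" for W
    proof -
      have cW: "is_cut P W" and ZW: "Z \<in> faces (apply_cut P W)" using W V Z by auto
      show ?thesis
        unfolding Cons.prems(4)[OF face_cut_in_faces[OF Cons.prems(1) cW ZW]]
          pull_face_cut[OF Cons.prems(1,2) cW ZW] ..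
    qed
    ultimately show ?thesis using Z by (simp add: cut_deriv_def sw)
  qed
  then show ?case
    using Cons.IH[OF fp U _, of "cut_deriv P V f'" "cut_deriv (\<tau> ` P) (map_prod \<tau> \<tau> V) f"]
      Cons.prems(3,5) V'(2) by simp
qed simp

lemma Gamma_relabel_face: "Y \<in> faces {J} \<Longrightarrow> Gamma_relabel \<sigma> I J f Y = f (pull_face \<sigma> I Y)"
  by (simp add: Gamma_relabel_def)

lemma Gamma_relabel_in_Gamma:
  assumes f: "f \<in> Gamma I"
  shows "Gamma_relabel \<sigma> I J f \<in> Gamma J"
proof (cases "J = {}")
  case True
  then have "I = {}" using \<sigma>_image by simp
  then show ?thesis using f True by (auto simp: Gamma_def Gamma_relabel_def)
next
  case False
  then have "I \<noteq> {}" using \<sigma>_image by blast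
  then have fI: "f \<in> Gamma_part {I}" using f by (simp add: Gamma_def)
  have fp: "fin_part {J}" using False J by (simp add: fin_part_singleton)
  have U: "\<Union>{J} = J" by simp
  have L: "Gamma_relabel \<sigma> I J f \<in> L_dual {J}"
    by (simp add: L_dual_def dual_on_def Gamma_relabel_def)
  have "semisimple (leaves {J} F) (forest_deriv {J} F (Gamma_relabel \<sigma> I J f))"
    if F: "is_forest {J} F" for F
  proof -
    let ?Q = "leaves {J} F" and ?F = "map (map_prod \<tau> \<tau>) F"
    have fpQ: "fin_part ?Q" and UQ: "\<Union>?Q = J"
      using fin_part_leaves[OF fp F] Union_leaves[OF F] by simp_all
    have hom: "block_hom (\<Union>{J}) \<tau>" using \<tau>_hom by simp
    have F': "is_forest {I} ?F" "leaves {I} ?F = \<tau> ` ?Q"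
      using forest_image[OF hom F] \<tau>_J by simp_all
    have ss: "semisimple (\<tau> ` ?Q) (forest_deriv {I} ?F f)"
      using Gamma_partD(2)[OF fI F'(1)] F'(2) by simp
    have val: "forest_deriv {J} F (Gamma_relabel \<sigma> I J f) Y = forest_deriv {I} ?F f (pull_face \<sigma> I Y)"
      if "Y \<in> faces ?Q" for Y
      using forest_deriv_pull[where f' = "Gamma_relabel \<sigma> I J f" and f = f,
          OF fp U F Gamma_relabel_face that] \<tau>_J by simp
    show ?thesis
      unfolding semisimple_iff[OF fpQ]
    proof (intro conjI ballI impI)
      show "forest_deriv {J} F (Gamma_relabel \<sigma> I J f) \<in> L_dual ?Q"
        by (rule forest_deriv_in_L_dual[OF L])
      fix Y Z assume Y: "Y \<in> faces ?Q" and Z: "Z \<in> faces ?Q"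
        and eq: "\<forall>S\<in>?Q. face_restrict Y S = face_restrict Z S"
      have "face_restrict (pull_face \<sigma> I Y) S = face_restrict (pull_face \<sigma> I Z) S"
        if S: "S \<in> \<tau> ` ?Q" for S
      proof -
        obtain S0 where S0: "S0 \<in> ?Q" "S = \<tau> S0" using S by blast
        then have "S0 \<subseteq> J" using UQ by blast
        then show ?thesis using face_restrict_pull_face[of S0] eq S0 by simp
      qed
      moreover have "pull_face \<sigma> I Y \<in> faces (\<tau> ` ?Q)" "pull_face \<sigma> I Z \<in> faces (\<tau> ` ?Q)"
        using pull_face_in_faces[OF fpQ UQ] Y Z by blast+
      ultimately show "forest_deriv {J} F (Gamma_relabel \<sigma> I J f) Y
          = forest_deriv {J} F (Gamma_relabel \<sigma> I J f) Z"
        using ss unfolding semisimple_iff[OF \<tau>_partition(1)[OF fpQ UQ]] val[OF Y] val[OF Z] by blast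
    qed
  qed
  then show ?thesis using L False by (simp add: Gamma_def Gamma_part_def)
qed

text \<open>Both sides are compared at a face \<open>Y\<close> over \<open>P\<close>. Transport
  commutes with forest derivatives by \<open>forest_deriv_pull\<close>, and with
  \<open>flatten\<close> because direct images commute with unions.\<close>

lemma coaction_relabel:
  assumes f: "f \<in> Gamma I"
  shows "coaction J (Gamma_relabel \<sigma> I J f) = Lie_Gamma_relabel \<sigma> I J (coaction I f)"
proof
  note f' = Gamma_relabel_in_Gamma[OF f]
  fix p :: "'b set set \<times> 'b set forest \<times> ('b set \<Rightarrow> 'b face)"
  show "coaction J (Gamma_relabel \<sigma> I J f) p = Lie_Gamma_relabel \<sigma> I J (coaction I f) p"
  proof (cases "p \<in> comp_dom layered_trees (\<lambda>S. faces {S}) J")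
    case False
    moreover obtain P T y where "p = (P, T, y)" by (metis prod_cases3)
    ultimately show ?thesis
      using coaction_outside[OF J f', of p] by (simp add: Lie_Gamma_relabel_def)
  next
    case True
    then obtain P T Y where p: "p = (P, T, restrict (face_restrict Y) P)" and P: "partition_on J P"
      and T: "T \<in> layered_trees P" and Y: "Y \<in> faces P"
      by (rule comp_dom_faceE[OF J])
    have fp: "fin_part P" and U: "\<Union>P = J" using P J by (simp_all add: fin_part_iff)
    note P' = \<tau>_partition[OF fp U]
    have part: "partition_on I (\<tau> ` P)" using P' I by (simp add: fin_part_iff)
    have inj: "inj_on \<tau> P"
      using block_hom_inj[OF \<tau>_hom] by (rule inj_on_subset) (use U in blast)
    note T' = map_tree_layered_trees[OF inj T]
    have "P \<noteq> {}" using T by (simp add: layered_trees_def)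
    then have Jne: "J \<noteq> {}" using fin_part_ne[OF fp] U by blast
    have fpJ: "fin_part {J}" using Jne J by (simp add: fin_part_singleton)
    have lv: "is_forest {J} (flatten T)" "leaves {J} (flatten T) = P"
      using flatten_forest[OF fp T] U by simp_all
    have "coaction J (Gamma_relabel \<sigma> I J f) p
        = forest_deriv {J} (flatten T) (Gamma_relabel \<sigma> I J f) Y"
      unfolding p by (rule coaction_face[OF J P f' T Y])
    also have "\<dots> = forest_deriv (\<tau> ` {J}) (map (map_prod \<tau> \<tau>) (flatten T)) f (pull_face \<sigma> I Y)"
      by (rule forest_deriv_pull[OF fpJ _ lv(1) Gamma_relabel_face]) (use lv(2) Y in simp_all)
    also have "map (map_prod \<tau> \<tau>) (flatten T) = flatten (map_tree \<tau> T)"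
      by (simp add: flatten_def map_tree_def image_Union split_beta)
    also have "forest_deriv (\<tau> ` {J}) (flatten (map_tree \<tau> T)) f (pull_face \<sigma> I Y)
        = coaction I f (\<tau> ` P, map_tree \<tau> T, restrict (face_restrict (pull_face \<sigma> I Y)) (\<tau> ` P))"
      using coaction_face[OF I part f T' pull_face_in_faces[OF fp U Y]] \<tau>_J by simp
    also have "restrict (face_restrict (pull_face \<sigma> I Y)) (\<tau> ` P)
        = (\<lambda>S\<in>\<tau> ` P. pull_face \<sigma> S (restrict (face_restrict Y) P (\<sigma> ` S)))"
    proof (rule restrict_ext)
      fix S assume "S \<in> \<tau> ` P"
      then obtain S0 where S0: "S0 \<in> P" "S = \<tau> S0" by blast
      then have "S0 \<subseteq> J" using U by blast
      then show "face_restrict (pull_face \<sigma> I Y) S = pull_face \<sigma> S (restrict (face_restrict Y) P (\<sigma> ` S))"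
        using face_restrict_pull_face[of S0] S0 \<sigma>_\<tau>[of S0] by simp
    qed
    also have "coaction I f (\<tau> ` P, map_tree \<tau> T, \<dots>) = Lie_Gamma_relabel \<sigma> I J (coaction I f) p"
      using True by (simp add: p Lie_Gamma_relabel_def)
    finally show ?thesis .
  qed
qed

end

section \<open>Coassociativity\<close>

text \<open>This certifies the choice made by \<open>tensor_map\<close>: the induced map is linear
  on tensors and acts factorwise on pure ones.\<close>

lemma tensor_map_coaction:
  assumes "finite I" "partition_on I P"
  shows "is_tensor_map P (Gamma :: _ \<Rightarrow> ('a face \<Rightarrow> 'k::field) set) coaction (tensor_map P Gamma coaction)"
proof -
  have fp: "fin_part P" using assms by (simp add: fin_part_iff)
  have fin: "finite S" if "S \<in> P" for S
    using fp that by (auto simp: fin_part_def intro: finite_subset)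
  show ?thesis
    by (rule tensor_map[where X = "\<lambda>S. faces {S}"])
      (simp_all add: fin_part_finite[OF fp] finite_faces_block[OF fp] Gamma_subset subspace_Gamma fin
        linear_on_coaction)
qed

text \<open>Pure tensors span. Linearity is asked for inside \<open>tensor K V\<close> only, because
  \<open>tensor_map\<close> is unspecified elsewhere.\<close>

lemma tensor_functional_eqI:
  assumes t: "t \<in> tensor K V"
    and A: "A 0 = 0" "\<And>c p s. p \<in> tensor K V \<Longrightarrow> s \<in> tensor K V \<Longrightarrow> A (fscale c p + s) = c * A p + A s"
    and B: "B 0 = 0" "\<And>c p s. p \<in> tensor K V \<Longrightarrow> s \<in> tensor K V \<Longrightarrow> B (fscale c p + s) = c * B p + B s"
    and eq: "\<And>f. (\<And>j. j \<in> K \<Longrightarrow> f j \<in> V j) \<Longrightarrow> A (pure_tensor K f) = B (pure_tensor K f)"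
  shows "A t = (B t :: 'k::field)"
proof -
  have "t \<in> tensor K V \<and> A t = B t"
    using t unfolding tensor_def
  proof (induction rule: fun_vs.span_induct_alt)
    case base
    show ?case by (simp only: A(1) B(1) fun_vs.span_zero simp_thms)
  next
    case (step c p s)
    then have p: "p \<in> tensor K V" unfolding tensor_def by (intro fun_vs.span_base)
    have s: "s \<in> tensor K V" using step unfolding tensor_def by blast
    have "A p = B p" using step(1) eq by blast
    then have "A (fscale c p + s) = B (fscale c p + s)"
      unfolding A(2)[OF p s] B(2)[OF p s] using step(2) by metis
    moreover have "fscale c p + s \<in> tensor K V"
      by (intro fun_vs.subspace_add[OF subspace_tensor] fun_vs.subspace_scale[OF subspace_tensor] p s)
    ultimately show ?case unfolding tensor_def by blast
  qed
  then show ?thesis by simp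
qed

lemma tensor_map_linear:
  assumes L: "is_tensor_map K V \<eta> L" and p: "p \<in> tensor K V" and s: "s \<in> tensor K V"
  shows "L 0 = 0" "L (fscale c p + s) y = c * L p y + L s y"
proof -
  note lin = L[unfolded is_tensor_map_def linear_on_def, THEN conjunct1]
  have "L (fscale 0 p) = fscale 0 (L p)" using lin p by blast
  then show "L 0 = 0" by (simp add: fscale_def zero_fun_def)
  have "fscale c p \<in> tensor K V" by (rule fun_vs.subspace_scale[OF subspace_tensor p])
  then have "L (fscale c p + s) = fscale c (L p) + L s" using lin p s by metis
  then show "L (fscale c p + s) y = c * L p y + L s y" by (simp add: fscale_def)
qed

lemma ext_prod_linear: "ext_prod P (fscale c p + s) = fscale c (ext_prod P p) + ext_prod P s"
  by (auto simp: ext_prod_def fscale_def fun_eq_iff)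

lemma ext_prod_0: "ext_prod P 0 = 0"
  by (auto simp: ext_prod_def fun_eq_iff)

text \<open>Both sides are linear in the tensor \<open>tree_deriv I P T f\<close>, which may thus be
  replaced by a pure tensor. Then the left side is a product of coactions of the factors, and the
  right side is the same product by \<open>forest_deriv_concat\<close>, whatever the order
  \<open>Ss\<close> of the blocks.\<close>

lemma coassociativity_at_forests:
  assumes I: "finite I" and f: "f \<in> Gamma I" and P: "partition_on I P" and T: "T \<in> layered_trees P"
    and part: "\<And>S. S \<in> P \<Longrightarrow> partition_on S (part S)"
    and tree: "\<And>S. S \<in> P \<Longrightarrow> tree S \<in> layered_trees (part S)"
    and X: "X \<in> faces (\<Union>S\<in>P. part S)"
    and Ss: "distinct Ss" "set Ss = P"
    and y: "y \<in> extensional P"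
      "\<And>S. S \<in> P \<Longrightarrow> y S = (part S, tree S, restrict (face_restrict X) (part S))"
  shows "tensor_map P Gamma coaction (tree_deriv I P T f) y
    = forest_deriv {I} (flatten T @ concat (map (\<lambda>S. flatten (tree S)) Ss)) f X"
proof -
  have fp: "fin_part P" and U: "\<Union>P = I" using I P by (simp_all add: fin_part_iff)
  have finS: "finite S" if "S \<in> P" for S
    using fp that by (auto simp: fin_part_def intro: finite_subset)
  have fpS: "fin_part (part S)" and US: "\<Union>(part S) = S" if "S \<in> P" for S
    using part[OF that] finS[OF that] by (simp_all add: fin_part_iff)
  have ft: "is_forest {S} (flatten (tree S))" "leaves {S} (flatten (tree S)) = part S" if "S \<in> P" for S
    using flatten_forest[OF fpS tree] US that by simp_all
  let ?F = "concat (map (\<lambda>S. flatten (tree S)) Ss)"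
  let ?L = "tensor_map P (Gamma :: _ \<Rightarrow> ('a face \<Rightarrow> 'b) set) coaction"
  let ?g = "tree_deriv I P T f"
  note L = tensor_map_coaction[OF I P]
  have g: "?g \<in> tensor P Gamma" "ext_prod P ?g = forest_deriv {I} (flatten T) f"
    using tree_deriv[OF fp _ T, unfolded U, OF f] by simp_all
  have lv: "leaves {I} (flatten T) = P" using flatten_forest(2)[OF fp T] U by simp
  have UQ: "(\<Union>S\<in>P. {S}) = P" by simp
  have fpU: "fin_part (\<Union>S\<in>P. {S})" unfolding UQ by (rule fp)
  have Q: "(\<Union>S\<in>P. if S \<in> set Ss then leaves {S} (flatten (tree S)) else {S}) = (\<Union>S\<in>P. part S)"
    using Ss(2) ft(2) by (intro SUP_cong refl) simp
  have "?L ?g y = forest_deriv P ?F (ext_prod P ?g) X"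
  proof (rule tensor_functional_eqI[where A = "\<lambda>t. ?L t y" and B = "\<lambda>t. forest_deriv P ?F (ext_prod P t) X", OF g(1)])
    show "?L 0 y = 0" using tensor_map_linear(1)[OF L g(1) g(1)] by simp
    show "?L (fscale c p + s) y = c * ?L p y + ?L s y" if "p \<in> tensor P Gamma" "s \<in> tensor P Gamma" for c p s
      by (rule tensor_map_linear(2)[OF L that])
    show "forest_deriv P ?F (ext_prod P 0) X = 0" by (simp add: ext_prod_0 forest_deriv_0)
    show "forest_deriv P ?F (ext_prod P (fscale c p + s)) X
        = c * forest_deriv P ?F (ext_prod P p) X + forest_deriv P ?F (ext_prod P s) X" for c p s
      by (simp add: ext_prod_linear forest_deriv_add forest_deriv_scale) (simp add: fscale_def)
    fix h :: "'a set \<Rightarrow> 'a face \<Rightarrow> 'b" assume h: "\<And>S. S \<in> P \<Longrightarrow> h S \<in> Gamma S"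
    have "?L (pure_tensor P h) = pure_tensor P (\<lambda>S. coaction S (h S))"
      using L h unfolding is_tensor_map_def by blast
    then have "?L (pure_tensor P h) y = (\<Prod>S\<in>P. coaction S (h S) (y S))"
      using y(1) by (simp add: pure_tensor_def)
    also have "\<dots> = (\<Prod>S\<in>P. forest_deriv {S} (flatten (tree S)) (h S) (face_restrict X S))"
    proof (rule prod.cong[OF refl])
      fix S assume S: "S \<in> P"
      have sub: "part S \<subseteq> (\<Union>S\<in>P. part S)" using S by blast
      \<comment> \<open>The union of the \<open>part S\<close> is the set of leaves of the
        concatenated forest, hence a partition.\<close>
      have "is_forest (\<Union>S\<in>P. {S}) ?F \<and> leaves (\<Union>S\<in>P. {S}) ?F = (\<Union>S\<in>P. part S)"
        unfolding Q[symmetric] by (rule forest_concat[OF fpU _ Ss(1)]) (use Ss(2) ft(1) in auto)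
      then have fpQ: "fin_part (\<Union>S\<in>P. part S)" using fin_part_leaves[OF fpU, of ?F] by metis
      have XS: "face_restrict X S \<in> faces (part S)"
        using face_restrict_in_faces[OF fpQ sub X] US[OF S] by simp
      have "restrict (face_restrict X) (part S) = restrict (face_restrict (face_restrict X S)) (part S)"
      proof (rule restrict_ext)
        fix R assume "R \<in> part S"
        then have "R \<subseteq> S" using US[OF S] by blast
        then show "face_restrict X R = face_restrict (face_restrict X S) R"
          by (simp add: face_restrict_face_restrict)
      qed
      then show "coaction S (h S) (y S) = forest_deriv {S} (flatten (tree S)) (h S) (face_restrict X S)"
        using coaction_face[OF finS[OF S] part[OF S] h[OF S] tree[OF S] XS] y(2)[OF S] by simp
    qed
    also have "\<dots> = (\<Prod>S\<in>P. (if S \<in> set Ss then forest_deriv {S} (flatten (tree S)) (h S) else h S)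
        (face_restrict X (\<Union>{S})))"
      using Ss(2) by (intro prod.cong) simp_all
    also have "\<dots> = forest_deriv (\<Union>S\<in>P. {S}) ?F (ext_prod P (pure_tensor P h)) X"
    proof (rule forest_deriv_concat[symmetric, OF fin_part_finite[OF fp] fpU _ Ss(1)])
      show "X \<in> faces (\<Union>S\<in>P. if S \<in> set Ss then leaves {S} (flatten (tree S)) else {S})"
        unfolding Q by (rule X)
      show "ext_prod P (pure_tensor P h) Z = (\<Prod>S\<in>P. h S (face_restrict Z (\<Union>{S})))"
        if "Z \<in> faces (\<Union>S\<in>P. {S})" for Z
        using ext_prod_pure_tensor[of Z P h] that by simp
    qed (use Ss(2) ft(1) in auto)
    finally show "?L (pure_tensor P h) y = forest_deriv P ?F (ext_prod P (pure_tensor P h)) X"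
      unfolding UQ .
  qed
  then show ?thesis by (simp add: forest_deriv_append lv g(2))
qed

text \<open>A set \<open>C\<close> of blocks becomes the set of their partitions. One flattening
  collects all the smaller blocks, the second their elements, and this is \<open>\<Union>C\<close>
  again.\<close>

lemma flatten_map_tree_parts:
  assumes T: "T \<in> layered_trees P" and part: "\<And>S. S \<in> P \<Longrightarrow> \<Union>(part S) = S"
  shows "flatten (flatten (map_tree part T)) = flatten T"
proof -
  have U: "\<Union>(\<Union>(part ` C)) = \<Union>C" if C: "C \<subseteq> P" for C
  proof -
    have "\<Union>(\<Union>(part ` C)) = (\<Union>S\<in>C. \<Union>(part S))" by blast
    also have "\<dots> = (\<Union>S\<in>C. S)" using part C by (intro SUP_cong refl) blast
    finally show ?thesis by simp
  qed
  show ?thesis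
    unfolding flatten_def map_tree_def map_map o_def
  proof (rule map_cong[OF refl])
    fix V assume V: "V \<in> set T"
    obtain C D where CD: "V = (C, D)" by force
    have "C \<subseteq> P" "D \<subseteq> P"
      using forest_cut_subset[of "{P}" T C D] T V by (simp_all add: layered_trees_def CD)
    from U[OF this(1)] U[OF this(2)]
    show "(case case case V of (C, D) \<Rightarrow> (part ` C, part ` D) of (C, D) \<Rightarrow> (\<Union>C, \<Union>D) of
        (C, D) \<Rightarrow> (\<Union>C, \<Union>D)) = (case V of (C, D) \<Rightarrow> (\<Union>C, \<Union>D))"
      by (simp only: CD prod.case)
  qed
qed

lemma flatten_append_concat:
  "flatten (xs @ concat (map G Bs)) = flatten xs @ concat (map (\<lambda>B. flatten (G B)) Bs)"
  by (simp add: flatten_def map_concat o_def)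

text \<open>Partitions of the blocks of \<open>P\<close> combine to a refinement \<open>Q\<close> of
  \<open>P\<close>. The left side evaluates the coaction at \<open>Q\<close> and a grafted tree, the
  right side iterates it. Both are derivatives of \<open>f\<close> at one face \<open>X\<close> over
  \<open>Q\<close>, along \<open>flatten T\<close> followed by the flattened trees of the blocks;
  outside the domain both vanish.\<close>

lemma coaction_coassoc:
  assumes I: "finite I" and f: "f \<in> Gamma I"
  shows "Lie_assoc (\<lambda>S. faces {S}) I (comp_map_left I Lie_decomp (coaction I f))
    = comp_map_right I Gamma coaction (coaction I f)"
proof
  fix p :: "'a set set \<times> 'a set forest \<times> ('a set \<Rightarrow> 'a set set \<times> 'a set forest \<times> ('a set \<Rightarrow> 'a face))"
  obtain P T y where p: "p = (P, T, y)" by (metis prod_cases3)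
  let ?dom = "comp_dom layered_trees (\<lambda>S. faces {S})"
  let ?L = "tensor_map P (Gamma :: _ \<Rightarrow> ('a face \<Rightarrow> 'b) set) coaction"
  show "Lie_assoc (\<lambda>S. faces {S}) I (comp_map_left I Lie_decomp (coaction I f)) p
    = comp_map_right I Gamma coaction (coaction I f) p"
  proof (cases "partition_on I P")
    case False
    then show ?thesis by (simp add: p Lie_assoc_def comp_map_right_def comp_dom_def)
  next
    case P: True
    note L = tensor_map_coaction[OF I P]
    have fp: "fin_part P" and U: "\<Union>P = I" using I P by (simp_all add: fin_part_iff)
    have finS: "finite S" if "S \<in> P" for S
      using fp that by (auto simp: fin_part_def intro: finite_subset)
    have rhs: "comp_map_right I Gamma coaction (coaction I f) p = ?L (\<lambda>z. coaction I f (P, T, z)) y"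
      using P by (simp add: p comp_map_right_def)
    have zero: "(0 :: ('a set \<Rightarrow> 'a face) \<Rightarrow> 'b) \<in> tensor P Gamma"
      by (rule fun_vs.subspace_0[OF subspace_tensor])
    show ?thesis
    proof (cases "T \<in> layered_trees P")
      case False
      then have "(\<lambda>z. coaction I f (P, T, z)) = 0" by (simp add: coaction_apply[OF I P] zero_fun_def)
      then have "comp_map_right I Gamma coaction (coaction I f) p = 0"
        using rhs tensor_map_linear(1)[OF L zero zero] by simp
      then show ?thesis using False by (simp add: p Lie_assoc_def comp_dom_def)
    next
      case T: True
      have g: "tree_deriv I P T f \<in> tensor P Gamma"
        using tree_deriv(1)[OF fp _ T, unfolded U, OF f] .
      have rhs: "comp_map_right I Gamma coaction (coaction I f) p = ?L (tree_deriv I P T f) y"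
        using rhs T by (simp add: coaction_apply[OF I P])
      show ?thesis
      proof (cases "y \<in> PiE P ?dom")
        case False
        \<comment> \<open>Either \<open>y\<close> is not extensional or some factor
          \<open>coaction S (h S)\<close> vanishes at \<open>y S\<close>, so every pure tensor is
          sent to 0 at \<open>y\<close>.\<close>
        have "?L (tree_deriv I P T f) y = 0"
        proof (rule tensor_functional_eqI[where A = "\<lambda>t. ?L t y" and B = "\<lambda>t. 0", OF g])
          show "?L 0 y = 0" using tensor_map_linear(1)[OF L zero zero] by simp
          show "?L (fscale c p + s) y = c * ?L p y + ?L s y"
            if "p \<in> tensor P Gamma" "s \<in> tensor P Gamma" for c p s
            by (rule tensor_map_linear(2)[OF L that])
          fix h :: "'a set \<Rightarrow> 'a face \<Rightarrow> 'b" assume h: "\<And>S. S \<in> P \<Longrightarrow> h S \<in> Gamma S"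
          have *: "?L (pure_tensor P h) = pure_tensor P (\<lambda>S. coaction S (h S))"
            using L h unfolding is_tensor_map_def by blast
          have "pure_tensor P (\<lambda>S. coaction S (h S)) y = 0"
          proof (cases "y \<in> extensional P")
            case True
            with False obtain S where S: "S \<in> P" "y S \<notin> ?dom S" by (auto simp: PiE_iff)
            have "coaction S (h S) (y S) = 0"
              by (rule coaction_outside[OF finS[OF S(1)] h[OF S(1)] S(2)])
            then show ?thesis using S(1) fin_part_finite[OF fp] by (auto simp: pure_tensor_def)
          qed (simp add: pure_tensor_def)
          then show "?L (pure_tensor P h) y = 0" using * by simp
        qed simp_all
        then show ?thesis using False rhs by (simp add: p Lie_assoc_def comp_dom_def)
      next
        case y: True
        define part where "part S = fst (y S)" for S
        define tree where "tree S = fst (snd (y S))" for S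
        define arg where "arg S = snd (snd (y S))" for S
        have yS: "y S = (part S, tree S, arg S)" for S by (simp add: part_def tree_def arg_def)
        have part: "partition_on S (part S)" and tree: "tree S \<in> layered_trees (part S)"
          and arg: "arg S \<in> PiE (part S) (\<lambda>R. faces {R})" if "S \<in> P" for S
          using PiE_mem[OF y that] by (simp_all add: comp_dom_def yS)
        have fpS: "fin_part (part S)" and US: "\<Union>(part S) = S" if "S \<in> P" for S
          using part[OF that] finS[OF that] by (simp_all add: fin_part_iff)
        define Q where "Q = (\<Union>S\<in>P. part S)"
        define \<P> where "\<P> = part ` P"
        define block where "block R = (THE S. S \<in> P \<and> R \<subseteq> S)" for R
        define z where "z = (\<lambda>R\<in>Q. arg (block R) R)"
        \<comment> \<open>Parts are nonempty and the blocks of \<open>P\<close> are disjoint, so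
          each part lies in exactly one block.\<close>
        have block: "block R = S" if S: "S \<in> P" and R: "R \<in> part S" for S R
          unfolding block_def
        proof (rule the_equality)
          show "S \<in> P \<and> R \<subseteq> S" using S R US by blast
          fix S' assume "S' \<in> P \<and> R \<subseteq> S'"
          moreover obtain i where "i \<in> R" using fin_part_ne[OF fpS[OF S] R] by blast
          moreover have "R \<subseteq> S" using R US[OF S] by blast
          ultimately show "S' = S" using fin_part_eq[OF fp, of S' S i] S by blast
        qed
        have UQ: "\<Union>Q = I" unfolding Q_def using US U by blast
        have same: "S = S'" if "S \<in> P" "S' \<in> P" "R \<in> part S" "R \<in> part S'" for S S' R
          using block[of S R] block[of S' R] that by simp
        have fpQ: "fin_part Q"
          unfolding fin_part_def
        proof (intro conjI)
          show "finite (\<Union>Q)" using UQ I by simp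
          show "{} \<notin> Q" unfolding Q_def using fin_part_ne[OF fpS] by blast
          show "disjoint Q"
            unfolding disjoint_def
          proof (intro ballI impI)
            fix R R' assume R: "R \<in> Q" "R' \<in> Q" "R \<noteq> R'"
            then obtain S S' where S: "S \<in> P" "R \<in> part S" "S' \<in> P" "R' \<in> part S'"
              unfolding Q_def by blast
            show "R \<inter> R' = {}"
            proof (cases "S = S'")
              case True
              then show ?thesis using fin_part_disjoint[OF fpS[OF S(1)] S(2)] S(4) R(3) by blast
            next
              case False
              have "R \<subseteq> S" "R' \<subseteq> S'" using S US by blast+
              then show ?thesis using fin_part_disjoint[OF fp S(1,3) False] by blast
            qed
          qed
        qed
        have PQ: "partition_on I Q" using fpQ UQ I by (simp add: fin_part_iff)
        have finQ: "finite Q" using fpQ by (rule fin_part_finite)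
        \<comment> \<open>\<open>part S\<close> determines \<open>S\<close> as its union; hence
          \<open>T\<close> can be transported to a tree over \<open>\<P>\<close>.\<close>
        have inj: "inj_on part P" using US by (metis inj_onI)
        have UP: "\<Union>\<P> = Q" by (simp add: \<P>_def Q_def)
        have ne: "part S \<noteq> {}" if "S \<in> P" for S using US[OF that] fin_part_ne[OF fp that] by blast
        have fpP: "fin_part \<P>"
          unfolding fin_part_def UP
        proof (intro conjI finQ)
          show "{} \<notin> \<P>" using ne by (auto simp: \<P>_def)
          show "disjoint \<P>" using same by (fastforce simp: \<P>_def disjoint_def)
        qed
        have z: "z \<in> PiE Q (\<lambda>R. faces {R})"
        proof (rule PiE_I)
          fix R assume R: "R \<in> Q"
          then obtain S where S: "S \<in> P" "R \<in> part S" unfolding Q_def by blast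
          then show "z R \<in> faces {R}" using R PiE_mem[OF arg] block by (simp add: z_def)
        qed (simp add: z_def)
        \<comment> \<open>The face arguments of all blocks are glued to one face over
          \<open>Q\<close>, whose restrictions give back every \<open>arg S\<close>.\<close>
        obtain X where X: "X \<in> faces Q" "restrict (face_restrict X) Q = z" by (rule glue_blocks[OF fpQ z])
        have argX: "arg S = restrict (face_restrict X) (part S)" if S: "S \<in> P" for S
        proof
          fix R
          show "arg S R = restrict (face_restrict X) (part S) R"
          proof (cases "R \<in> part S")
            case True
            then have R: "R \<in> Q" using S by (auto simp: Q_def)
            have "face_restrict X R = z R" using fun_cong[OF X(2), of R] R by simp
            then show ?thesis using True R block[OF S True] by (simp add: z_def)
          next
            case False
            then show ?thesis using PiE_arb[OF arg[OF S] False] by simp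
          qed
        qed
        define T' where "T' = map_tree part T"
        define G where "G = (\<lambda>B\<in>\<P>. tree (\<Union>B))"
        have T': "T' \<in> layered_trees \<P>"
          unfolding T'_def \<P>_def by (rule map_tree_layered_trees[OF inj T])
        have G: "G B \<in> layered_trees B" if "B \<in> \<P>" for B
          using that tree US by (auto simp: G_def \<P>_def)
        \<comment> \<open>The same choice as in the definition of \<open>graft\<close>, so that the
          trees appear in exactly the order of the grafted list.\<close>
        define Bs where "Bs = (SOME Bs. distinct Bs \<and> set Bs = \<P>)"
        have "\<exists>Bs. distinct Bs \<and> set Bs = \<P>"
          using finite_distinct_list[OF fin_part_finite[OF fpP]] by blast
        then have Bs: "distinct Bs" "set Bs = \<P>" unfolding Bs_def by (metis (mono_tags, lifting) someI_ex)+
        have graft: "graft \<P> T' G = flatten T' @ concat (map G Bs)"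
          by (simp add: graft_def Bs_def)
        \<comment> \<open>\<open>flatten T'\<close> leads from \<open>{Q}\<close> to
          \<open>\<P>\<close>, and the trees \<open>G B\<close> lead from there to the
          singletons.\<close>
        have tree_graft: "graft \<P> T' G \<in> layered_trees Q"
        proof -
          have sg: "(\<Union>B\<in>\<P>. {B}) = \<P>" by simp
          have fl: "is_forest {Q} (flatten T')" "leaves {Q} (flatten T') = \<P>"
            using flatten_forest[OF fpP T'] UP by simp_all
          have "is_forest \<P> (concat (map G Bs)) \<and>
            leaves \<P> (concat (map G Bs)) = (\<Union>B\<in>\<P>. if B \<in> set Bs then leaves {B} (G B) else {B})"
            using forest_concat[of "\<lambda>B. {B}" \<P> Bs G] fpP Bs G unfolding sg
            by (simp add: layered_trees_def)
          moreover have "(\<Union>B\<in>\<P>. if B \<in> set Bs then leaves {B} (G B) else {B}) = (\<Union>B\<in>\<P>. {{R} |R. R \<in> B})"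
            using Bs(2) G by (intro SUP_cong refl) (simp add: layered_trees_def)
          moreover have "(\<Union>B\<in>\<P>. {{R} |R. R \<in> B}) = {{R} |R. R \<in> Q}" using UP by blast
          moreover have "Q \<noteq> {}" using T ne by (auto simp: layered_trees_def Q_def)
          ultimately show ?thesis
            using fl by (simp add: graft layered_trees_def is_forest_append leaves_append)
        qed
        have dom: "(\<P>, T', G) \<in> comp_dom layered_trees layered_trees Q"
          using fpP UP finQ T' G by (simp add: comp_dom_def fin_part_iff PiE_iff) (simp add: G_def)
        have "Lie_assoc (\<lambda>S. faces {S}) I (comp_map_left I Lie_decomp (coaction I f)) p
            = comp_map_left I Lie_decomp (coaction I f) (Q, (\<P>, T', G), z)"
        proof -
          have "(P, T, y) \<in> comp_dom layered_trees ?dom I" using P T y by (simp add: comp_dom_def)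
          then show ?thesis
            by (simp add: p Lie_assoc_def Let_def Q_def \<P>_def T'_def G_def z_def part_def[abs_def]
                tree_def arg_def block_def)
        qed
        also have "\<dots> = coaction I f (Q, graft \<P> T' G, z)"
          using PQ dom by (simp add: comp_map_left_def Lie_decomp_def)
        also have "\<dots> = forest_deriv {I} (flatten (graft \<P> T' G)) f X"
          using coaction_face[OF I PQ f tree_graft X(1)] X(2) by simp
        also have "flatten (graft \<P> T' G)
            = flatten T @ concat (map (\<lambda>S. flatten (tree S)) (map Union Bs))"
        proof -
          have "flatten (flatten T') = flatten T"
            unfolding T'_def by (rule flatten_map_tree_parts[OF T US])
          moreover have "map (\<lambda>B. flatten (G B)) Bs = map (\<lambda>S. flatten (tree S)) (map Union Bs)"
            using Bs(2) by (simp add: G_def)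
          ultimately show ?thesis by (simp only: graft flatten_append_concat)
        qed
        \<comment> \<open>\<open>Union\<close> maps \<open>\<P>\<close> bijectively onto
          \<open>P\<close>, so the order \<open>Bs\<close> chosen by \<open>graft\<close> yields an
          order of the blocks of \<open>P\<close>.\<close>
        also have "forest_deriv {I} \<dots> f X = ?L (tree_deriv I P T f) y"
        proof (rule coassociativity_at_forests[symmetric, OF I f P T part tree])
          show "X \<in> faces (\<Union>S\<in>P. part S)" using X(1) by (simp add: Q_def)
          show "y \<in> extensional P" using y by (simp add: PiE_iff)
          show "y S = (part S, tree S, restrict (face_restrict X) (part S))" if "S \<in> P" for S
            using yS argX[OF that] by simp
          have "inj_on Union (set Bs)"
            unfolding Bs(2) \<P>_def using US by (auto intro!: inj_onI)
          then show "distinct (map Union Bs)" using Bs(1) by (simp add: distinct_map)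
          show "set (map Union Bs) = P" using Bs(2) US by (auto simp: \<P>_def image_iff)
        qed
        finally show ?thesis using rhs by simp
      qed
    qed
  qed
qed

theorem corollary5p2p1:
  fixes I :: "'a set" and J :: "'b set" and \<sigma> :: "'a \<Rightarrow> 'b"
  assumes "finite I" and "bij_betw \<sigma> I J"
  shows
    "linear_on (Gamma I :: ('a face \<Rightarrow> 'k::field_char_0) set) (coaction I) \<and>
     (\<forall>f \<in> (Gamma I :: ('a face \<Rightarrow> 'k) set).
        coaction I f \<in> species_comp Lie_dual Gamma I \<and>
        (Gamma_relabel \<sigma> I J f \<in> Gamma J \<and>
         coaction J (Gamma_relabel \<sigma> I J f) = Lie_Gamma_relabel \<sigma> I J (coaction I f)) \<and>
        left_unitor I (comp_map_left I Lie_counit (coaction I f)) = f \<and>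
        Lie_assoc (\<lambda>S. faces {S}) I (comp_map_left I Lie_decomp (coaction I f))
          = comp_map_right I Gamma coaction (coaction I f))"
proof -
  interpret relabelling \<sigma> I J using assms by unfold_locales
  show ?thesis
    using linear_on_coaction[OF I] coaction_in_species_comp[OF I] Gamma_relabel_in_Gamma
      coaction_relabel coaction_counit[OF I] coaction_coassoc[OF I]
    by (intro conjI ballI)
qed

end
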